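(* Let $n\ge 1$ and let $P_n$ be the path with vertices $0,1,\dots,n-1$ (consecutive integers adjacent). Call a vertex central if it is the middle vertex $m$ when $n=2m+1$, or one of the two middle vertices $m-1,m$ when $n=2m$. Let $C_{P_n}=\{a: A_{P_n}(a,b)\ge 0\text{ for every vertex }b\}$ be the set of safe vertices of the first-passage location game on $P_n$. Then: (i) $C_{P_n}$ is exactly the set of central vertices of $P_n$ (so there is one safe vertex if $n$ is odd and there are two if $n$ is even); (ii) every central vertex $c$ strictly defeats every noncentral vertex $b$, i.e. $A_{P_n}(c,b)>0$; (iii) $\mathcal O(P_n)=\mathcal P(C_{P_n})$, $\operatorname{PNE}(P_n)=C_{P_n}\times C_{P_n}$, and $\operatorname{MNE}(P_n)=\mathcal P(C_{P_n})\times\mathcal P(C_{P_n})$, where $\mathcal P(C)$ denotes the set of probability measures on the vertex set that are supported on $C$. The degenerate paths $P_1$ and $P_2$ are included.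
   Context: Walk: on a finite connected graph $G=(V,E)$ the constant-speed walk waits at each nonisolated vertex an exponential time of mean one and then jumps to a uniformly random neighbor (so a path endpoint also has total jump rate one). On the one-vertex graph the walk stays put. Payoffs: for independent walks started at $a,b\in V$, let $\tau_z^{(a)},\tau_z^{(b)}$ be the first hitting times of $z\in V$ (equal to $0$ if the start is $z$), and set $$q_z(a,b)=\Pr(\tau_z^{(a)}<\tau_z^{(b)})+\tfrac12\Pr(\tau_z^{(a)}=\tau_z^{(b)}),\qquad U_G(a,b)=\sum_{z\in V}q_z(a,b),\qquad A_G(a,b)=U_G(a,b)-\tfrac{|V|}{2}.$$ Co-location is permitted, with the two walks independent given their common start; then $q_z(a,a)=1/2$. One has $U_G(a,b)+U_G(b,a)=|V|$. Game: two players simultaneously choose starting vertices $a$ and $b$ (or probability distributions over vertices); they receive $U_G(a,b)$ and $U_G(b,a)=|V|-U_G(a,b)$ (expectations in the mixed case). $\operatorname{PNE}(G)$ and $\operatorname{MNE}(G)$ are the sets of pure and of mixed Nash equilibria (ordered pairs of vertices, respectively of probability measures on $V$). The set of optimal strategies is $$\mathcal O(G)=\Bigl\{\mu\in\mathcal P(V):\ \sum_{a\in V}\mu(a)A_G(a,b)\ge 0\ \text{ for every } b\in V\Bigr\}.$$ *)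

theory Defs
  imports "HOL-Probability.Probability"
begin

section \<open>The constant-speed walk\<close>

text \<open>
  A finite simple graph is given by its vertex set \<open>V\<close> and its (symmetric, irreflexive)
  adjacency relation \<open>E\<close>.
\<close>

definition nbrs :: "'a set \<Rightarrow> ('a \<Rightarrow> 'a \<Rightarrow> bool) \<Rightarrow> 'a \<Rightarrow> 'a set" where
  "nbrs V E v = {w \<in> V. E v w}"

text \<open>At an isolated vertex the walk stays put: its jumps lead back to the same vertex.\<close>

definition jump_pmf :: "'a set \<Rightarrow> ('a \<Rightarrow> 'a \<Rightarrow> bool) \<Rightarrow> 'a \<Rightarrow> 'a pmf" where
  "jump_pmf V E v = (if nbrs V E v = {} then return_pmf v else pmf_of_set (nbrs V E v))"

text \<open>
  The sample space of one walk consists of i.i.d. pairs \<open>(s\<^sub>k, f\<^sub>k)\<close>, where \<open>s\<^sub>k\<close> is an exponential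
  holding time of mean one and, independently of it, \<open>f\<^sub>k\<close> assigns to every vertex \<open>v\<close> an
  independent sample \<open>f\<^sub>k v\<close> of \<open>jump_pmf V E v\<close>. The walk waits for time \<open>s\<^sub>k\<close> at its \<open>k\<close>-th
  position \<open>v\<close> (counting from 0) and then jumps to \<open>f\<^sub>k v\<close>. Since \<open>f\<^sub>k\<close> is independent of the
  positions up to the \<open>k\<close>-th one, these positions form the simple random walk on the graph,
  independent of the holding times.
\<close>

type_synonym 'a walk_sample = "(real \<times> ('a \<Rightarrow> 'a)) stream"

definition walk_measure :: "'a set \<Rightarrow> ('a \<Rightarrow> 'a \<Rightarrow> bool) \<Rightarrow> 'a walk_sample measure" where
  "walk_measure V E =
     stream_space (density lborel (\<lambda>x. ennreal (exponential_density 1 x))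
                   \<Otimes>\<^sub>M measure_pmf (Pi_pmf V undefined (jump_pmf V E)))"

primrec jump_chain :: "'a \<Rightarrow> 'a walk_sample \<Rightarrow> nat \<Rightarrow> 'a" where
  "jump_chain a \<omega> 0 = a"
| "jump_chain a \<omega> (Suc k) = snd (\<omega> !! k) (jump_chain a \<omega> k)"

definition jump_time :: "'a walk_sample \<Rightarrow> nat \<Rightarrow> real" where
  "jump_time \<omega> k = (\<Sum>i<k. fst (\<omega> !! i))"

text \<open>
  The jump times almost surely increase strictly to infinity, so that the least \<open>k\<close> below
  exists for every \<open>t \<ge> 0\<close> and is the number of jumps up to time \<open>t\<close>.
\<close>

definition walk :: "'a \<Rightarrow> 'a walk_sample \<Rightarrow> real \<Rightarrow> 'a" where
  "walk a \<omega> t = jump_chain a \<omega> (LEAST k. t < jump_time \<omega> (Suc k))"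

definition hitting_time :: "'a \<Rightarrow> 'a \<Rightarrow> 'a walk_sample \<Rightarrow> ereal" where
  "hitting_time z a \<omega> = (INF t \<in> {t. 0 \<le> t \<and> walk a \<omega> t = z}. ereal t)"


section \<open>The first-passage location game\<close>

text \<open>
  The two walks are driven by the two independent components of a product space. Ties, including
  the event that neither walk ever hits \<open>z\<close>, count one half.
\<close>

definition first_hit_prob :: "'a set \<Rightarrow> ('a \<Rightarrow> 'a \<Rightarrow> bool) \<Rightarrow> 'a \<Rightarrow> 'a \<Rightarrow> 'a \<Rightarrow> real" where
  "first_hit_prob V E z a b =
     \<P>(\<omega> in walk_measure V E \<Otimes>\<^sub>M walk_measure V E.
        hitting_time z a (fst \<omega>) < hitting_time z b (snd \<omega>))
     + 1 / 2 * \<P>(\<omega> in walk_measure V E \<Otimes>\<^sub>M walk_measure V E.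
        hitting_time z a (fst \<omega>) = hitting_time z b (snd \<omega>))"

definition payoff :: "'a set \<Rightarrow> ('a \<Rightarrow> 'a \<Rightarrow> bool) \<Rightarrow> 'a \<Rightarrow> 'a \<Rightarrow> real" where
  "payoff V E a b = (\<Sum>z\<in>V. first_hit_prob V E z a b)"

definition advantage :: "'a set \<Rightarrow> ('a \<Rightarrow> 'a \<Rightarrow> bool) \<Rightarrow> 'a \<Rightarrow> 'a \<Rightarrow> real" where
  "advantage V E a b = payoff V E a b - real (card V) / 2"

definition safe_vertices :: "'a set \<Rightarrow> ('a \<Rightarrow> 'a \<Rightarrow> bool) \<Rightarrow> 'a set" where
  "safe_vertices V E = {a \<in> V. \<forall>b\<in>V. advantage V E a b \<ge> 0}"

text \<open>The probability measures on the vertex set that are supported on \<open>C\<close>.\<close>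

definition prob_on :: "'a set \<Rightarrow> 'a pmf set" where
  "prob_on C = {\<mu>. set_pmf \<mu> \<subseteq> C}"

definition optimal_strategies :: "'a set \<Rightarrow> ('a \<Rightarrow> 'a \<Rightarrow> bool) \<Rightarrow> 'a pmf set" where
  "optimal_strategies V E =
     {\<mu> \<in> prob_on V. \<forall>b\<in>V. (\<Sum>a\<in>V. pmf \<mu> a * advantage V E a b) \<ge> 0}"

text \<open>
  If the players choose \<open>a\<close> and \<open>b\<close>, they receive \<open>payoff V E a b\<close> and \<open>payoff V E b a\<close> respectively.
\<close>

definition PNE :: "'a set \<Rightarrow> ('a \<Rightarrow> 'a \<Rightarrow> bool) \<Rightarrow> ('a \<times> 'a) set" where
  "PNE V E = {(a, b). a \<in> V \<and> b \<in> V \<and>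
     (\<forall>a'\<in>V. payoff V E a' b \<le> payoff V E a b) \<and>
     (\<forall>b'\<in>V. payoff V E b' a \<le> payoff V E b a)}"

definition mixed_payoff :: "'a set \<Rightarrow> ('a \<Rightarrow> 'a \<Rightarrow> bool) \<Rightarrow> 'a pmf \<Rightarrow> 'a pmf \<Rightarrow> real" where
  "mixed_payoff V E \<mu> \<nu> = measure_pmf.expectation (pair_pmf \<mu> \<nu>) (\<lambda>(a, b). payoff V E a b)"

definition MNE :: "'a set \<Rightarrow> ('a \<Rightarrow> 'a \<Rightarrow> bool) \<Rightarrow> ('a pmf \<times> 'a pmf) set" where
  "MNE V E = {(\<mu>, \<nu>). \<mu> \<in> prob_on V \<and> \<nu> \<in> prob_on V \<and>
     (\<forall>\<mu>'\<in>prob_on V. mixed_payoff V E \<mu>' \<nu> \<le> mixed_payoff V E \<mu> \<nu>) \<and>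
     (\<forall>\<nu>'\<in>prob_on V. mixed_payoff V E \<nu>' \<mu> \<le> mixed_payoff V E \<nu> \<mu>)}"


section \<open>Paths\<close>

definition path_verts :: "nat \<Rightarrow> nat set" where
  "path_verts n = {0..<n}"

definition path_adj :: "nat \<Rightarrow> nat \<Rightarrow> bool" where
  "path_adj i j \<longleftrightarrow> j = i + 1 \<or> i = j + 1"

definition central_vertices :: "nat \<Rightarrow> nat set" where
  "central_vertices n =
     {c. \<exists>m. (n = 2 * m + 1 \<and> c = m) \<or> (n = 2 * m \<and> m \<ge> 1 \<and> (c = m - 1 \<or> c = m))}"

end

theory Submission
  imports Defs
begin

text \<open>
  For a fixed target \<open>z\<close> the winning probability \<open>q\<^sub>z a b\<close> is a bounded function on the grid that is discretely
  harmonic in \<open>(a, b)\<close> as long as neither walk has hit \<open>z\<close>, with reflection at the ends of the path. Hence the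
  advantage is superharmonic, up to its source on the edge \<open>b = N\<close>, on the triangle \<open>a < b\<close>, \<open>a + b > N\<close>, where
  \<open>N = n - 1\<close>, and it vanishes on the two other sides by antisymmetry and reflection. There it is compared by the
  minimum principle with an explicit harmonic polynomial that vanishes on the same two sides and is positive when
  \<open>a\<close> is central. The comparison reduces to a lower bound for the source on the edge; two of its three terms are
  estimated by explicit superharmonic functions, and the third by the first modes of its expansion in products of
  sines and hyperbolic cosines. The resulting inequality is verified numerically for \<open>N < 20\<close> and, in terms of
  the ratio of the two distances to the ends, for \<open>N \<ge> 20\<close>. The equilibria then follow as in any symmetric zero-sum game
  with a set of mutually equivalent strategies that beat all others.
\<close>

section \<open>Hitting times and duels of independent walks\<close>

text \<open>On the edge \<open>y = N\<close> the source itself can be negative (already for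
  \<open>N = 4\<close>, \<open>x = 1\<close>), so comparing the advantage with 0 would fail; the
  barrier carries this negative part. For \<open>D = N - x\<close> proportional to \<open>N\<close>
  its charge is of order \<open>N ^ 3\<close> and the source of order \<open>1 / N\<close>, so the
  multiple used is a constant over \<open>N ^ 4\<close>. With \<open>t = D / N\<close> the claim
  becomes, up to lower order terms,
  \<open>172 / 100 * (1 - 6 * t ^ 2 + 4 * t ^ 3) < N * source\<close>. The constant has to be large
  where the cubic is negative: the bound used for \<open>t \<ge> 7 / 8\<close> needs more than 1.68.
  It has to be small where the cubic is positive: the estimates used for
  \<open>t \<le> 1 / 3\<close> allow at most about 1.722. The value 1.72 lies in this window. Until
  a walk hits \<open>z\<close> it stays on its side of \<open>z\<close>, so every winning
  probability depends only on the two distances to \<open>z\<close> and the widths of the sides.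
  Monotonicity in these widths is what makes different targets comparable and allows a width to be
  replaced by a more convenient one.\<close>

definition first_passage :: "'a \<Rightarrow> 'a \<Rightarrow> 'a walk_sample \<Rightarrow> ereal" where
  "first_passage z a \<omega> =
     (if \<exists>k. jump_chain a \<omega> k = z then ereal (jump_time \<omega> (LEAST k. jump_chain a \<omega> k = z)) else \<infinity>)"

lemma jump_time_mono:
  assumes pos: "\<And>k. 0 < fst (\<omega> !! k)" and "j \<le> k"
  shows "jump_time \<omega> j \<le> jump_time \<omega> k"
  unfolding jump_time_def using assms by (intro sum_mono2) (auto intro: less_imp_le)

text \<open>Positive holding times make the jump times strictly increasing, so the index selected by
  \<open>walk\<close> at time \<open>jump_time \<omega> k\<close> is \<open>k\<close> itself. Unlike
  the infimum over real times, \<open>first_passage\<close> satisfies a one-step recursion along the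
  stream.\<close>

lemma hitting_time_eq_first_passage:
  assumes pos: "\<And>k. 0 < fst (\<omega> !! k)"
  shows "hitting_time z a \<omega> = first_passage z a \<omega>"
proof (cases "\<exists>k. jump_chain a \<omega> k = z")
  case False
  then have "walk a \<omega> t \<noteq> z" for t by (auto simp: walk_def)
  then show ?thesis using False by (simp add: hitting_time_def first_passage_def top_ereal_def)
next
  case True
  define k where "k = (LEAST k. jump_chain a \<omega> k = z)"
  have k: "jump_chain a \<omega> k = z" unfolding k_def using True by (rule LeastI_ex)
  have least: "jump_chain a \<omega> j \<noteq> z" if "j < k" for j
    using that not_less_Least unfolding k_def by blast
  have step: "jump_time \<omega> (Suc j) = jump_time \<omega> j + fst (\<omega> !! j)" for j
    by (simp add: jump_time_def)
  have nonneg: "0 \<le> jump_time \<omega> k" using jump_time_mono[OF pos, of 0 k] by (simp add: jump_time_def)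
  have "(LEAST j. jump_time \<omega> k < jump_time \<omega> (Suc j)) = k"
  proof (rule Least_equality)
    show "jump_time \<omega> k < jump_time \<omega> (Suc k)" using pos[of k] by (simp add: step)
    fix j assume j: "jump_time \<omega> k < jump_time \<omega> (Suc j)"
    then show "k \<le> j" using jump_time_mono[OF pos, of "Suc j" k] by (meson not_less not_less_eq_eq)
  qed
  then have at: "walk a \<omega> (jump_time \<omega> k) = z" by (simp add: walk_def k)
  have before: "jump_time \<omega> k \<le> t" if "walk a \<omega> t = z" "0 \<le> t" for t
  proof (rule ccontr)
    assume "\<not> jump_time \<omega> k \<le> t"
    then have t: "t < jump_time \<omega> k" by simp
    then obtain i where i: "k = Suc i" using \<open>0 \<le> t\<close> by (cases k) (auto simp: jump_time_def)
    then have "(LEAST j. t < jump_time \<omega> (Suc j)) \<le> i" using t by (intro Least_le) simp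
    then have "walk a \<omega> t \<noteq> z" unfolding walk_def using least i by simp
    then show False using that by simp
  qed
  have "hitting_time z a \<omega> = ereal (jump_time \<omega> k)"
    unfolding hitting_time_def
  proof (rule antisym)
    show "(INF t\<in>{t. 0 \<le> t \<and> walk a \<omega> t = z}. ereal t) \<le> ereal (jump_time \<omega> k)"
      using nonneg at by (intro INF_lower) auto
    show "ereal (jump_time \<omega> k) \<le> (INF t\<in>{t. 0 \<le> t \<and> walk a \<omega> t = z}. ereal t)"
      using before by (intro INF_greatest) auto
  qed
  then show ?thesis using True by (simp add: first_passage_def k_def)
qed

lemma jump_chain_Stream: "jump_chain a (x ## \<omega>) (Suc k) = jump_chain (snd x a) \<omega> k"
  by (induction k) auto

lemma jump_time_Stream: "jump_time (x ## \<omega>) (Suc k) = fst x + jump_time \<omega> k"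
  unfolding jump_time_def by (subst sum.lessThan_Suc_shift) simp

lemma first_passage_start: "first_passage z z \<omega> = 0"
proof -
  have "(LEAST k. jump_chain z \<omega> k = z) = 0" by (rule Least_equality) auto
  moreover have "\<exists>k. jump_chain z \<omega> k = z" by (rule exI[of _ 0]) simp
  ultimately show ?thesis by (simp add: first_passage_def jump_time_def zero_ereal_def)
qed

lemma first_passage_Stream:
  assumes "a \<noteq> z"
  shows "first_passage z a (x ## \<omega>) = ereal (fst x) + first_passage z (snd x a) \<omega>"
proof (cases "\<exists>k. jump_chain (snd x a) \<omega> k = z")
  case True
  then obtain k where k: "jump_chain a (x ## \<omega>) (Suc k) = z" by (auto simp only: jump_chain_Stream)
  have "(LEAST k. jump_chain a (x ## \<omega>) k = z) = Suc (LEAST k. jump_chain a (x ## \<omega>) (Suc k) = z)"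
    by (rule Least_Suc[of "\<lambda>k. jump_chain a (x ## \<omega>) k = z", OF k]) (use assms in simp)
  moreover have "\<exists>k. jump_chain a (x ## \<omega>) k = z" using k by (rule exI)
  ultimately show ?thesis
    using True by (simp add: first_passage_def jump_chain_Stream jump_time_Stream del: jump_chain.simps)
next
  case False
  have "jump_chain a (x ## \<omega>) k \<noteq> z" for k
  proof (cases k)
    case (Suc j)
    then show ?thesis using False by (simp add: jump_chain_Stream del: jump_chain.simps)
  qed (use assms in simp)
  then show ?thesis using False by (simp add: first_passage_def)
qed

lemma first_passage_not_MInfty: "first_passage z a \<omega> \<noteq> -\<infinity>"
  by (simp add: first_passage_def)

text \<open>Proved for every sample, including those where the jump times misbehave: the events in
  \<open>first_hit_prob\<close> are stated with \<open>hitting_time\<close>, whose measurability has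
  to be shown on the whole space before null sets can be discarded.\<close>

lemma walk_right_constant:
  "\<exists>\<delta>>0. \<forall>s. t \<le> s \<and> s < t + \<delta> \<longrightarrow> walk a \<omega> s = walk a \<omega> t"
proof (cases "\<exists>k. t < jump_time \<omega> (Suc k)")
  case True
  define K where "K = (LEAST k. t < jump_time \<omega> (Suc k))"
  have K: "t < jump_time \<omega> (Suc K)" unfolding K_def using True by (rule LeastI_ex)
  have least: "jump_time \<omega> (Suc j) \<le> t" if "j < K" for j
    using not_less_Least[of j "\<lambda>k. t < jump_time \<omega> (Suc k)"] that unfolding K_def by (simp add: not_less)
  have "(LEAST k. s < jump_time \<omega> (Suc k)) = K" if s: "t \<le> s" "s < jump_time \<omega> (Suc K)" for s
  proof (rule Least_equality)
    fix j assume "s < jump_time \<omega> (Suc j)"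
    then show "K \<le> j" using least[of j] s by (cases "j < K") auto
  qed (use s in simp)
  then have "walk a \<omega> s = walk a \<omega> t" if "t \<le> s" "s < t + (jump_time \<omega> (Suc K) - t)" for s
    unfolding walk_def K_def[symmetric] using that by simp
  moreover have "0 < jump_time \<omega> (Suc K) - t" using K by simp
  ultimately show ?thesis by blast
next
  case False
  \<comment> \<open>If no jump time exceeds \<open>t\<close>, the \<open>LEAST\<close> is an
    unspecified number, but it is the \<open>LEAST\<close> of the same empty predicate at all later
    times.\<close>
  have eq: "(\<lambda>k. s < jump_time \<omega> (Suc k)) = (\<lambda>k. t < jump_time \<omega> (Suc k))" if "t \<le> s" for s
  proof
    fix k
    show "(s < jump_time \<omega> (Suc k)) = (t < jump_time \<omega> (Suc k))"
    proof -
      have "\<not> t < jump_time \<omega> (Suc k)" using False by blast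
      then show ?thesis using that by linarith
    qed
  qed
  have "walk a \<omega> s = walk a \<omega> t" if "t \<le> s" for s
    unfolding walk_def by (rule arg_cong[where f = "\<lambda>P. jump_chain a \<omega> (Least P)", OF eq[OF that]])
  moreover have "(0 :: real) < 1" by simp
  ultimately show ?thesis by blast
qed

text \<open>Right-continuity of the walk reduces the infimum to a countable one.\<close>

lemma hitting_time_rational:
  "hitting_time z a \<omega> = (INF q\<in>{q \<in> \<rat>. 0 \<le> q}. if walk a \<omega> q = z then ereal q else \<infinity>)"
  (is "_ = ?R")
proof (rule antisym)
  show "hitting_time z a \<omega> \<le> ?R"
    unfolding hitting_time_def
  proof (rule INF_greatest)
    fix q :: real assume q: "q \<in> {q \<in> \<rat>. 0 \<le> q}"
    show "(INF t\<in>{t. 0 \<le> t \<and> walk a \<omega> t = z}. ereal t) \<le> (if walk a \<omega> q = z then ereal q else \<infinity>)"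
    proof (cases "walk a \<omega> q = z")
      case True
      then have "(INF t\<in>{t. 0 \<le> t \<and> walk a \<omega> t = z}. ereal t) \<le> ereal q"
        using q by (intro INF_lower) simp
      then show ?thesis using True by simp
    qed simp
  qed
  show "?R \<le> hitting_time z a \<omega>"
    unfolding hitting_time_def
  proof (intro INF_greatest)
    fix t assume "t \<in> {t. 0 \<le> t \<and> walk a \<omega> t = z}"
    then have t: "0 \<le> t" "walk a \<omega> t = z" by auto
    show "?R \<le> ereal t"
    proof (rule ereal_le_epsilon2)
      fix e :: real assume "0 < e"
      obtain \<delta> where \<delta>: "0 < \<delta>" "\<And>s. t \<le> s \<Longrightarrow> s < t + \<delta> \<Longrightarrow> walk a \<omega> s = walk a \<omega> t"
        using walk_right_constant by metis
      obtain q where q: "q \<in> \<rat>" "t < q" "q < t + min e \<delta>"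
        using Rats_dense_in_real[of t "t + min e \<delta>"] \<open>0 < e\<close> \<open>0 < \<delta>\<close> by auto
      have w: "walk a \<omega> q = z" using \<delta>(2)[of q] q t by simp
      have "?R \<le> (if walk a \<omega> q = z then ereal q else \<infinity>)"
        by (rule INF_lower) (use q t in simp)
      also have "\<dots> = ereal q" by (simp only: w if_True refl)
      also have "\<dots> \<le> ereal (t + e)" using q by simp
      also have "\<dots> = ereal t + ereal e" by simp
      finally show "?R \<le> ereal t + ereal e" .
    qed
  qed
qed

section \<open>Measurability and the first-step decomposition of one walk\<close>

definition step_measure :: "'a set \<Rightarrow> ('a \<Rightarrow> 'a \<Rightarrow> bool) \<Rightarrow> (real \<times> ('a \<Rightarrow> 'a)) measure" where
  "step_measure V E = density lborel (\<lambda>x. ennreal (exponential_density 1 x))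
                   \<Otimes>\<^sub>M measure_pmf (Pi_pmf V undefined (jump_pmf V E))"

abbreviation exp_measure :: "real measure" where
  "exp_measure \<equiv> density lborel (\<lambda>x. ennreal (exponential_density 1 x))"

lemma walk_measure_eq: "walk_measure V E = stream_space (step_measure V E)"
  by (simp add: walk_measure_def step_measure_def)

lemma prob_space_exp_measure: "prob_space exp_measure"
  by (rule prob_space_exponential_density) simp

lemma prob_space_step_measure: "prob_space (step_measure V E)"
proof -
  interpret A: prob_space exp_measure by (rule prob_space_exp_measure)
  interpret B: prob_space "measure_pmf (Pi_pmf V undefined (jump_pmf V E))" by (rule prob_space_measure_pmf)
  interpret pair_prob_space exp_measure "measure_pmf (Pi_pmf V undefined (jump_pmf V E))" ..
  show ?thesis unfolding step_measure_def by (rule prob_space_axioms)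
qed

lemma prob_space_walk_measure: "prob_space (walk_measure V E)"
  unfolding walk_measure_eq by (rule prob_space.prob_space_stream_space[OF prob_space_step_measure])

lemma sets_step_measure [measurable_cong]: "sets (step_measure V E) = sets (borel \<Otimes>\<^sub>M count_space UNIV)"
  unfolding step_measure_def by (intro sets_pair_measure_cong) auto

lemma sets_walk_measure [measurable_cong]:
  "sets (walk_measure V E) = sets (stream_space (borel \<Otimes>\<^sub>M count_space UNIV))"
  unfolding walk_measure_eq by (intro sets_stream_space_cong sets_step_measure)

lemma measurable_jump_time [measurable]: "(\<lambda>\<omega>. jump_time \<omega> k) \<in> borel_measurable (walk_measure V E)"
  unfolding jump_time_def by measurable

lemma measurable_jump_chain [measurable]:
  fixes a :: "'a :: countable"
  shows "(\<lambda>\<omega>. jump_chain a \<omega> k) \<in> measurable (walk_measure V E) (count_space UNIV)"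
proof (induction k)
  case (Suc k)
  have "(\<lambda>\<omega>. snd (\<omega> !! k) v) \<in> measurable (walk_measure V E) (count_space UNIV)" for v
    by (rule measurable_compose[of _ _ "count_space UNIV" "\<lambda>f. f v"]) measurable
  then show ?case
    using measurable_compose_countable[of "\<lambda>v \<omega>. snd (\<omega> !! k) v", OF _ Suc] by simp
qed simp

lemma measurable_first_passage [measurable]:
  fixes a :: "'a :: countable"
  shows "first_passage z a \<in> borel_measurable (walk_measure V E)"
proof -
  have [measurable]: "(\<lambda>\<omega>. jump_time \<omega> (LEAST k. jump_chain a \<omega> k = z)) \<in> borel_measurable (walk_measure V E)"
    by (rule measurable_compose_countable[of "\<lambda>k \<omega>. jump_time \<omega> k"]) measurable
  show ?thesis unfolding first_passage_def[abs_def] by measurable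
qed

lemma measurable_hitting_time [measurable]:
  fixes a :: "'a :: countable"
  shows "hitting_time z a \<in> borel_measurable (walk_measure V E)"
proof -
  have [measurable]: "(\<lambda>\<omega>. walk a \<omega> t) \<in> measurable (walk_measure V E) (count_space UNIV)" for t
    unfolding walk_def
    by (rule measurable_compose_countable[of "\<lambda>k \<omega>. jump_chain a \<omega> k"]) measurable
  have "countable {q \<in> \<rat>. 0 \<le> (q :: real)}" by (rule countable_subset[OF _ countable_rat]) auto
  then show ?thesis
    unfolding hitting_time_rational[abs_def] by (intro borel_measurable_INF) measurable
qed

lemma AE_holding_times_pos: "AE \<omega> in walk_measure V E. \<forall>k. 0 < fst (\<omega> !! k)"
proof -
  interpret S: prob_space "step_measure V E" by (rule prob_space_step_measure)
  interpret A: prob_space exp_measure by (rule prob_space_exp_measure)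
  interpret B: prob_space "measure_pmf (Pi_pmf V undefined (jump_pmf V E))" by (rule prob_space_measure_pmf)
  interpret P: pair_prob_space exp_measure "measure_pmf (Pi_pmf V undefined (jump_pmf V E))" ..
  have "AE x in lborel. x \<noteq> (0 :: real)" by (rule AE_lborel_singleton)
  then have "AE e in exp_measure. 0 < e"
    by (subst AE_density) (auto simp: exponential_density_def elim!: eventually_mono)
  then have "AE e in exp_measure. AE f in measure_pmf (Pi_pmf V undefined (jump_pmf V E)). 0 < fst (e, f)"
    by (rule eventually_mono) simp
  then have "AE x in step_measure V E. 0 < fst x"
    unfolding step_measure_def by (rule P.AE_pair_measure[rotated]) measurable
  then have "AE \<omega> in walk_measure V E. stream_all (\<lambda>x. 0 < fst x) \<omega>"
    unfolding walk_measure_eq by (intro S.AE_stream_all) measurable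
  then show ?thesis
  proof (rule eventually_mono)
    fix \<omega> :: "'a walk_sample" assume "stream_all (\<lambda>x. 0 < fst x) \<omega>"
    then have "\<forall>x\<in>sset \<omega>. 0 < fst x" by (simp add: stream.pred_set)
    then show "\<forall>k. 0 < fst (\<omega> !! k)" using snth_sset by blast
  qed
qed

text \<open>The head of the stream is split off; its holding time and jump function are independent,
  and only the component of the jump function at \<open>a\<close> matters. The holding time is
  integrated innermost so that identities for exponential averages can be applied pointwise in the
  rest of the path.\<close>

lemma nn_integral_first_passage:
  fixes a :: "'a :: countable"
  assumes V: "finite V" "a \<in> V" and "a \<noteq> z" and [measurable]: "F \<in> borel_measurable borel"
  shows "(\<integral>\<^sup>+\<omega>. F (first_passage z a \<omega>) \<partial>walk_measure V E) =
    (\<integral>\<^sup>+a'. \<integral>\<^sup>+\<omega>. \<integral>\<^sup>+e. F (ereal e + first_passage z a' \<omega>) \<partial>exp_measure \<partial>walk_measure V E \<partial>measure_pmf (jump_pmf V E a))"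
proof -
  let ?P = "Pi_pmf V undefined (jump_pmf V E)"
  let ?W = "walk_measure V E" and ?M = "step_measure V E"
  interpret M: prob_space ?M by (rule prob_space_step_measure)
  interpret W: prob_space ?W by (rule prob_space_walk_measure)
  interpret A: prob_space exp_measure by (rule prob_space_exp_measure)
  interpret B: prob_space "measure_pmf ?P" by (rule prob_space_measure_pmf)
  interpret AB: pair_sigma_finite exp_measure "measure_pmf ?P" ..
  interpret AW: pair_sigma_finite exp_measure ?W ..
  have [measurable]: "(\<lambda>x. snd x a) \<in> measurable ?M (count_space UNIV)"
    by (rule measurable_compose[of _ _ "count_space UNIV" "\<lambda>f. f a"]) measurable
  have [measurable]: "(\<lambda>y. first_passage z (snd (fst y) a) (snd y)) \<in> borel_measurable (?M \<Otimes>\<^sub>M ?W)"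
    by (rule measurable_compose_countable[of "\<lambda>v y. first_passage z v (snd y)"]) measurable
  have [measurable]: "(\<lambda>x. \<integral>\<^sup>+\<omega>. F (ereal (fst x) + first_passage z (snd x a) \<omega>) \<partial>?W) \<in> borel_measurable ?M"
    by measurable
  have "(\<integral>\<^sup>+\<omega>. F (first_passage z a \<omega>) \<partial>?W) =
      (\<integral>\<^sup>+x. \<integral>\<^sup>+\<omega>. F (first_passage z a (x ## \<omega>)) \<partial>?W \<partial>?M)"
    unfolding walk_measure_eq
    by (rule M.nn_integral_stream_space) (simp add: walk_measure_eq[symmetric])
  also have "\<dots> = (\<integral>\<^sup>+x. \<integral>\<^sup>+\<omega>. F (ereal (fst x) + first_passage z (snd x a) \<omega>) \<partial>?W \<partial>?M)"
    by (simp add: first_passage_Stream[OF \<open>a \<noteq> z\<close>])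
  also have "\<dots> = (\<integral>\<^sup>+f. \<integral>\<^sup>+e. \<integral>\<^sup>+\<omega>. F (ereal e + first_passage z (f a) \<omega>) \<partial>?W \<partial>exp_measure \<partial>measure_pmf ?P)"
    unfolding step_measure_def
    by (subst AB.nn_integral_snd[symmetric]) (simp_all add: step_measure_def[symmetric])
  also have "\<dots> = (\<integral>\<^sup>+f. \<integral>\<^sup>+\<omega>. \<integral>\<^sup>+e. F (ereal e + first_passage z (f a) \<omega>) \<partial>exp_measure \<partial>?W \<partial>measure_pmf ?P)"
    by (intro nn_integral_cong AW.Fubini'[symmetric]) measurable
  also have "\<dots> = (\<integral>\<^sup>+a'. \<integral>\<^sup>+\<omega>. \<integral>\<^sup>+e. F (ereal e + first_passage z a' \<omega>) \<partial>exp_measure \<partial>?W \<partial>measure_pmf (map_pmf (\<lambda>f. f a) ?P))"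
    by simp
  also have "\<dots> = (\<integral>\<^sup>+a'. \<integral>\<^sup>+\<omega>. \<integral>\<^sup>+e. F (ereal e + first_passage z a' \<omega>) \<partial>exp_measure \<partial>?W \<partial>measure_pmf (jump_pmf V E a))"
    using V by (simp only: Pi_pmf_component if_True)
  finally show ?thesis .
qed

section \<open>Races between exponential clocks\<close>

lemma ennreal_average:
  assumes "0 \<le> p" "0 \<le> q"
  shows "(ennreal p + ennreal q) / 2 = ennreal ((p + q) / 2)"
  using divide_ennreal[of "p + q" 2] assms by (simp add: ennreal_plus)

text \<open>Valued in \<open>ennreal\<close>, so that exchanging integrals requires measurability
  only.\<close>

definition half_win :: "ereal \<Rightarrow> ereal \<Rightarrow> ennreal" where
  "half_win s t = (if s < t then 1 else if s = t then ennreal (1 / 2) else 0)"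

lemma measurable_half_win [measurable (raw)]:
  assumes [measurable]: "f \<in> borel_measurable M" "g \<in> borel_measurable M"
  shows "(\<lambda>x. half_win (f x) (g x)) \<in> borel_measurable M"
  unfolding half_win_def by measurable

lemma emeasure_exp_measure_greaterThan: "emeasure exp_measure {c<..} = ennreal (exp (- max 0 c))"
proof -
  interpret prob_space exp_measure by (rule prob_space_exp_measure)
  have D: "distributed exp_measure lborel (\<lambda>x. x) (exponential_density 1)"
    unfolding distributed_def by (simp add: distr_id2)
  have ge: "emeasure exp_measure {c<..} = ennreal (exp (- c))" if "0 \<le> c" for c
    using exponential_distributedD_gt[OF D that]
    by (simp add: emeasure_eq_measure greaterThan_def)
  show ?thesis
  proof (cases "0 \<le> c")
    case False
    then have "emeasure exp_measure {0<..} \<le> emeasure exp_measure {c<..}" by (intro emeasure_mono) auto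
    then have "emeasure exp_measure {c<..} = 1"
      using ge[of 0] emeasure_le_1[of "{c<..}"] by simp
    then show ?thesis using False by simp
  qed (use ge in simp)
qed

lemma AE_exp_measure_neq: "AE e in exp_measure. e \<noteq> c"
proof -
  have "AE e in lborel. 0 < ennreal (exponential_density 1 e) \<longrightarrow> e \<noteq> c"
    by (rule eventually_mono[OF AE_lborel_singleton[of c]]) simp
  then show ?thesis by (subst AE_density) simp_all
qed

lemma nn_integral_half_win_right:
  "(\<integral>\<^sup>+e. half_win (ereal s) (ereal e + ereal t) \<partial>exp_measure) = ennreal (exp (- max 0 (s - t)))"
proof -
  have "(\<integral>\<^sup>+e. half_win (ereal s) (ereal e + ereal t) \<partial>exp_measure) = (\<integral>\<^sup>+e. indicator {s - t<..} e \<partial>exp_measure)"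
  proof (rule nn_integral_cong_AE, rule eventually_mono[OF AE_exp_measure_neq[of "s - t"]])
    fix e assume "e \<noteq> s - t"
    then show "half_win (ereal s) (ereal e + ereal t) = indicator {s - t<..} e" by (auto simp: half_win_def indicator_def)
  qed
  then show ?thesis by (simp add: emeasure_exp_measure_greaterThan)
qed

lemma nn_integral_half_win_left:
  "(\<integral>\<^sup>+e. half_win (ereal e + ereal s) (ereal t) \<partial>exp_measure) = ennreal (1 - exp (- max 0 (t - s)))"
proof -
  interpret prob_space exp_measure by (rule prob_space_exp_measure)
  have "(\<integral>\<^sup>+e. half_win (ereal e + ereal s) (ereal t) \<partial>exp_measure) = (\<integral>\<^sup>+e. indicator (- {t - s<..}) e \<partial>exp_measure)"
  proof (rule nn_integral_cong_AE, rule eventually_mono[OF AE_exp_measure_neq[of "t - s"]])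
    fix e assume "e \<noteq> t - s"
    then show "half_win (ereal e + ereal s) (ereal t) = indicator (- {t - s<..}) e" by (auto simp: half_win_def indicator_def)
  qed
  also have "\<dots> = emeasure exp_measure (space exp_measure - {t - s<..})"
  proof -
    have "space exp_measure - {t - s<..} = - {t - s<..}" by auto
    then show ?thesis by simp
  qed
  also have "\<dots> = emeasure exp_measure (space exp_measure) - emeasure exp_measure {t - s<..}"
    by (rule emeasure_compl) auto
  also have "\<dots> = 1 - emeasure exp_measure {t - s<..}" by (simp only: emeasure_space_1)
  finally show ?thesis
    using ennreal_minus[of "exp (- max 0 (t - s))" 1] by (simp add: emeasure_exp_measure_greaterThan)
qed

lemma nn_integral_exp_measure_exp:
  assumes "0 \<le> d"
  shows "(\<integral>\<^sup>+e. ennreal (exp (- max 0 (e - d))) \<partial>exp_measure) = ennreal (1 - exp (- d) / 2)"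
proof -
  have "(\<integral>\<^sup>+e. ennreal (exp (- max 0 (e - d))) \<partial>exp_measure) =
      (\<integral>\<^sup>+e. ennreal (exponential_density 1 e) * ennreal (exp (- max 0 (e - d))) \<partial>lborel)"
    by (subst nn_integral_density) auto
  also have "\<dots> = (\<integral>\<^sup>+e. ennreal (exp (- e)) * indicator {0..d} e + ennreal (exp (d - 2 * e)) * indicator {d..} e \<partial>lborel)"
  proof (rule nn_integral_cong_AE, rule eventually_mono[OF AE_lborel_singleton[of d]])
    fix x :: real assume "x \<noteq> d"
    then show "ennreal (exponential_density 1 x) * ennreal (exp (- max 0 (x - d))) =
        ennreal (exp (- x)) * indicator {0..d} x + ennreal (exp (d - 2 * x)) * indicator {d..} x"
      using assms by (auto simp: exponential_density_def indicator_def ennreal_mult[symmetric] exp_add[symmetric])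
  qed
  also have "\<dots> = (\<integral>\<^sup>+e. ennreal (exp (- e)) * indicator {0..d} e \<partial>lborel) + (\<integral>\<^sup>+e. ennreal (exp (d - 2 * e)) * indicator {d..} e \<partial>lborel)"
    by (rule nn_integral_add) auto
  also have "(\<integral>\<^sup>+e. ennreal (exp (- e)) * indicator {0..d} e \<partial>lborel) = ennreal (- exp (- d) - (- exp (- 0)))"
    by (rule nn_integral_FTC_Icc) (auto intro!: derivative_eq_intros assms)
  also have "(\<integral>\<^sup>+e. ennreal (exp (d - 2 * e)) * indicator {d..} e \<partial>lborel) = ennreal (0 - (- exp (d - 2 * d) / 2))"
  proof (rule nn_integral_FTC_atLeast[where F = "\<lambda>x. - exp (d - 2 * x) / 2" and T = 0])
    show "((\<lambda>x. - exp (d - 2 * x) / 2) \<longlongrightarrow> 0) at_top" by real_asymp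
  qed (auto intro!: derivative_eq_intros)
  finally show ?thesis using assms by (simp add: ennreal_plus[symmetric] del: ennreal_plus)
qed

text \<open>Each clock rings first with probability one half, and the other then starts afresh. This
  is verified by computation: both sides depend only on \<open>d = t - s\<close>, through the
  exponential tail.\<close>

lemma half_win_memoryless_real:
  "(\<integral>\<^sup>+e. \<integral>\<^sup>+e'. half_win (ereal e + ereal s) (ereal e' + ereal t) \<partial>exp_measure \<partial>exp_measure) =
    ((\<integral>\<^sup>+e'. half_win (ereal s) (ereal e' + ereal t) \<partial>exp_measure) + (\<integral>\<^sup>+e. half_win (ereal e + ereal s) (ereal t) \<partial>exp_measure)) / 2"
proof -
  define d where "d = t - s"
  have "(\<integral>\<^sup>+e. \<integral>\<^sup>+e'. half_win (ereal e + ereal s) (ereal e' + ereal t) \<partial>exp_measure \<partial>exp_measure) =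
      (\<integral>\<^sup>+e. ennreal (exp (- max 0 (e - d))) \<partial>exp_measure)"
    using nn_integral_half_win_right[of "_ + s" t] by (simp add: d_def algebra_simps)
  also have "\<dots> = ennreal ((exp (- max 0 (- d)) + (1 - exp (- max 0 d))) / 2)"
  proof (cases "0 \<le> d")
    case True
    then show ?thesis by (subst nn_integral_exp_measure_exp) (simp_all add: field_simps)
  next
    \<comment> \<open>For \<open>d < 0\<close> the maximum is \<open>e - d\<close> almost
      everywhere; the factor \<open>exp d\<close> splits off and leaves the integral for
      \<open>d = 0\<close>.\<close>
    case False
    have "AE e in exp_measure. 0 \<le> e"
      by (subst AE_density) (auto simp: exponential_density_def)
    then have "(\<integral>\<^sup>+e. ennreal (exp (- max 0 (e - d))) \<partial>exp_measure) = (\<integral>\<^sup>+e. ennreal (exp d) * ennreal (exp (- max 0 (e - 0))) \<partial>exp_measure)"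
      using False
      by (intro nn_integral_cong_AE) (auto simp: ennreal_mult[symmetric] exp_add[symmetric] elim!: eventually_mono)
    also have "\<dots> = ennreal (exp d) * ennreal (1 / 2)"
      by (subst nn_integral_cmult) (auto simp: nn_integral_exp_measure_exp[of 0, simplified])
    also have "\<dots> = ennreal (exp d * (1 / 2))" by (rule ennreal_mult[symmetric]) auto
    finally show ?thesis using False by simp
  qed
  also have "\<dots> = (ennreal (exp (- max 0 (- d))) + ennreal (1 - exp (- max 0 d))) / 2"
    by (rule ennreal_average[symmetric]) auto
  finally show ?thesis
    by (simp only: nn_integral_half_win_right nn_integral_half_win_left d_def minus_diff_eq)
qed

lemma half_win_memoryless:
  assumes "s \<noteq> -\<infinity>" "t \<noteq> -\<infinity>"
  shows "(\<integral>\<^sup>+e. \<integral>\<^sup>+e'. half_win (ereal e + s) (ereal e' + t) \<partial>exp_measure \<partial>exp_measure) =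
    ((\<integral>\<^sup>+e'. half_win s (ereal e' + t) \<partial>exp_measure) + (\<integral>\<^sup>+e. half_win (ereal e + s) t \<partial>exp_measure)) / 2"
proof -
  interpret prob_space exp_measure by (rule prob_space_exp_measure)
  show ?thesis
  proof (cases "s = \<infinity> \<or> t = \<infinity>")
    case False
    then obtain s' t' where "s = ereal s'" "t = ereal t'" using assms by (metis ereal_cases)
    then show ?thesis by (simp only: half_win_memoryless_real)
  next
    case True
    have one: "emeasure exp_measure UNIV = 1" using emeasure_space_1 by simp
    have two: "(1 + 1 :: ennreal) / 2 = 1" by (simp add: one_add_one ennreal_divide_self)
    have half: "(ennreal (1 / 2) + ennreal (1 / 2)) / 2 = ennreal (1 / 2)"
      using ennreal_average[of "1 / 2" "1 / 2"] by simp
    show ?thesis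
      using True assms by (cases s; cases t) (auto simp: half_win_def one two half[simplified])
  qed
qed

definition duel_value :: "'a set \<Rightarrow> ('a \<Rightarrow> 'a \<Rightarrow> bool) \<Rightarrow> 'a \<Rightarrow> 'a \<Rightarrow> 'a \<Rightarrow> ennreal" where
  "duel_value V E z a b =
     (\<integral>\<^sup>+\<omega>. \<integral>\<^sup>+\<omega>'. half_win (first_passage z a \<omega>) (first_passage z b \<omega>') \<partial>walk_measure V E \<partial>walk_measure V E)"

lemma first_hit_prob_eq:
  fixes a b :: "'a :: countable"
  shows "ennreal (first_hit_prob V E z a b) = duel_value V E z a b"
proof -
  let ?W = "walk_measure V E"
  let ?X = "\<lambda>\<omega>. first_passage z a (fst \<omega>)" and ?Y = "\<lambda>\<omega>. first_passage z b (snd \<omega>)"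
  interpret W: prob_space ?W by (rule prob_space_walk_measure)
  interpret WW: pair_prob_space ?W ?W ..
  have "AE x in ?W. AE y in ?W. hitting_time z a x = first_passage z a x \<and> hitting_time z b y = first_passage z b y"
    using AE_holding_times_pos[of V E]
  proof (rule eventually_mono)
    fix x :: "'a walk_sample" assume x: "\<forall>k. 0 < fst (x !! k)"
    show "AE y in ?W. hitting_time z a x = first_passage z a x \<and> hitting_time z b y = first_passage z b y"
      using AE_holding_times_pos[of V E]
      by (rule eventually_mono) (use x in \<open>simp add: hitting_time_eq_first_passage\<close>)
  qed
  then have ae: "AE \<omega> in ?W \<Otimes>\<^sub>M ?W. hitting_time z a (fst \<omega>) = ?X \<omega> \<and> hitting_time z b (snd \<omega>) = ?Y \<omega>"
    by (intro WW.AE_pair_measure) simp_all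
  have X: "?X \<in> borel_measurable (?W \<Otimes>\<^sub>M ?W)"
    by (rule measurable_compose[OF measurable_fst measurable_first_passage])
  have Y: "?Y \<in> borel_measurable (?W \<Otimes>\<^sub>M ?W)"
    by (rule measurable_compose[OF measurable_snd measurable_first_passage])
  have X': "(\<lambda>\<omega>. hitting_time z a (fst \<omega>)) \<in> borel_measurable (?W \<Otimes>\<^sub>M ?W)"
    by (rule measurable_compose[OF measurable_fst measurable_hitting_time])
  have Y': "(\<lambda>\<omega>. hitting_time z b (snd \<omega>)) \<in> borel_measurable (?W \<Otimes>\<^sub>M ?W)"
    by (rule measurable_compose[OF measurable_snd measurable_hitting_time])
  have A: "{\<omega> \<in> space (?W \<Otimes>\<^sub>M ?W). ?X \<omega> < ?Y \<omega>} \<in> sets (?W \<Otimes>\<^sub>M ?W)" (is "?A \<in> _")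
    by (rule borel_measurable_less[OF X Y])
  have A': "{\<omega> \<in> space (?W \<Otimes>\<^sub>M ?W). hitting_time z a (fst \<omega>) < hitting_time z b (snd \<omega>)} \<in> sets (?W \<Otimes>\<^sub>M ?W)" (is "?A' \<in> _")
    by (rule borel_measurable_less[OF X' Y'])
  have B: "{\<omega> \<in> space (?W \<Otimes>\<^sub>M ?W). ?X \<omega> = ?Y \<omega>} \<in> sets (?W \<Otimes>\<^sub>M ?W)" (is "?B \<in> _")
    by (rule borel_measurable_eq[OF X Y])
  have B': "{\<omega> \<in> space (?W \<Otimes>\<^sub>M ?W). hitting_time z a (fst \<omega>) = hitting_time z b (snd \<omega>)} \<in> sets (?W \<Otimes>\<^sub>M ?W)" (is "?B' \<in> _")
    by (rule borel_measurable_eq[OF X' Y'])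
  have "AE \<omega> in ?W \<Otimes>\<^sub>M ?W. \<omega> \<in> ?A' \<longleftrightarrow> \<omega> \<in> ?A"
    by (rule eventually_mono[OF ae]) simp
  then have lt: "WW.prob ?A' = WW.prob ?A"
    using A' A by (rule WW.finite_measure_eq_AE)
  have "AE \<omega> in ?W \<Otimes>\<^sub>M ?W. \<omega> \<in> ?B' \<longleftrightarrow> \<omega> \<in> ?B"
    by (rule eventually_mono[OF ae]) simp
  then have eq: "WW.prob ?B' = WW.prob ?B"
    using B' B by (rule WW.finite_measure_eq_AE)
  have "first_hit_prob V E z a b = WW.prob ?A + 1 / 2 * WW.prob ?B"
    unfolding first_hit_prob_def lt eq by (rule refl)
  then have "ennreal (first_hit_prob V E z a b) = ennreal (WW.prob ?A) + ennreal (1 / 2) * ennreal (WW.prob ?B)"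
  proof -
    assume e: "first_hit_prob V E z a b = WW.prob ?A + 1 / 2 * WW.prob ?B"
    have "ennreal (1 / 2 * WW.prob ?B) = ennreal (1 / 2) * ennreal (WW.prob ?B)"
      by (rule ennreal_mult) auto
    moreover have "ennreal (WW.prob ?A + 1 / 2 * WW.prob ?B) = ennreal (WW.prob ?A) + ennreal (1 / 2 * WW.prob ?B)"
      by (rule ennreal_plus) auto
    ultimately show ?thesis by (simp only: e)
  qed
  also have "\<dots> = emeasure (?W \<Otimes>\<^sub>M ?W) ?A + ennreal (1 / 2) * emeasure (?W \<Otimes>\<^sub>M ?W) ?B"
    by (simp only: WW.emeasure_eq_measure)
  also have "\<dots> = (\<integral>\<^sup>+\<omega>. indicator ?A \<omega> \<partial>(?W \<Otimes>\<^sub>M ?W)) + (\<integral>\<^sup>+\<omega>. ennreal (1 / 2) * indicator ?B \<omega> \<partial>(?W \<Otimes>\<^sub>M ?W))"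
    using A B by (simp only: nn_integral_cmult_indicator nn_integral_indicator)
  also have "\<dots> = (\<integral>\<^sup>+\<omega>. indicator ?A \<omega> + ennreal (1 / 2) * indicator ?B \<omega> \<partial>(?W \<Otimes>\<^sub>M ?W))"
  proof -
    note A [measurable] and B [measurable]
    show ?thesis by (rule nn_integral_add[symmetric]) measurable
  qed
  also have "\<dots> = (\<integral>\<^sup>+\<omega>. half_win (?X \<omega>) (?Y \<omega>) \<partial>(?W \<Otimes>\<^sub>M ?W))"
    by (rule nn_integral_cong) (simp add: half_win_def indicator_def del: ennreal_half)
  also have "\<dots> = duel_value V E z a b"
    unfolding duel_value_def
    using W.nn_integral_fst[OF measurable_half_win[OF X Y]] by simp
  finally show ?thesis .
qed


lemma exp_race:
  fixes \<nu> :: "'b measure" and T :: "'b \<Rightarrow> ereal"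
  assumes "prob_space \<nu>" and [measurable]: "T \<in> borel_measurable \<nu>"
    and "s \<noteq> -\<infinity>" "\<And>x. T x \<noteq> -\<infinity>"
  shows "(\<integral>\<^sup>+e. \<integral>\<^sup>+x. \<integral>\<^sup>+e'. half_win (ereal e + s) (ereal e' + T x) \<partial>exp_measure \<partial>\<nu> \<partial>exp_measure) =
    ((\<integral>\<^sup>+x. \<integral>\<^sup>+e'. half_win s (ereal e' + T x) \<partial>exp_measure \<partial>\<nu>) +
     (\<integral>\<^sup>+e. \<integral>\<^sup>+x. half_win (ereal e + s) (T x) \<partial>\<nu> \<partial>exp_measure)) / 2"
proof -
  interpret N: prob_space \<nu> by fact
  interpret X: prob_space exp_measure by (rule prob_space_exp_measure)
  interpret XN: pair_sigma_finite exp_measure \<nu> ..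
  have "(\<integral>\<^sup>+e. \<integral>\<^sup>+x. \<integral>\<^sup>+e'. half_win (ereal e + s) (ereal e' + T x) \<partial>exp_measure \<partial>\<nu> \<partial>exp_measure) =
      (\<integral>\<^sup>+x. \<integral>\<^sup>+e. \<integral>\<^sup>+e'. half_win (ereal e + s) (ereal e' + T x) \<partial>exp_measure \<partial>exp_measure \<partial>\<nu>)"
    by (rule XN.Fubini'[symmetric]) measurable
  also have "\<dots> = (\<integral>\<^sup>+x. ((\<integral>\<^sup>+e'. half_win s (ereal e' + T x) \<partial>exp_measure) +
      (\<integral>\<^sup>+e. half_win (ereal e + s) (T x) \<partial>exp_measure)) / 2 \<partial>\<nu>)"
    by (simp only: half_win_memoryless[OF assms(3,4)])
  also have "\<dots> = (\<integral>\<^sup>+x. (\<integral>\<^sup>+e'. half_win s (ereal e' + T x) \<partial>exp_measure) +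
      (\<integral>\<^sup>+e. half_win (ereal e + s) (T x) \<partial>exp_measure) \<partial>\<nu>) / 2"
    by (rule nn_integral_divide) measurable
  also have "(\<integral>\<^sup>+x. (\<integral>\<^sup>+e'. half_win s (ereal e' + T x) \<partial>exp_measure) +
      (\<integral>\<^sup>+e. half_win (ereal e + s) (T x) \<partial>exp_measure) \<partial>\<nu>) =
      (\<integral>\<^sup>+x. \<integral>\<^sup>+e'. half_win s (ereal e' + T x) \<partial>exp_measure \<partial>\<nu>) +
      (\<integral>\<^sup>+x. \<integral>\<^sup>+e. half_win (ereal e + s) (T x) \<partial>exp_measure \<partial>\<nu>)"
    by (rule nn_integral_add) measurable
  also have "(\<integral>\<^sup>+x. \<integral>\<^sup>+e. half_win (ereal e + s) (T x) \<partial>exp_measure \<partial>\<nu>) =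
      (\<integral>\<^sup>+e. \<integral>\<^sup>+x. half_win (ereal e + s) (T x) \<partial>\<nu> \<partial>exp_measure)"
    by (rule XN.Fubini') measurable
  finally show ?thesis .
qed

text \<open>The first walker sets out from \<open>a\<close> only after an extra holding time. This
  is what \<open>duel_value\<close> becomes once that walker's first holding time and jump are
  exposed.\<close>

definition delayed_value :: "'a set \<Rightarrow> ('a \<Rightarrow> 'a \<Rightarrow> bool) \<Rightarrow> 'a \<Rightarrow> 'a \<Rightarrow> 'a \<Rightarrow> ennreal" where
  "delayed_value V E z a b =
     (\<integral>\<^sup>+\<omega>. \<integral>\<^sup>+e. \<integral>\<^sup>+\<omega>'. half_win (ereal e + first_passage z a \<omega>) (first_passage z b \<omega>')
        \<partial>walk_measure V E \<partial>exp_measure \<partial>walk_measure V E)"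

text \<open>
  Whoever jumps first does so with probability one half each, and the holding time of the other
  starts afresh.
\<close>

lemma duel_value_step:
  fixes a b :: "'a :: countable"
  assumes V: "finite V" "a \<in> V" "b \<in> V" and ne: "a \<noteq> z" "b \<noteq> z"
    and Ja: "\<And>g :: 'a \<Rightarrow> ennreal. (\<integral>\<^sup>+x. g x \<partial>measure_pmf (jump_pmf V E a)) = (g a\<^sub>1 + g a\<^sub>2) / 2"
    and Jb: "\<And>g :: 'a \<Rightarrow> ennreal. (\<integral>\<^sup>+x. g x \<partial>measure_pmf (jump_pmf V E b)) = (g b\<^sub>1 + g b\<^sub>2) / 2"
  shows "duel_value V E z a b =
    ((duel_value V E z a\<^sub>1 b + duel_value V E z a\<^sub>2 b) / 2 +
     (duel_value V E z a b\<^sub>1 + duel_value V E z a b\<^sub>2) / 2) / 2"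
proof -
  let ?W = "walk_measure V E" and ?h = "\<lambda>a. first_passage z a"
  interpret W: prob_space ?W by (rule prob_space_walk_measure)
  interpret X: prob_space exp_measure by (rule prob_space_exp_measure)
  interpret XW: pair_sigma_finite exp_measure ?W ..
  \<comment> \<open>\<open>F d s\<close> is the chance that the time \<open>s\<close> beats a
    passage from \<open>d\<close>; \<open>G d s\<close>, below, grants that passage an additional
    holding time.\<close>
  define F where "F = (\<lambda>b s. \<integral>\<^sup>+\<omega>'. half_win s (?h b \<omega>') \<partial>?W)"
  have F_meas [measurable]: "F b \<in> borel_measurable borel" for b unfolding F_def by measurable
  have hw: "half_win s \<in> borel_measurable borel" for s by measurable
  have duel_F: "duel_value V E z c d = (\<integral>\<^sup>+\<omega>. F d (?h c \<omega>) \<partial>?W)" for c d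
    by (simp only: duel_value_def F_def)
  have delayed_F: "delayed_value V E z c d = (\<integral>\<^sup>+\<omega>. \<integral>\<^sup>+e. F d (ereal e + ?h c \<omega>) \<partial>exp_measure \<partial>?W)" for c d
    by (simp only: delayed_value_def F_def)
  have step_a: "duel_value V E z a d = (delayed_value V E z a\<^sub>1 d + delayed_value V E z a\<^sub>2 d) / 2" for d
    unfolding duel_F delayed_F nn_integral_first_passage[OF V(1,2) ne(1) F_meas] Ja by (rule refl)
  define G where "G = (\<lambda>d s. \<integral>\<^sup>+\<omega>'. \<integral>\<^sup>+e'. half_win s (ereal e' + ?h d \<omega>') \<partial>exp_measure \<partial>?W)"
  have G_meas [measurable]: "G d \<in> borel_measurable borel" for d unfolding G_def by measurable
  have F_b: "F b s = (G b\<^sub>1 s + G b\<^sub>2 s) / 2" for s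
    unfolding F_def G_def nn_integral_first_passage[OF V(1,3) ne(2) hw] Jb by (rule refl)
  have race: "(\<integral>\<^sup>+e. G d (ereal e + s) \<partial>exp_measure) = (G d s + (\<integral>\<^sup>+e. F d (ereal e + s) \<partial>exp_measure)) / 2"
    if "s \<noteq> -\<infinity>" for d s
    unfolding F_def G_def
    by (rule exp_race[OF prob_space_walk_measure _ that first_passage_not_MInfty]) measurable
  have avg_FG: "(\<integral>\<^sup>+e. F b (ereal e + s) \<partial>exp_measure) =
      (F b s + ((\<integral>\<^sup>+e. F b\<^sub>1 (ereal e + s) \<partial>exp_measure) + (\<integral>\<^sup>+e. F b\<^sub>2 (ereal e + s) \<partial>exp_measure)) / 2) / 2"
    if s: "s \<noteq> -\<infinity>" for s
  proof -
    have "(\<integral>\<^sup>+e. F b (ereal e + s) \<partial>exp_measure) = (\<integral>\<^sup>+e. (G b\<^sub>1 (ereal e + s) + G b\<^sub>2 (ereal e + s)) / 2 \<partial>exp_measure)"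
      by (simp only: F_b)
    also have "\<dots> = (\<integral>\<^sup>+e. G b\<^sub>1 (ereal e + s) + G b\<^sub>2 (ereal e + s) \<partial>exp_measure) / 2"
      by (rule nn_integral_divide) measurable
    also have "(\<integral>\<^sup>+e. G b\<^sub>1 (ereal e + s) + G b\<^sub>2 (ereal e + s) \<partial>exp_measure) =
        (\<integral>\<^sup>+e. G b\<^sub>1 (ereal e + s) \<partial>exp_measure) + (\<integral>\<^sup>+e. G b\<^sub>2 (ereal e + s) \<partial>exp_measure)"
      by (rule nn_integral_add) measurable
    also have "\<dots> / 2 = (F b s + ((\<integral>\<^sup>+e. F b\<^sub>1 (ereal e + s) \<partial>exp_measure) + (\<integral>\<^sup>+e. F b\<^sub>2 (ereal e + s) \<partial>exp_measure)) / 2) / 2"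
      unfolding race[OF s] F_b by (simp add: divide_ennreal_def distrib_right distrib_left ac_simps)
    finally show ?thesis .
  qed
  \<comment> \<open>With probability one half the delay ends first and an undelayed duel remains;
    otherwise \<open>b\<close> jumps while the delay persists.\<close>
  have delayed: "delayed_value V E z c b =
      (duel_value V E z c b + (delayed_value V E z c b\<^sub>1 + delayed_value V E z c b\<^sub>2) / 2) / 2" for c
  proof -
    let ?I = "\<lambda>d \<omega>. \<integral>\<^sup>+e. F d (ereal e + ?h c \<omega>) \<partial>exp_measure"
    have [measurable]: "?I d \<in> borel_measurable ?W" for d by measurable
    have "delayed_value V E z c b = (\<integral>\<^sup>+\<omega>. (F b (?h c \<omega>) + (?I b\<^sub>1 \<omega> + ?I b\<^sub>2 \<omega>) / 2) / 2 \<partial>?W)"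
      unfolding delayed_F by (intro nn_integral_cong avg_FG first_passage_not_MInfty)
    also have "\<dots> = (\<integral>\<^sup>+\<omega>. F b (?h c \<omega>) + (?I b\<^sub>1 \<omega> + ?I b\<^sub>2 \<omega>) / 2 \<partial>?W) / 2"
      by (rule nn_integral_divide) measurable
    also have "(\<integral>\<^sup>+\<omega>. F b (?h c \<omega>) + (?I b\<^sub>1 \<omega> + ?I b\<^sub>2 \<omega>) / 2 \<partial>?W) =
        (\<integral>\<^sup>+\<omega>. F b (?h c \<omega>) \<partial>?W) + (\<integral>\<^sup>+\<omega>. (?I b\<^sub>1 \<omega> + ?I b\<^sub>2 \<omega>) / 2 \<partial>?W)"
      by (rule nn_integral_add) measurable
    also have "(\<integral>\<^sup>+\<omega>. (?I b\<^sub>1 \<omega> + ?I b\<^sub>2 \<omega>) / 2 \<partial>?W) = (\<integral>\<^sup>+\<omega>. ?I b\<^sub>1 \<omega> + ?I b\<^sub>2 \<omega> \<partial>?W) / 2"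
      by (rule nn_integral_divide) measurable
    also have "(\<integral>\<^sup>+\<omega>. ?I b\<^sub>1 \<omega> + ?I b\<^sub>2 \<omega> \<partial>?W) = (\<integral>\<^sup>+\<omega>. ?I b\<^sub>1 \<omega> \<partial>?W) + (\<integral>\<^sup>+\<omega>. ?I b\<^sub>2 \<omega> \<partial>?W)"
      by (rule nn_integral_add) measurable
    finally show ?thesis by (simp only: duel_F delayed_F)
  qed
  \<comment> \<open>Averaged over the jumps of \<open>a\<close>, the delayed values against the
    neighbours of \<open>b\<close> turn back into duels started from \<open>a\<close>.\<close>
  show ?thesis
    unfolding step_a[of b] delayed step_a[of "b\<^sub>1"] step_a[of "b\<^sub>2"]
    by (simp add: divide_ennreal_def distrib_right distrib_left ac_simps)
qed

section \<open>Discrete harmonic functions on rectangles\<close>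

text \<open>Take a minimiser of least \<open>rank\<close>. A negative minimum passes to its
  neighbour \<open>na\<close>, which has smaller rank or lies outside \<open>S\<close>, where
  \<open>g\<close> is nonnegative. The neighbour maps are arbitrary, so reflections and self-loops
  are covered, and superharmonicity is required only where \<open>g\<close> is negative.\<close>

lemma min_principle:
  fixes g :: "'a \<Rightarrow> real" and na nb nc nd :: "'a \<Rightarrow> 'a" and rank :: "'a \<Rightarrow> nat"
  assumes fin: "finite S"
    and super: "\<And>p. p \<in> S \<Longrightarrow> g p < 0 \<Longrightarrow> g (na p) + g (nb p) + g (nc p) + g (nd p) \<le> 4 * g p"
    and bd: "\<And>p. p \<in> S \<Longrightarrow> na p \<notin> S \<Longrightarrow> 0 \<le> g (na p)"
            "\<And>p. p \<in> S \<Longrightarrow> nb p \<notin> S \<Longrightarrow> 0 \<le> g (nb p)"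
            "\<And>p. p \<in> S \<Longrightarrow> nc p \<notin> S \<Longrightarrow> 0 \<le> g (nc p)"
            "\<And>p. p \<in> S \<Longrightarrow> nd p \<notin> S \<Longrightarrow> 0 \<le> g (nd p)"
    and rank: "\<And>p. p \<in> S \<Longrightarrow> na p \<in> S \<Longrightarrow> rank (na p) < rank p"
    and p: "p \<in> S"
  shows "0 \<le> g p"
proof (rule ccontr)
  assume neg: "\<not> 0 \<le> g p"
  define \<mu> where "\<mu> = Min (g ` S)"
  have fin': "finite (g ` S)" and ne: "g ` S \<noteq> {}" using fin p by auto
  have mu: "\<mu> \<le> g r" if "r \<in> S" for r using that fin' by (simp add: \<mu>_def)
  have neg_mu: "\<mu> < 0" using mu[OF p] neg by simp
  have "\<mu> \<in> g ` S" unfolding \<mu>_def using fin' ne by (rule Min_in)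
  then have "\<exists>r. r \<in> S \<and> g r = \<mu>" by auto
  then obtain r where r: "r \<in> S \<and> g r = \<mu>"
    and least: "\<And>r'. r' \<in> S \<and> g r' = \<mu> \<Longrightarrow> rank r \<le> rank r'"
    using exists_least_lemma ex_has_least_nat[of "\<lambda>r. r \<in> S \<and> g r = \<mu>" _ rank] by metis
  have ge: "\<mu> \<le> g (na r)" "\<mu> \<le> g (nb r)" "\<mu> \<le> g (nc r)" "\<mu> \<le> g (nd r)"
    using mu bd[of r] r neg_mu by (meson less_imp_le order_trans)+
  have "g (na r) = \<mu>"
    using super[of r] r neg_mu ge by auto
  moreover from this have "na r \<in> S"
    using bd(1)[of r] r neg_mu by force
  ultimately show False
    using least[of "na r"] rank[of r] r by auto
qed

text \<open>The last column and the last row reflect the walk.\<close>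

definition refl_up :: "nat \<Rightarrow> nat \<Rightarrow> nat" where
  "refl_up W u = (if u < W then u + 1 else u - 1)"

text \<open>
  \<open>f u v\<close> is the probability that a walker at distance \<open>v\<close> from a common target arrives before
  one at distance \<open>u\<close>, the walkers being confined to \<open>{0..K}\<close> and \<open>{0..W}\<close> respectively.
\<close>

definition duel :: "nat \<Rightarrow> nat \<Rightarrow> (nat \<Rightarrow> nat \<Rightarrow> real) \<Rightarrow> bool" where
  "duel W K f \<longleftrightarrow>
     (\<forall>v \<in> {1..K}. f 0 v = 0) \<and> (\<forall>u \<in> {1..W}. f u 0 = 1) \<and>
     (\<forall>u \<in> {1..W}. \<forall>v \<in> {1..K}.
        4 * f u v = f (u - 1) v + f (refl_up W u) v + f u (v - 1) + f u (refl_up K v))"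

lemma duelD:
  assumes "duel W K f"
  shows "1 \<le> v \<Longrightarrow> v \<le> K \<Longrightarrow> f 0 v = 0"
    and "1 \<le> u \<Longrightarrow> u \<le> W \<Longrightarrow> f u 0 = 1"
    and "1 \<le> u \<Longrightarrow> u \<le> W \<Longrightarrow> 1 \<le> v \<Longrightarrow> v \<le> K \<Longrightarrow>
      4 * f u v = f (u - 1) v + f (refl_up W u) v + f u (v - 1) + f u (refl_up K v)"
  using assms unfolding duel_def by auto

lemma duel_swap:
  assumes "duel W K f"
  shows "duel K W (\<lambda>u v. 1 - f v u)"
  using assms unfolding duel_def by (auto simp: algebra_simps)

lemma duel_nonneg:
  assumes f: "duel W K f" and uv: "1 \<le> u" "u \<le> W" "1 \<le> v" "v \<le> K"
  shows "0 \<le> f u v"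
proof -
  define S where "S = {1..W} \<times> {1..K}"
  have "0 \<le> (\<lambda>(u, v). f u v) (u, v)"
  proof (rule min_principle[where S = S and rank = fst and na = "\<lambda>(u, v). (u - 1, v)"
        and nb = "\<lambda>(u, v). (refl_up W u, v)" and nc = "\<lambda>(u, v). (u, v - 1)"
        and nd = "\<lambda>(u, v). (u, refl_up K v)"], goal_cases)
    case (2 p)
    then show ?case using duelD(3)[OF f, of "fst p" "snd p"] by (auto simp: S_def split: prod.splits)
  next
    case (3 p)
    then have "fst p = 1" "1 \<le> snd p" "snd p \<le> K" by (auto simp: S_def split: prod.splits)
    then show ?case using duelD(1)[OF f, of "snd p"] by (auto split: prod.splits)
  next
    case (4 p)
    then have "fst p = 1" "1 \<le> snd p" "snd p \<le> K" "W = 1"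
      by (auto simp: S_def refl_up_def split: prod.splits if_splits)
    then show ?case using duelD(1)[OF f, of "snd p"] by (auto simp: refl_up_def split: prod.splits)
  next
    case (5 p)
    then have "snd p = 1" "1 \<le> fst p" "fst p \<le> W" by (auto simp: S_def split: prod.splits)
    then show ?case using duelD(2)[OF f, of "fst p"] by (auto split: prod.splits)
  next
    case (6 p)
    then have "snd p = 1" "1 \<le> fst p" "fst p \<le> W" "K = 1"
      by (auto simp: S_def refl_up_def split: prod.splits if_splits)
    then show ?case using duelD(2)[OF f, of "fst p"] by (auto simp: refl_up_def split: prod.splits)
  qed (use uv in \<open>auto simp: S_def split: prod.splits\<close>)
  then show ?thesis by simp
qed

lemma duel_mono_left:
  assumes f: "duel W K f" and uv: "u + 1 \<le> W" "1 \<le> v" "v \<le> K"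
  shows "f u v \<le> f (u + 1) v"
proof (cases "u = 0")
  case True
  then show ?thesis using duelD(1)[OF f] duel_nonneg[OF f, of 1 v] uv by simp
next
  case False
  define S where "S = {1..W - 1} \<times> {1..K}"
  define g where "g = (\<lambda>(u, v). f (u + 1) v - f u v)"
  \<comment> \<open>The difference changes sign across the reflecting column. With the point itself
    as its own neighbour the four terms sum to \<open>6 * g\<close>, which is at most
    \<open>4 * g\<close> exactly because only points with \<open>g < 0\<close> are
    considered.\<close>
  define nx where "nx = (\<lambda>(u::nat, v::nat). if u + 1 < W then (u + 1, v) else (u, v))"
  have "0 \<le> g (u, v)"
  proof (rule min_principle[where S = S and rank = fst and na = "\<lambda>(u, v). (u - 1, v)"
        and nb = nx and nc = "\<lambda>(u, v). (u, v - 1)"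
        and nd = "\<lambda>(u, v). (u, refl_up K v)"], goal_cases)
    case (2 p)
    obtain u v where p: "p = (u, v)" by force
    have uv: "1 \<le> u" "u + 1 \<le> W" "1 \<le> v" "v \<le> K" using 2 p by (auto simp: S_def)
    have e1: "4 * f u v = f (u - 1) v + f (u + 1) v + f u (v - 1) + f u (refl_up K v)"
      using duelD(3)[OF f, of u v] uv by (simp add: refl_up_def)
    have e2: "4 * f (u + 1) v = f u v + f (refl_up W (u + 1)) v + f (u + 1) (v - 1) + f (u + 1) (refl_up K v)"
      using duelD(3)[OF f, of "u + 1" v] uv by simp
    have r: "u - 1 + 1 = u" using uv by simp
    show ?case
    proof (cases "u + 1 < W")
      case True
      then show ?thesis using e1 e2 r by (simp add: p g_def nx_def refl_up_def)
    next
      case False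
      then have "4 * f (u + 1) v = 2 * f u v + f (u + 1) (v - 1) + f (u + 1) (refl_up K v)"
        using e2 by (simp add: refl_up_def)
      moreover have "f (u + 1) v - f u v < 0" using 2 p by (simp add: g_def)
      ultimately show ?thesis using e1 r False by (simp add: p g_def nx_def)
    qed
  next
    case (3 p)
    obtain u v where p: "p = (u, v)" by force
    have uv: "u = 1" "2 \<le> W" "1 \<le> v" "v \<le> K" using 3 p by (auto simp: S_def)
    then show ?case using p duelD(1)[OF f, of v] duel_nonneg[OF f, of 1 v] by (simp add: g_def)
  next
    case (4 p)
    then show ?case by (auto simp: S_def nx_def split: prod.splits if_splits)
  next
    case (5 p)
    obtain u v where p: "p = (u, v)" by force
    have uv: "v = 1" "1 \<le> u" "u + 1 \<le> W" using 5 p by (auto simp: S_def)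
    then show ?case using p duelD(2)[OF f, of u] duelD(2)[OF f, of "u + 1"] by (simp add: g_def)
  next
    case (6 p)
    obtain u v where p: "p = (u, v)" by force
    have uv: "v = 1" "1 \<le> u" "u + 1 \<le> W" "K = 1"
      using 6 p by (auto simp: S_def refl_up_def split: if_splits)
    then show ?case using p duelD(2)[OF f, of u] duelD(2)[OF f, of "u + 1"]
      by (simp add: g_def refl_up_def)
  qed (use uv False in \<open>auto simp: S_def split: prod.splits\<close>)
  then show ?thesis by (simp add: g_def)
qed

lemma duel_mono_right:
  assumes f: "duel W K f" and uv: "1 \<le> u" "u \<le> W" "v + 1 \<le> K"
  shows "f u (v + 1) \<le> f u v"
  using duel_mono_left[OF duel_swap[OF f], of v u] uv by simp

text \<open>Moving the wall from \<open>W\<close> outwards replaces the reflected neighbour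
  \<open>W - 1\<close> of \<open>W\<close> by \<open>W + 1\<close>, where the value is larger by
  monotonicity.\<close>

lemma duel_reflect_left:
  assumes f: "duel W' K f" and "1 \<le> u" "u \<le> W" "W \<le> W'" "1 \<le> v" "v \<le> K"
  shows "f (refl_up W u) v \<le> f (refl_up W' u) v"
proof (cases "u < W \<or> W' = W")
  case True
  then show ?thesis using assms by (auto simp: refl_up_def)
next
  case False
  then have "u = W" "W < W'" using assms by auto
  then show ?thesis
    using duel_mono_left[OF f, of "u - 1" v] duel_mono_left[OF f, of u v] assms by (simp add: refl_up_def)
qed

lemma duel_reflect_right:
  assumes f: "duel W K' f" and "1 \<le> v" "v \<le> K" "K \<le> K'" "1 \<le> u" "u \<le> W"
  shows "f u (refl_up K' v) \<le> f u (refl_up K v)"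
  using duel_reflect_left[OF duel_swap[OF f], of v K u] assms by simp

text \<open>More room slows a walker down, less room speeds it up: by the two reflection lemmas
  \<open>g - f\<close> is superharmonic for the reflections of the smaller rectangle
  \<open>W\<close>, \<open>K'\<close>. Equal widths, used in both directions, give uniqueness of the
  duel.\<close>

lemma duel_le:
  assumes f: "duel W K f" and g: "duel W' K' g" and le: "W \<le> W'" "K' \<le> K"
    and uv: "1 \<le> u" "u \<le> W" "1 \<le> v" "v \<le> K'"
  shows "f u v \<le> g u v"
proof -
  define S where "S = {1..W} \<times> {1..K'}"
  define h where "h = (\<lambda>(u, v). g u v - f u v)"
  have "0 \<le> h (u, v)"
  proof (rule min_principle[where S = S and rank = fst and na = "\<lambda>(u, v). (u - 1, v)"
        and nb = "\<lambda>(u, v). (refl_up W u, v)" and nc = "\<lambda>(u, v). (u, v - 1)"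
        and nd = "\<lambda>(u, v). (u, refl_up K' v)"], goal_cases)
    case (2 p)
    obtain u v where p: "p = (u, v)" by force
    have uv: "1 \<le> u" "u \<le> W" "1 \<le> v" "v \<le> K'" using 2 p by (auto simp: S_def)
    show ?case
      using duelD(3)[OF f, of u v] duelD(3)[OF g, of u v] uv le
        duel_reflect_left[OF g, of u W v] duel_reflect_right[OF f, of v K' u]
      by (simp add: p h_def)
  next
    case (3 p)
    obtain u v where p: "p = (u, v)" by force
    have uv: "u = 1" "1 \<le> v" "v \<le> K'" using 3 p by (auto simp: S_def)
    then show ?case using p duelD(1)[OF f, of v] duelD(1)[OF g, of v] le by (simp add: h_def)
  next
    case (4 p)
    obtain u v where p: "p = (u, v)" by force
    have uv: "u = 1" "W = 1" "1 \<le> v" "v \<le> K'"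
      using 4 p by (auto simp: S_def refl_up_def split: if_splits)
    then show ?case using p duelD(1)[OF f, of v] duelD(1)[OF g, of v] le
      by (simp add: h_def refl_up_def)
  next
    case (5 p)
    obtain u v where p: "p = (u, v)" by force
    have uv: "v = 1" "1 \<le> u" "u \<le> W" using 5 p by (auto simp: S_def)
    then show ?case using p duelD(2)[OF f, of u] duelD(2)[OF g, of u] le by (simp add: h_def)
  next
    case (6 p)
    obtain u v where p: "p = (u, v)" by force
    have uv: "v = 1" "K' = 1" "1 \<le> u" "u \<le> W"
      using 6 p by (auto simp: S_def refl_up_def split: if_splits)
    then show ?case using p duelD(2)[OF f, of u] duelD(2)[OF g, of u] le
      by (simp add: h_def refl_up_def)
  qed (use uv in \<open>auto simp: S_def split: prod.splits\<close>)
  then show ?thesis by (simp add: h_def)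
qed

lemma duel_antisym:
  assumes f: "duel R R f" and uv: "1 \<le> u" "u \<le> R" "1 \<le> v" "v \<le> R"
  shows "f u v + f v u = 1"
  using duel_le[OF f duel_swap[OF f] order_refl order_refl uv]
    duel_le[OF duel_swap[OF f] f order_refl order_refl uv] by simp

lemma duel_diag:
  assumes f: "duel R R f" and uv: "1 \<le> u" "u \<le> R"
  shows "f u u = 1 / 2"
  using duel_antisym[OF f, of u u] uv by simp

text \<open>Both widths grow, so \<open>duel_le\<close> gives no verdict. Antisymmetry fixes the
  value \<open>1 / 2\<close> on the diagonal of either square, and on the triangle
  \<open>u < v\<close> only the walker at distance \<open>v\<close> can feel the wall.\<close>

lemma duel_square_le:
  assumes f: "duel R R f" and g: "duel R' R' g" and le: "R \<le> R'"
    and uv: "1 \<le> u" "u \<le> v" "v \<le> R"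
  shows "g u v \<le> f u v"
proof (cases "u = v")
  case True
  then show ?thesis using duel_diag[OF f, of u] duel_diag[OF g, of u] uv le by simp
next
  case False
  define S where "S = {(u, v). 1 \<le> u \<and> u < v \<and> v \<le> R}"
  define h where "h = (\<lambda>(u, v). f u v - g u v)"
  have bdry: "0 \<le> h (0, v)" if "1 \<le> v" "v \<le> R" for v
    using duelD(1)[OF f, of v] duelD(1)[OF g, of v] that le by (simp add: h_def)
  have diag: "h (v, v) = 0" if "1 \<le> v" "v \<le> R" for v
    using duel_diag[OF f, of v] duel_diag[OF g, of v] that le by (simp add: h_def)
  have "0 \<le> h (u, v)"
  proof (rule min_principle[where S = S and rank = fst and na = "\<lambda>(u, v). (u - 1, v)"
        and nb = "\<lambda>(u, v). (u + 1, v)" and nc = "\<lambda>(u, v). (u, v - 1)"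
        and nd = "\<lambda>(u, v). (u, refl_up R v)"], goal_cases)
    case 1
    have "S \<subseteq> {..R} \<times> {..R}" by (auto simp: S_def)
    then show ?case by (rule finite_subset) auto
  next
    case (2 p)
    obtain u v where p: "p = (u, v)" by force
    have uv: "1 \<le> u" "u < v" "v \<le> R" using 2 p by (auto simp: S_def)
    have "refl_up R u = u + 1" "refl_up R' u = u + 1" using uv le by (auto simp: refl_up_def)
    then show ?case
      using duelD(3)[OF f, of u v] duelD(3)[OF g, of u v] uv le
        duel_reflect_right[OF g, of v R u]
      by (simp add: p h_def)
  next
    case (3 p)
    obtain u v where p: "p = (u, v)" by force
    have uv: "u = 1" "1 < v" "v \<le> R" using 3 p by (auto simp: S_def)
    then show ?case using p bdry[of v] by simp
  next
    case (4 p)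
    obtain u v where p: "p = (u, v)" by force
    have uv: "u + 1 = v" "v \<le> R" "1 \<le> v" using 4 p by (auto simp: S_def)
    then show ?case using p diag[of v] by simp
  next
    case (5 p)
    obtain u v where p: "p = (u, v)" by force
    have uv: "u = v - 1" "1 \<le> u" "v \<le> R" using 5 p by (auto simp: S_def)
    then show ?case using p diag[of u] by simp
  next
    case (6 p)
    obtain u v where p: "p = (u, v)" by force
    have uv: "u = v - 1" "v = R" "1 \<le> u"
      using 6 p by (auto simp: S_def refl_up_def split: if_splits)
    then show ?case using p diag[of u] by (simp add: refl_up_def)
  qed (use uv False in \<open>auto simp: S_def split: prod.splits\<close>)
  then show ?thesis by (simp add: h_def)
qed

section \<open>The game on a path\<close>

text \<open>At an end of the path \<open>refl_down\<close> and \<open>refl_up\<close> both return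
  the only neighbour, so the average over the two describes a jump from any vertex.\<close>

definition refl_down :: "nat \<Rightarrow> nat" where
  "refl_down x = (if x = 0 then 1 else x - 1)"

text \<open>For paths with at least two vertices, everything about the game is derived from these
  equations, and by \<open>path_game_le\<close> they determine \<open>q\<close>. The condition
  \<open>1 \<le> N\<close> makes \<open>refl_down 0 = 1\<close> a vertex.\<close>

definition path_game :: "nat \<Rightarrow> (nat \<Rightarrow> nat \<Rightarrow> nat \<Rightarrow> real) \<Rightarrow> bool" where
  "path_game N q \<longleftrightarrow> 1 \<le> N \<and>
     (\<forall>z\<le>N. q z z z = 1 / 2 \<and> (\<forall>b\<le>N. b \<noteq> z \<longrightarrow> q z z b = 1 \<and> q z b z = 0) \<and>
       (\<forall>a\<le>N. \<forall>b\<le>N. a \<noteq> z \<longrightarrow> b \<noteq> z \<longrightarrow>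
          4 * q z a b = q z (refl_down a) b + q z (refl_up N a) b + q z a (refl_down b) + q z a (refl_up N b)))"

lemma path_nbrs:
  assumes "1 \<le> N" "x \<le> N"
  shows "nbrs (path_verts (Suc N)) path_adj x = {refl_down x, refl_up N x}"
  using assms by (auto simp: nbrs_def path_verts_def path_adj_def refl_down_def refl_up_def)

lemma nn_integral_jump_pmf_path:
  fixes g :: "nat \<Rightarrow> ennreal"
  assumes "1 \<le> N" "x \<le> N"
  shows "(\<integral>\<^sup>+y. g y \<partial>measure_pmf (jump_pmf (path_verts (Suc N)) path_adj x)) = (g (refl_down x) + g (refl_up N x)) / 2"
proof -
  have "(\<integral>\<^sup>+y. g y \<partial>measure_pmf (jump_pmf (path_verts (Suc N)) path_adj x)) =
      sum g {refl_down x, refl_up N x} / of_nat (card {refl_down x, refl_up N x})"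
    by (simp add: jump_pmf_def path_nbrs[OF assms] nn_integral_pmf_of_set)
  also have "\<dots> = (g (refl_down x) + g (refl_up N x)) / 2"
  proof (cases "refl_down x = refl_up N x")
    case True
    have "(c + c) / 2 = c" for c :: ennreal
      by (cases c) (simp_all add: ennreal_average ennreal_top_divide)
    then show ?thesis using True by (simp add: divide_ennreal_def)
  qed (simp add: card_insert_if)
  finally show ?thesis .
qed

lemma first_passage_pos:
  assumes pos: "\<And>k. 0 < fst (\<omega> !! k)" and "b \<noteq> z"
  shows "0 < first_passage z b \<omega>"
proof (cases "\<exists>k. jump_chain b \<omega> k = z")
  case True
  define k where "k = (LEAST k. jump_chain b \<omega> k = z)"
  have "jump_chain b \<omega> k = z" unfolding k_def using True by (rule LeastI_ex)
  then have "k \<noteq> 0" using assms(2) by (metis jump_chain.simps(1))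
  then have "jump_time \<omega> (Suc 0) \<le> jump_time \<omega> k" by (intro jump_time_mono pos) simp
  then have "0 < jump_time \<omega> k" using pos[of 0] by (simp add: jump_time_def)
  then show ?thesis using True by (simp add: first_passage_def k_def)
qed (simp add: first_passage_def)

lemma half_win_pos:
  assumes "0 < t"
  shows "half_win 0 t = 1" "half_win t 0 = 0"
proof -
  have "\<not> t < 0" using assms by (rule less_not_sym)
  moreover have "t \<noteq> 0" using assms by (rule less_imp_neq[symmetric])
  ultimately show "half_win 0 t = 1" "half_win t 0 = 0" using assms by (simp_all add: half_win_def)
qed

lemma duel_value_boundary:
  fixes z b :: "'a :: countable"
  shows "duel_value V E z z z = ennreal (1 / 2)"
    and "b \<noteq> z \<Longrightarrow> duel_value V E z z b = 1"
    and "b \<noteq> z \<Longrightarrow> duel_value V E z b z = 0"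
proof -
  interpret W: prob_space "walk_measure V E" by (rule prob_space_walk_measure)
  show "duel_value V E z z z = ennreal (1 / 2)"
    by (simp add: duel_value_def first_passage_start half_win_def W.emeasure_space_1)
  assume b: "b \<noteq> z"
  have pos: "AE \<omega> in walk_measure V E. 0 < first_passage z b \<omega>"
    by (rule eventually_mono[OF AE_holding_times_pos]) (use b in \<open>simp add: first_passage_pos\<close>)
  have "AE \<omega> in walk_measure V E. half_win 0 (first_passage z b \<omega>) = 1"
    by (rule eventually_mono[OF pos]) (rule half_win_pos)
  then have "(\<integral>\<^sup>+\<omega>. half_win 0 (first_passage z b \<omega>) \<partial>walk_measure V E) = (\<integral>\<^sup>+\<omega>. 1 \<partial>walk_measure V E)"
    by (rule nn_integral_cong_AE)
  then show "duel_value V E z z b = 1"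
    by (simp add: duel_value_def first_passage_start W.emeasure_space_1)
  have "AE \<omega> in walk_measure V E. half_win (first_passage z b \<omega>) 0 = 0"
    by (rule eventually_mono[OF pos]) (rule half_win_pos)
  then have "(\<integral>\<^sup>+\<omega>. half_win (first_passage z b \<omega>) 0 \<partial>walk_measure V E) = (\<integral>\<^sup>+\<omega>. 0 \<partial>walk_measure V E)"
    by (rule nn_integral_cong_AE)
  then show "duel_value V E z b z = 0"
    by (simp add: duel_value_def first_passage_start W.emeasure_space_1)
qed

lemma first_hit_prob_nonneg: "0 \<le> first_hit_prob V E z a b"
  by (simp add: first_hit_prob_def)

lemma path_game_first_hit_prob:
  assumes N: "1 \<le> N"
  shows "path_game N (first_hit_prob (path_verts (Suc N)) path_adj)"
proof -
  let ?V = "path_verts (Suc N)" and ?q = "first_hit_prob (path_verts (Suc N)) path_adj"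
  have V: "finite ?V" "\<And>x. x \<in> ?V \<longleftrightarrow> x \<le> N" by (auto simp: path_verts_def)
  have eqI: "?q z a b = r" if "duel_value ?V path_adj z a b = ennreal r" "0 \<le> r" for z a b r
    using first_hit_prob_eq[of ?V path_adj z a b] that by (metis ennreal_inj first_hit_prob_nonneg)
  have "4 * ?q z a b = ?q z (refl_down a) b + ?q z (refl_up N a) b + ?q z a (refl_down b) + ?q z a (refl_up N b)"
    if "z \<le> N" "a \<le> N" "b \<le> N" "a \<noteq> z" "b \<noteq> z" for z a b
  proof -
    have "ennreal (?q z a b) =
      ((ennreal (?q z (refl_down a) b) + ennreal (?q z (refl_up N a) b)) / 2 +
       (ennreal (?q z a (refl_down b)) + ennreal (?q z a (refl_up N b))) / 2) / 2"
      unfolding first_hit_prob_eq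
      by (rule duel_value_step) (use that N in \<open>simp_all add: V nn_integral_jump_pmf_path\<close>)
    also have "\<dots> = ennreal (((?q z (refl_down a) b + ?q z (refl_up N a) b) / 2 +
       (?q z a (refl_down b) + ?q z a (refl_up N b)) / 2) / 2)"
      by (simp add: ennreal_average first_hit_prob_nonneg add_nonneg_nonneg)
    finally have "?q z a b = ((?q z (refl_down a) b + ?q z (refl_up N a) b) / 2 +
       (?q z a (refl_down b) + ?q z a (refl_up N b)) / 2) / 2"
      by (simp add: first_hit_prob_nonneg add_nonneg_nonneg)
    then show ?thesis by (simp add: field_simps)
  qed
  moreover have "?q z z z = 1 / 2" for z by (rule eqI[OF duel_value_boundary(1)]) simp
  moreover have "?q z z b = 1" if "b \<noteq> z" for z b
    by (rule eqI) (simp_all add: duel_value_boundary(2)[OF that])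
  moreover have "?q z b z = 0" if "b \<noteq> z" for z b
    by (rule eqI) (simp_all add: duel_value_boundary(3)[OF that])
  ultimately show ?thesis using N unfolding path_game_def by blast
qed

lemma path_gameD:
  assumes "path_game N q"
  shows "1 \<le> N"
    and "z \<le> N \<Longrightarrow> q z z z = 1 / 2"
    and "z \<le> N \<Longrightarrow> b \<le> N \<Longrightarrow> b \<noteq> z \<Longrightarrow> q z z b = 1"
    and "z \<le> N \<Longrightarrow> b \<le> N \<Longrightarrow> b \<noteq> z \<Longrightarrow> q z b z = 0"
    and "z \<le> N \<Longrightarrow> a \<le> N \<Longrightarrow> b \<le> N \<Longrightarrow> a \<noteq> z \<Longrightarrow> b \<noteq> z \<Longrightarrow>
      4 * q z a b = q z (refl_down a) b + q z (refl_up N a) b + q z a (refl_down b) + q z a (refl_up N b)"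
  using assms unfolding path_game_def by auto

lemma refl_le:
  assumes "1 \<le> N" "x \<le> N"
  shows "refl_down x \<le> N" "refl_up N x \<le> N"
  using assms by (auto simp: refl_down_def refl_up_def)

section \<open>Uniqueness and symmetries of the winning probabilities\<close>

lemma path_game_le:
  assumes q: "path_game N q" and q': "path_game N q'" and le: "z \<le> N" "a \<le> N" "b \<le> N"
  shows "q z a b \<le> q' z a b"
proof (cases "a = z \<or> b = z")
  case True
  have "q z z z = q' z z z" using path_gameD(2)[OF q] path_gameD(2)[OF q'] le by metis
  then show ?thesis
    using True path_gameD(3,4)[OF q] path_gameD(3,4)[OF q'] le by (cases "a = z"; cases "b = z") auto
next
  case False
  define S where "S = {(a, b). a \<le> N \<and> b \<le> N \<and> a \<noteq> z \<and> b \<noteq> z}"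
  define h where "h = (\<lambda>(a, b). q' z a b - q z a b)"
  note N = path_gameD(1)[OF q]
  have "q z z z = q' z z z" using path_gameD(2)[OF q] path_gameD(2)[OF q'] le by metis
  then have bdry: "h (a, b) = 0" if "a \<le> N" "b \<le> N" "(a, b) \<notin> S" for a b
    using that path_gameD(3,4)[OF q] path_gameD(3,4)[OF q'] le
    by (cases "a = z"; cases "b = z") (auto simp: S_def h_def)
  have "0 \<le> h (a, b)"
  \<comment> \<open>The map \<open>na\<close> steps towards the target, and the sum of the two
    truncated differences is the distance to it.\<close>
  proof (rule min_principle[where S = S and rank = "\<lambda>(a, b). (a - z) + (z - a)"
        and na = "\<lambda>(a, b). (if z < a then refl_down a else refl_up N a, b)"
        and nb = "\<lambda>(a, b). (if z < a then refl_up N a else refl_down a, b)"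
        and nc = "\<lambda>(a, b). (a, refl_down b)"
        and nd = "\<lambda>(a, b). (a, refl_up N b)"], goal_cases)
    case 1
    have "S \<subseteq> {..N} \<times> {..N}" by (auto simp: S_def)
    then show ?case by (rule finite_subset) auto
  next
    case (2 p)
    obtain a b where p: "p = (a, b)" by force
    have "a \<le> N" "b \<le> N" "a \<noteq> z" "b \<noteq> z" using 2 p by (auto simp: S_def)
    then show ?case
      using path_gameD(5)[OF q, of z a b] path_gameD(5)[OF q', of z a b] le by (simp add: p h_def)
  next
    case (7 p)
    then show ?case using le by (auto simp: S_def refl_down_def refl_up_def split: if_splits)
  next
    case (3 p)
    obtain a b where p: "p = (a, b)" by force
    then have "a \<le> N" "b \<le> N" using 3 by (auto simp: S_def)
    then show ?case using 3 p bdry[of _ b] refl_le[OF N, of a] by (cases "z < a") auto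
  next
    case (4 p)
    obtain a b where p: "p = (a, b)" by force
    then have "a \<le> N" "b \<le> N" using 4 by (auto simp: S_def)
    then show ?case using 4 p bdry[of _ b] refl_le[OF N, of a] by (cases "z < a") auto
  next
    case (5 p)
    obtain a b where p: "p = (a, b)" by force
    then have "a \<le> N" "b \<le> N" using 5 by (auto simp: S_def)
    then show ?case using 5 p bdry[of a] refl_le[OF N, of b] by auto
  next
    case (6 p)
    obtain a b where p: "p = (a, b)" by force
    then have "a \<le> N" "b \<le> N" using 6 by (auto simp: S_def)
    then show ?case using 6 p bdry[of a] refl_le[OF N, of b] by auto
  next
    case 8
    show ?case using False le by (simp add: S_def)
  qed
  then show ?thesis by (simp add: h_def)
qed

lemma path_game_complement:
  assumes q: "path_game N q" and le: "z \<le> N" "a \<le> N" "b \<le> N"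
  shows "q z a b = 1 - q z b a"
proof -
  have "path_game N (\<lambda>z a b. 1 - q z b a)"
    using q unfolding path_game_def by (auto simp: algebra_simps)
  from path_game_le[OF q this le] path_game_le[OF this q le] show ?thesis by (rule antisym)
qed

lemma path_game_reflect:
  assumes q: "path_game N q" and le: "z \<le> N" "a \<le> N" "b \<le> N"
  shows "q (N - z) (N - a) (N - b) = q z a b"
proof -
  have refl: "refl_down (N - x) = N - refl_up N x" "refl_up N (N - x) = N - refl_down x" if "x \<le> N" for x
    using that path_gameD(1)[OF q] by (auto simp: refl_up_def refl_down_def)
  have ne: "N - x \<noteq> N - z" if "x \<noteq> z" "x \<le> N" "z \<le> N" for x z using that by auto
  have "path_game N (\<lambda>z a b. q (N - z) (N - a) (N - b))"
    unfolding path_game_def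
  proof (intro conjI allI impI, goal_cases)
    case (5 z a b)
    then show ?case
      using path_gameD(5)[OF q, of "N - z" "N - a" "N - b"] ne[of a z] ne[of b z] by (simp add: refl)
  qed (use path_gameD(1)[OF q] in \<open>simp_all add: path_gameD(2-4)[OF q] ne\<close>)
  from path_game_le[OF this q le] path_game_le[OF q this le] show ?thesis by (rule antisym)
qed

text \<open>The walk that is to arrive first is at distance \<open>v\<close>, its opponent at
  distance \<open>u\<close>. Two walkers on the same side give a square, walkers on opposite sides a
  rectangle with widths \<open>z\<close> and \<open>N - z\<close>.\<close>

lemma path_game_duel:
  assumes q: "path_game N q" and z: "z \<le> N"
  shows "duel (N - z) (N - z) (\<lambda>u v. q z (z + v) (z + u))"
    and "duel z z (\<lambda>u v. q z (z - v) (z - u))"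
    and "duel z (N - z) (\<lambda>u v. q z (z + v) (z - u))"
    and "duel (N - z) z (\<lambda>u v. q z (z - v) (z + u))"
proof -
  have R: "refl_down (z + v) = z + (v - 1)" "refl_up N (z + v) = z + refl_up (N - z) v"
    "z + v \<le> N" "z + v \<noteq> z" if "1 \<le> v" "v \<le> N - z" for v
    using that by (auto simp: refl_down_def refl_up_def)
  have L: "refl_down (z - v) = z - refl_up z v" "refl_up N (z - v) = z - (v - 1)"
    "z - v \<le> N" "z - v \<noteq> z" if "1 \<le> v" "v \<le> z" for v
    using that z by (auto simp: refl_down_def refl_up_def)
  note simps = duel_def path_gameD(3,4)[OF q z] path_gameD(5)[OF q z]
  show "duel (N - z) (N - z) (\<lambda>u v. q z (z + v) (z + u))"
    unfolding duel_def
    by (intro conjI ballI) (simp_all add: path_gameD(3,4)[OF q z] path_gameD(5)[OF q z] R)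
  show "duel z z (\<lambda>u v. q z (z - v) (z - u))"
    unfolding duel_def
    by (intro conjI ballI) (simp_all add: path_gameD(3,4)[OF q z] path_gameD(5)[OF q z] L)
  show "duel z (N - z) (\<lambda>u v. q z (z + v) (z - u))"
    unfolding duel_def
    by (intro conjI ballI) (simp_all add: path_gameD(3,4)[OF q z] path_gameD(5)[OF q z] L R)
  show "duel (N - z) z (\<lambda>u v. q z (z - v) (z + u))"
    unfolding duel_def
    by (intro conjI ballI) (simp_all add: path_gameD(3,4)[OF q z] path_gameD(5)[OF q z] L R)
qed

section \<open>The advantage and its source\<close>

definition path_adv :: "nat \<Rightarrow> (nat \<Rightarrow> nat \<Rightarrow> nat \<Rightarrow> real) \<Rightarrow> nat \<Rightarrow> nat \<Rightarrow> real" where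
  "path_adv N q x y = (\<Sum>z\<le>N. q z x y) - (real N + 1) / 2"

lemma path_adv_swap:
  assumes "path_game N q" "x \<le> N" "y \<le> N"
  shows "path_adv N q y x = - path_adv N q x y"
proof -
  have "(\<Sum>z\<le>N. q z y x) = (\<Sum>z\<le>N. 1 - q z x y)"
    using assms by (intro sum.cong refl path_game_complement[OF assms(1)]) auto
  also have "\<dots> = (real N + 1) - (\<Sum>z\<le>N. q z x y)" by (simp add: sum_subtractf)
  finally show ?thesis unfolding path_adv_def by (simp add: field_simps)
qed

lemma path_adv_reflect:
  assumes "path_game N q" "x \<le> N" "y \<le> N"
  shows "path_adv N q (N - x) (N - y) = path_adv N q x y"
proof -
  have "(\<Sum>z\<le>N. q z (N - x) (N - y)) = (\<Sum>z\<le>N. q (N - z) (N - x) (N - y))"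
    by (rule sum.reindex_bij_witness[of _ "\<lambda>z. N - z" "\<lambda>z. N - z"]) auto
  also have "\<dots> = (\<Sum>z\<le>N. q z x y)"
    using path_game_reflect[OF assms(1)] assms by (intro sum.cong) auto
  finally show ?thesis by (simp add: path_adv_def)
qed

lemma path_adv_diag:
  assumes "path_game N q" "x \<le> N"
  shows "path_adv N q x x = 0"
  using path_adv_swap[OF assms(1), of x x] assms by linarith

lemma path_adv_antidiag:
  assumes "path_game N q" "x \<le> N"
  shows "path_adv N q x (N - x) = 0"
proof -
  have "N - (N - x) = x" using assms by simp
  then have "path_adv N q (N - x) x = path_adv N q x (N - x)"
    using path_adv_reflect[OF assms(1), of x "N - x"] assms by simp
  then show ?thesis using path_adv_swap[OF assms(1), of x "N - x"] assms by linarith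
qed

text \<open>Every \<open>q z\<close> is harmonic off \<open>z\<close>, so only the targets \<open>x\<close> and \<open>y\<close> contribute.\<close>

lemma path_adv_source:
  assumes q: "path_game N q" and xy: "x \<le> N" "y \<le> N" "x \<noteq> y"
  shows "4 * path_adv N q x y - (path_adv N q (refl_down x) y + path_adv N q (refl_up N x) y +
      path_adv N q x (refl_down y) + path_adv N q x (refl_up N y)) =
    (4 - (q x (refl_down x) y + q x (refl_up N x) y + q x x (refl_down y) + q x x (refl_up N y))) -
    (q y (refl_down x) y + q y (refl_up N x) y + q y x (refl_down y) + q y x (refl_up N y))"
proof -
  define f where "f z = 4 * q z x y - (q z (refl_down x) y + q z (refl_up N x) y + q z x (refl_down y) + q z x (refl_up N y))" for z
  have f0: "f z = 0" if "z \<le> N" "z \<noteq> x" "z \<noteq> y" for z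
    using path_gameD(5)[OF q, of z x y] that xy by (simp add: f_def)
  have "(\<Sum>z\<le>N. f z) = (\<Sum>z\<in>{x, y}. f z)"
    using xy f0 by (intro sum.mono_neutral_right) auto
  also have "\<dots> = f x + f y" using xy by simp
  finally have "(\<Sum>z\<le>N. f z) = f x + f y" .
  moreover have "(\<Sum>z\<le>N. f z) = 4 * path_adv N q x y - (path_adv N q (refl_down x) y + path_adv N q (refl_up N x) y +
      path_adv N q x (refl_down y) + path_adv N q x (refl_up N y))"
  proof -
    have "(\<Sum>z\<le>N. f z) = 4 * (\<Sum>z\<le>N. q z x y) - ((\<Sum>z\<le>N. q z (refl_down x) y) + (\<Sum>z\<le>N. q z (refl_up N x) y) +
        (\<Sum>z\<le>N. q z x (refl_down y)) + (\<Sum>z\<le>N. q z x (refl_up N y)))"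
      unfolding f_def by (simp only: sum_subtractf sum.distrib sum_distrib_left)
    moreover have "4 * (A - c) - ((B - c) + (C - c) + (D - c) + (E - c)) = 4 * A - (B + C + D + E)"
      for A B C D E c :: real by simp
    ultimately show ?thesis unfolding path_adv_def by metis
  qed
  moreover have "q x x y = 1" "q y x y = 0" using path_gameD(3,4)[OF q] xy by auto
  ultimately have "4 * path_adv N q x y - (path_adv N q (refl_down x) y + path_adv N q (refl_up N x) y +
      path_adv N q x (refl_down y) + path_adv N q x (refl_up N y)) = f x + f y" "q x x y = 1" "q y x y = 0" by auto
  then show ?thesis unfolding f_def by linarith
qed

text \<open>The factor 2 arises because at \<open>y = N\<close> both neighbours of \<open>y\<close>
  are \<open>N - 1\<close>. For \<open>x + 1 = N\<close> the remaining terms involve ties of value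
  \<open>1 / 2\<close>, and their contributions cancel.\<close>

definition end_source :: "nat \<Rightarrow> (nat \<Rightarrow> nat \<Rightarrow> nat \<Rightarrow> real) \<Rightarrow> nat \<Rightarrow> real" where
  "end_source N q x = q x N (x - 1) + (if x + 1 < N then q x N (x + 1) - 2 * q N x (N - 1) else 0)"

text \<open>The source consists of two wins at target \<open>x\<close> minus two at target
  \<open>y\<close>. Since \<open>N < x + y\<close>, the side to the right of \<open>x\<close> is
  narrower than the side to the left of \<open>y\<close>, and that to the right of \<open>y\<close>
  narrower than that to the left of \<open>x\<close>. The terms for opposite sides are compared by
  \<open>duel_le\<close>, those for the same side by \<open>duel_square_le\<close>.\<close>

lemma path_adv_source_interior:
  assumes q: "path_game N q" and xy: "x < y" "y < N" "N < x + y"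
  shows "path_adv N q (x - 1) y + path_adv N q (x + 1) y + path_adv N q x (y - 1) + path_adv N q x (y + 1)
    \<le> 4 * path_adv N q x y"
proof -
  have x: "1 \<le> x" "refl_down x = x - 1" "refl_up N x = x + 1" "refl_down y = y - 1" "refl_up N y = y + 1"
    using xy by (auto simp: refl_down_def refl_up_def)
  have b1: "q y x (y + 1) \<le> q x y (x - 1)"
    using duel_le[OF path_game_duel(4)[OF q, of y] path_game_duel(3)[OF q, of x], of 1 "y - x"] xy x by simp
  have b2: "q y x (y - 1) \<le> q x y (x + 1)"
    using duel_square_le[OF path_game_duel(1)[OF q, of x] path_game_duel(2)[OF q, of y], of 1 "y - x"] xy by simp
  note src = path_adv_source[OF q, of x y, unfolded x(2-5)]
  have e: "q x (x - 1) y = 1 - q x y (x - 1)" "q x (x + 1) y = 1 - q x y (x + 1)"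
    using path_game_complement[OF q, of x "x - 1" y] path_game_complement[OF q, of x "x + 1" y] xy by auto
  have e1: "q x x (y + 1) = 1" "q y (x - 1) y = 0" using path_gameD(3,4)[OF q] xy by auto
  show ?thesis
  proof (cases "y = x + 1")
    case True
    have "q x x x = 1 / 2" "q y y y = 1 / 2" using path_gameD(2)[OF q] xy by auto
    then show ?thesis using src e e1 b1 b2 True xy by simp
  next
    case False
    then have "q x x (y - 1) = 1" "q y (x + 1) y = 0" using path_gameD(3,4)[OF q] xy by auto
    then show ?thesis using src e e1 b1 b2 xy by simp
  qed
qed

lemma path_adv_source_end:
  assumes q: "path_game N q" and x: "1 \<le> x" "x < N"
  shows "4 * path_adv N q x N =
    path_adv N q (x - 1) N + path_adv N q (x + 1) N + 2 * path_adv N q x (N - 1) + end_source N q x"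
proof -
  have r: "refl_down x = x - 1" "refl_up N x = x + 1" "refl_down N = N - 1" "refl_up N N = N - 1"
    using x by (auto simp: refl_down_def refl_up_def)
  note src = path_adv_source[OF q, of x N, unfolded r]
  have e: "q x (x - 1) N = 1 - q x N (x - 1)" "q x (x + 1) N = 1 - q x N (x + 1)"
    using path_game_complement[OF q, of x "x - 1" N] path_game_complement[OF q, of x "x + 1" N] x by auto
  have e1: "q N (x - 1) N = 0" using path_gameD(4)[OF q] x by auto
  show ?thesis
  proof (cases "N = x + 1")
    case True
    have "q x x x = 1 / 2" "q N N N = 1 / 2" "q N x x = 1 - q N x x" "q x N N = 1 - q x N N"
      using path_gameD(2)[OF q] path_game_complement[OF q, of N x x] path_game_complement[OF q, of x N N] x by auto
    then show ?thesis using src e e1 True x by (simp add: end_source_def)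
  next
    case False
    then have "q x x (N - 1) = 1" "q N (x + 1) N = 0" using path_gameD(3,4)[OF q] x by auto
    then show ?thesis using src e e1 x False by (simp add: end_source_def)
  qed
qed

text \<open>
  In the centred coordinates \<open>X = 2 x - N\<close> and \<open>Y = 2 y - N\<close> the polynomial below is exactly harmonic
  for the discrete Laplacian and vanishes for \<open>X = Y\<close> and \<open>X = - Y\<close>, like the advantage itself.
\<close>

definition barrier :: "nat \<Rightarrow> nat \<Rightarrow> nat \<Rightarrow> real" where
  "barrier N x y = (let X = 2 * real x - real N; Y = 2 * real y - real N
     in (Y\<^sup>2 - X\<^sup>2) * (X * Y + real N))"

definition barrier_charge :: "nat \<Rightarrow> nat \<Rightarrow> real" where
  "barrier_charge N x = (let X = 2 * real x - real N
     in 4 * (X * (3 * (real N)\<^sup>2 + 4 - X\<^sup>2) + 2 * (real N)\<^sup>2))"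

lemma barrier_harmonic:
  assumes "1 \<le> x" "1 \<le> y"
  shows "barrier N (x - 1) y + barrier N (x + 1) y + barrier N x (y - 1) + barrier N x (y + 1) = 4 * barrier N x y"
proof -
  have "real (x - 1) = real x - 1" "real (x + 1) = real x + 1" "real (y - 1) = real y - 1" "real (y + 1) = real y + 1"
    using assms by (simp_all add: of_nat_diff)
  then show ?thesis unfolding barrier_def Let_def by algebra
qed

lemma barrier_end:
  assumes "1 \<le> x" "1 \<le> N"
  shows "4 * barrier N x N = barrier N (x - 1) N + barrier N (x + 1) N + 2 * barrier N x (N - 1) + barrier_charge N x"
proof -
  have "real (x - 1) = real x - 1" "real (x + 1) = real x + 1" "real (N - 1) = real N - 1"
    using assms by (simp_all add: of_nat_diff)
  then show ?thesis unfolding barrier_def barrier_charge_def Let_def by algebra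
qed

text \<open>
  Off the edge \<open>y = N\<close> of the triangle the source of the advantage is nonnegative while the barrier has none,
  so the comparison need only be checked on that edge.
\<close>

lemma path_adv_ge_barrier:
  assumes q: "path_game N q"
    and src: "\<And>x. 1 \<le> x \<Longrightarrow> x < N \<Longrightarrow> c * barrier_charge N x \<le> end_source N q x"
    and xy: "x < y" "y \<le> N" "N < x + y"
  shows "c * barrier N x y \<le> path_adv N q x y"
proof -
  define S where "S = {(x, y). x < y \<and> y \<le> N \<and> N < x + y}"
  define g where "g = (\<lambda>(x, y). path_adv N q x y - c * barrier N x y)"
  have bdry: "g (x, y) = 0" if "x = y \<or> x + y = N" "x \<le> N" for x y
  proof -
    have "path_adv N q x y = 0"
      using that path_adv_diag[OF q, of x] path_adv_antidiag[OF q, of x] by force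
    moreover have "barrier N x y = 0"
    proof -
      have "real y = real x \<or> real y = real N - real x" using that(1) by auto
      then have "2 * real y - real N = 2 * real x - real N \<or> 2 * real y - real N = - (2 * real x - real N)" by linarith
      then have "(2 * real y - real N)\<^sup>2 = (2 * real x - real N)\<^sup>2" by (metis power2_minus)
      then show ?thesis by (simp add: barrier_def Let_def)
    qed
    ultimately show ?thesis by (simp add: g_def)
  qed
  have "0 \<le> g (x, y)"
  proof (rule min_principle[where S = S and rank = snd and na = "\<lambda>(x, y). (x, y - 1)"
        and nb = "\<lambda>(x, y). (x - 1, y)" and nc = "\<lambda>(x, y). (x + 1, y)"
        and nd = "\<lambda>(x, y). (x, refl_up N y)"], goal_cases)
    case 1
    have "S \<subseteq> {..N} \<times> {..N}" by (auto simp: S_def)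
    then show ?case by (rule finite_subset) auto
  next
    case (2 p)
    obtain x y where p: "p = (x, y)" by force
    have xy: "x < y" "y \<le> N" "N < x + y" using 2 p by (auto simp: S_def)
    then have x: "1 \<le> x" "x < N" "1 \<le> y" by auto
    show ?case
    proof (cases "y < N")
      case True
      have "c * (barrier N (x - 1) y + barrier N (x + 1) y + barrier N x (y - 1) + barrier N x (y + 1)) = c * (4 * barrier N x y)"
        using barrier_harmonic[of x y N] x by simp
      then show ?thesis
        using path_adv_source_interior[OF q xy(1) True xy(3)] True
        by (simp add: p g_def refl_up_def distrib_left)
    next
      case False
      then have "y = N" using xy by simp
      have "c * (4 * barrier N x N) = c * (barrier N (x - 1) N + barrier N (x + 1) N + 2 * barrier N x (N - 1) + barrier_charge N x)"
        using barrier_end[of x N] x path_gameD(1)[OF q] by simp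
      then show ?thesis
        using path_adv_source_end[OF q x(1,2)] src[OF x(1,2)] \<open>y = N\<close>
        by (simp add: p g_def refl_up_def distrib_left)
    qed
  next
    case (3 p)
    obtain x y where p: "p = (x, y)" by force
    then have "x = y - 1 \<or> x + (y - 1) = N" "x \<le> N" using 3 by (auto simp: S_def)
    from bdry[OF this] show ?case by (simp add: p)
  next
    case (4 p)
    obtain x y where p: "p = (x, y)" by force
    then have "x - 1 = y \<or> (x - 1) + y = N" "x - 1 \<le> N" using 4 by (auto simp: S_def)
    from bdry[OF this] show ?case by (simp add: p)
  next
    case (5 p)
    obtain x y where p: "p = (x, y)" by force
    then have "x + 1 = y \<or> (x + 1) + y = N" "x + 1 \<le> N" using 5 by (auto simp: S_def)
    from bdry[OF this] show ?case by (simp add: p)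
  next
    case (6 p)
    obtain x y where p: "p = (x, y)" by force
    then have "y = N" "x = y - 1 \<or> x + (y - 1) = N" "x \<le> N" using 6 by (auto simp: S_def refl_up_def split: if_splits)
    then show ?case using bdry[of x "y - 1"] by (simp add: p refl_up_def)
  next
    case (7 p)
    then show ?case by (auto simp: S_def)
  next
    case 8
    then show ?case using xy by (simp add: S_def)
  qed
  then show ?thesis by (simp add: g_def)
qed

text \<open>The summand \<open>N\<close> in the barrier is what admits \<open>X = -1\<close>, the
  left of two central vertices: \<open>X * Y + N \<ge> N - Y\<close>. This can vanish only at
  \<open>y = N\<close>, so on that edge strictness is taken from the strict source inequality
  instead.\<close>

lemma path_adv_pos:
  assumes q: "path_game N q" and c: "0 < c"
    and src: "\<And>x. 1 \<le> x \<Longrightarrow> x < N \<Longrightarrow> c * barrier_charge N x < end_source N q x"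
    and xy: "x < y" "y \<le> N" "N < x + y" and central: "N \<le> 2 * x + 1"
  shows "0 < path_adv N q x y"
proof -
  have ge: "c * barrier N x' y' \<le> path_adv N q x' y'" if "x' \<le> y'" "y' \<le> N" "N \<le> x' + y'" for x' y'
  proof (cases "x' < y' \<and> N < x' + y'")
    case True
    then show ?thesis using path_adv_ge_barrier[OF q less_imp_le[OF src]] that by blast
  next
    case False
    then have b: "x' = y' \<or> y' = N - x'" "x' \<le> N" using that by auto
    then have "path_adv N q x' y' = 0"
      using path_adv_diag[OF q, of x'] path_adv_antidiag[OF q, of x'] by auto
    moreover have "real y' = real x' \<or> real y' = real N - real x'" using b by (auto simp: of_nat_diff)
    then have "2 * real y' - real N = 2 * real x' - real N \<or> 2 * real y' - real N = - (2 * real x' - real N)" by linarith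
    then have "(2 * real y' - real N)\<^sup>2 = (2 * real x' - real N)\<^sup>2" by (metis power2_minus)
    ultimately show ?thesis by (simp add: barrier_def Let_def)
  qed
  define X where "X = 2 * real x - real N"
  define Y where "Y = 2 * real y - real N"
  have X: "- 1 \<le> X" "X < Y" "- Y < X" "Y \<le> N" using xy central by (auto simp: X_def Y_def)
  have "\<bar>X\<bar> < \<bar>Y\<bar>" using X by linarith
  then have sq: "0 < Y\<^sup>2 - X\<^sup>2" using abs_le_square_iff[of Y X] by linarith
  have bar: "barrier N x y = (Y\<^sup>2 - X\<^sup>2) * (X * Y + real N)" by (simp add: barrier_def X_def Y_def Let_def)
  have XY: "- Y \<le> X * Y" using mult_right_mono[of "- 1" X Y] X by linarith
  show ?thesis
  proof (cases "y < N")
    case True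
    then have "Y < N" by (simp add: Y_def)
    with XY have "0 < X * Y + real N" by linarith
    then have "0 < c * barrier N x y" unfolding bar by (rule mult_pos_pos[OF c mult_pos_pos[OF sq]])
    moreover have "c * barrier N x y \<le> path_adv N q x y" by (rule ge) (use xy in auto)
    ultimately show ?thesis by linarith
  next
    case False
    then have y: "y = N" using xy by simp
    have "0 \<le> X * Y + real N" using XY X(4) by linarith
    then have "0 \<le> barrier N x y" unfolding bar by (rule mult_nonneg_nonneg[OF less_imp_le[OF sq]])
    then have nonneg: "0 \<le> c * barrier N x N" using c y by simp
    have x: "1 \<le> x" "x < N" using xy y by auto
    have "c * (4 * barrier N x N) = c * (barrier N (x - 1) N + barrier N (x + 1) N + 2 * barrier N x (N - 1) + barrier_charge N x)"
      using barrier_end[of x N] x by auto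
    moreover have "c * barrier N (x - 1) N \<le> path_adv N q (x - 1) N" "c * barrier N (x + 1) N \<le> path_adv N q (x + 1) N"
      "c * barrier N x (N - 1) \<le> path_adv N q x (N - 1)"
      using x xy y central by (intro ge; simp)+
    ultimately have "c * (4 * barrier N x N) < 4 * path_adv N q x N"
      using path_adv_source_end[OF q x] src[OF x] by (simp add: distrib_left)
    then show ?thesis using nonneg by (simp add: y)
  qed
qed

section \<open>Superharmonic upper bounds\<close>

lemma duel_le_half:
  assumes f: "duel R R f" and uv: "1 \<le> u" "u \<le> v" "v \<le> R"
  shows "f u v \<le> 1 / 2"
  using uv(2,3)
proof (induction v rule: dec_induct)
  case base
  then show ?case using duel_diag[OF f, of u] uv by simp
next
  case (step v)
  then show ?case using duel_mono_right[OF f, of u v] uv by simp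
qed

text \<open>The even extension about \<open>v = N\<close> turns the reflecting wall into interior
  points, so the comparison functions below need not be symmetric there.\<close>

definition refl_ext :: "nat \<Rightarrow> (nat \<Rightarrow> nat \<Rightarrow> real) \<Rightarrow> nat \<Rightarrow> nat \<Rightarrow> real" where
  "refl_ext N f u v = f u (if v \<le> N then v else 2 * N - v)"

lemma refl_ext_zero:
  assumes "duel N N f" "1 \<le> v" "v < 2 * N"
  shows "refl_ext N f 0 v = 0"
  using assms duelD(1)[OF assms(1)] by (auto simp: refl_ext_def)

lemma refl_ext_le_half:
  assumes "duel N N f" "1 \<le> u" "u \<le> v" "u + v \<le> 2 * N"
  shows "refl_ext N f u v \<le> 1 / 2"
  unfolding refl_ext_def by (rule duel_le_half[OF assms(1,2)]) (use assms in auto)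

lemma refl_ext_harmonic:
  assumes f: "duel N N f" and uv: "1 \<le> u" "u < N" "1 \<le> v" "v < 2 * N"
  shows "4 * refl_ext N f u v = refl_ext N f (u - 1) v + refl_ext N f (u + 1) v +
    refl_ext N f u (v - 1) + refl_ext N f u (v + 1)"
proof (cases "v < N \<or> v = N")
  case True
  have "2 * N - (N + 1) = N - 1" by simp
  then show ?thesis using True duelD(3)[OF f, of u v] uv by (auto simp: refl_ext_def refl_up_def)
next
  case False
  define w where "w = 2 * N - v"
  have w: "1 \<le> w" "w < N" "2 * N - (v + 1) = w - 1" "2 * N - (v - 1) = w + 1" "\<not> v \<le> N" "\<not> v + 1 \<le> N"
    using False uv by (auto simp: w_def)
  have "v - 1 = w + 1" if "v - 1 \<le> N" using that False uv by (auto simp: w_def)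
  then have "refl_ext N f u (v - 1) = f u (w + 1)" using w(4) by (auto simp: refl_ext_def)
  then show ?thesis using duelD(3)[OF f, of u w] uv w by (simp add: refl_ext_def refl_up_def w_def[symmetric])
qed

text \<open>On the slanted sides \<open>u = v\<close> and \<open>u + v = S\<close> the extension is
  at most \<open>1 / 2\<close>, and it vanishes for \<open>u = 0\<close>; the factor 2 normalises
  the boundary values to 1 and 0.\<close>

lemma refl_ext_le_superharmonic:
  assumes f: "duel N N f" and S: "S \<le> 2 * N"
    and super: "\<And>u v. 1 \<le> u \<Longrightarrow> u < v \<Longrightarrow> u + v < S \<Longrightarrow>
      \<psi> (u - 1) v + \<psi> (u + 1) v + \<psi> u (v - 1) + \<psi> u (v + 1) \<le> 4 * \<psi> u v"
    and bdry: "\<And>v. 1 \<le> v \<Longrightarrow> v < S \<Longrightarrow> 0 \<le> \<psi> 0 v" "\<And>u. 1 \<le> u \<Longrightarrow> 1 \<le> \<psi> u u"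
      "\<And>u v. 1 \<le> u \<Longrightarrow> u < v \<Longrightarrow> u + v = S \<Longrightarrow> 1 \<le> \<psi> u v"
    and uv: "1 \<le> u" "u < v" "u + v < S"
  shows "2 * refl_ext N f u v \<le> \<psi> u v"
proof -
  define R where "R = {(u, v). 1 \<le> u \<and> u < v \<and> u + v < S}"
  define g where "g = (\<lambda>(u, v). \<psi> u v - 2 * refl_ext N f u v)"
  have edge: "0 \<le> g (u, v)" if "1 \<le> u" "u = v \<or> (u < v \<and> u + v = S)" "u + v \<le> S" for u v
    using that refl_ext_le_half[OF f, of u v] bdry(2)[of u] bdry(3)[of u v] S by (auto simp: g_def)
  have "0 \<le> g (u, v)"
  proof (rule min_principle[where S = R and rank = fst and na = "\<lambda>(u, v). (u - 1, v)"
        and nb = "\<lambda>(u, v). (u + 1, v)" and nc = "\<lambda>(u, v). (u, v - 1)"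
        and nd = "\<lambda>(u, v). (u, v + 1)"], goal_cases)
    case 1
    have "R \<subseteq> {..S} \<times> {..S}" by (auto simp: R_def)
    then show ?case by (rule finite_subset) auto
  next
    case (2 p)
    obtain u v where p: "p = (u, v)" by force
    then have uv: "1 \<le> u" "u < v" "u + v < S" using 2 by (auto simp: R_def)
    then show ?case using super[OF uv] refl_ext_harmonic[OF f, of u v] S by (simp add: p g_def)
  next
    case (3 p)
    obtain u v where p: "p = (u, v)" by force
    then have "u - 1 = 0" "1 \<le> v" "v < S" using 3 by (auto simp: R_def)
    then show ?case using bdry(1)[of v] refl_ext_zero[OF f, of v] S by (simp add: p g_def)
  next
    case (4 p)
    obtain u v where p: "p = (u, v)" by force
    then show ?case using 4 by (auto simp: R_def intro!: edge)
  next
    case (5 p)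
    obtain u v where p: "p = (u, v)" by force
    then show ?case using 5 by (auto simp: R_def intro!: edge)
  next
    case (6 p)
    obtain u v where p: "p = (u, v)" by force
    then show ?case using 6 by (auto simp: R_def intro!: edge)
  next
    case (7 p)
    then show ?case by (auto simp: R_def)
  next
    case 8
    then show ?case using uv by (simp add: R_def)
  qed
  then show ?thesis by (simp add: g_def)
qed

lemma inverse_midpoint:
  fixes s :: real
  assumes "1 < s"
  shows "2 / s \<le> 1 / (s - 1) + 1 / (s + 1)"
proof -
  have "2 / s = 2 * s / (s * s)" using assms by simp
  also have "\<dots> \<le> 2 * s / (s * s - 1)"
    using assms mult_strict_mono[of 1 s 1 s] by (intro divide_left_mono) auto
  also have "\<dots> = 1 / (s - 1) + 1 / (s + 1)"
    using assms mult_strict_mono[of 1 s 1 s] by (simp add: divide_simps) (simp add: algebra_simps)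
  finally show ?thesis .
qed

text \<open>The terms \<open>2 * u / (u + v)\<close> and \<open>2 * u / (S - v + u)\<close> belong
  to the corners \<open>(0, 0)\<close> and \<open>(0, S)\<close>: each is 0 on \<open>u = 0\<close>
  and 1 on one slanted side. On the other slanted side it equals \<open>2 * u / S\<close>, which the
  linear term removes.\<close>

lemma refl_ext_le_corner:
  assumes f: "duel N N f" and S: "S \<le> 2 * N" and uv: "1 \<le> u" "u < v" "u + v < S"
  shows "refl_ext N f u v \<le> real u * (1 / real (u + v) + 1 / (real S - real v + real u) - 1 / real S)"
proof -
  define \<psi> where "\<psi> u v = 2 * real u * (1 / (real u + real v) + 1 / (real S - real v + real u) - 1 / real S)" for u v
  have "2 * refl_ext N f u v \<le> \<psi> u v"
  proof (rule refl_ext_le_superharmonic[OF f S], goal_cases)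
    case (1 u v)
    define r where "r = real u + real v"
    define w where "w = real S - real v + real u"
    define p where "p = real v - real u"
    have r: "1 < r" "1 < w" "0 < p" "0 < real S - r" using 1 by (auto simp: r_def w_def p_def)
    \<comment> \<open>In the coordinates \<open>v - u\<close> and \<open>u + v\<close> every step
      changes both by one. The changes of the numerators cancel in pairs, which leaves the convexity
      of the reciprocal.\<close>
    have alt: "\<psi> a b = (1 - (real b - real a) / (real a + real b)) +
        (1 - (real S - real a - real b) / (real S - real b + real a)) - 2 * real a / real S"
      if "real a + real b \<noteq> 0" "real S - real b + real a \<noteq> 0" for a b
      using that by (simp add: \<psi>_def field_simps)
    have u: "real (u - 1) = real u - 1" "real (v - 1) = real v - 1" using 1 by auto
    have "\<psi> (u - 1) v = (1 - (p + 1) / (r - 1)) + (1 - (real S - r + 1) / (w - 1)) - 2 * (real u - 1) / real S"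
      using 1 by (subst alt) (auto simp: u r_def w_def p_def algebra_simps)
    moreover have "\<psi> (u + 1) v = (1 - (p - 1) / (r + 1)) + (1 - (real S - r - 1) / (w + 1)) - 2 * (real u + 1) / real S"
      using 1 by (subst alt) (auto simp: u r_def w_def p_def algebra_simps)
    moreover have "\<psi> u (v - 1) = (1 - (p - 1) / (r - 1)) + (1 - (real S - r + 1) / (w + 1)) - 2 * real u / real S"
      using 1 by (subst alt) (auto simp: u r_def w_def p_def algebra_simps)
    moreover have "\<psi> u (v + 1) = (1 - (p + 1) / (r + 1)) + (1 - (real S - r - 1) / (w - 1)) - 2 * real u / real S"
      using 1 by (subst alt) (auto simp: u r_def w_def p_def algebra_simps)
    moreover have "\<psi> u v = (1 - p / r) + (1 - (real S - r) / w) - 2 * real u / real S"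
      using 1 by (subst alt) (auto simp: u r_def w_def p_def algebra_simps)
    moreover have "p * (2 / r) \<le> p * (1 / (r - 1) + 1 / (r + 1))"
      by (intro mult_left_mono inverse_midpoint) (use r in auto)
    moreover have "(real S - r) * (2 / w) \<le> (real S - r) * (1 / (w - 1) + 1 / (w + 1))"
      by (intro mult_left_mono inverse_midpoint) (use r in auto)
    ultimately show ?case
      by (simp add: add_divide_distrib diff_divide_distrib distrib_left)
  next
    case (3 u)
    then show ?case by (simp add: \<psi>_def field_simps)
  next
    case (4 u v)
    then have "real u + real v = real S" "real S - real v + real u = 2 * real u" by linarith+
    then have "\<psi> u v = 2 * real u * (1 / real S + 1 / (2 * real u) - 1 / real S)" by (simp only: \<psi>_def)
    then show ?case using 4(1) by simp
  qed (use uv in \<open>auto simp: \<psi>_def\<close>)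
  then show ?thesis by (simp add: \<psi>_def)
qed

text \<open>Only the corner \<open>(0, 0)\<close> gets a rational term. The harmonic polynomial
  \<open>v ^ 2 - u ^ 2\<close>, zero on the diagonal, is scaled to restore the value 1 on
  \<open>u + v = 2 * N\<close>.\<close>

lemma refl_ext_le_corner_square:
  assumes f: "duel N N f" and uv: "1 \<le> u" "u < v" "u + v < 2 * N"
  shows "refl_ext N f u v \<le> real u / real (u + v) + ((real v)\<^sup>2 - (real u)\<^sup>2) / (8 * (real N)\<^sup>2)"
proof -
  define \<psi> where "\<psi> u v = 2 * real u / (real u + real v) + ((real v)\<^sup>2 - (real u)\<^sup>2) / (4 * (real N)\<^sup>2)" for u v
  have "2 * refl_ext N f u v \<le> \<psi> u v"
  proof (rule refl_ext_le_superharmonic[OF f order_refl], goal_cases)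
    case (1 u v)
    define r where "r = real u + real v"
    define p where "p = real v - real u"
    define c where "c = 4 * (real N)\<^sup>2"
    have r: "1 < r" "0 < p" using 1 by (auto simp: r_def p_def)
    have alt: "\<psi> a b = 1 - (real b - real a) / (real a + real b) + (real b - real a) * (real a + real b) / c"
      if "real a + real b \<noteq> 0" for a b
      using that by (simp add: \<psi>_def c_def field_simps power2_eq_square)
    have u: "real (u - 1) = real u - 1" "real (v - 1) = real v - 1" using 1 by auto
    have "\<psi> (u - 1) v = 1 - (p + 1) / (r - 1) + (p + 1) * (r - 1) / c"
      using 1 by (subst alt) (auto simp: u r_def p_def algebra_simps)
    moreover have "\<psi> (u + 1) v = 1 - (p - 1) / (r + 1) + (p - 1) * (r + 1) / c"
      using 1 by (subst alt) (auto simp: u r_def p_def algebra_simps)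
    moreover have "\<psi> u (v - 1) = 1 - (p - 1) / (r - 1) + (p - 1) * (r - 1) / c"
      using 1 by (subst alt) (auto simp: u r_def p_def algebra_simps)
    moreover have "\<psi> u (v + 1) = 1 - (p + 1) / (r + 1) + (p + 1) * (r + 1) / c"
      using 1 by (subst alt) (auto simp: u r_def p_def algebra_simps)
    moreover have "\<psi> u v = 1 - p / r + p * r / c"
      using 1 by (subst alt) (auto simp: u r_def p_def algebra_simps)
    moreover have "p * (2 / r) \<le> p * (1 / (r - 1) + 1 / (r + 1))"
      by (intro mult_left_mono inverse_midpoint) (use r in auto)
    ultimately show ?case
      by (simp add: add_divide_distrib diff_divide_distrib distrib_left distrib_right left_diff_distrib right_diff_distrib)
  next
    case (3 u)
    then show ?case by (simp add: \<psi>_def field_simps)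
  next
    case (4 u v)
    then have N: "2 * real N = real u + real v" by linarith
    have sq: "4 * (real N)\<^sup>2 = (real u + real v)\<^sup>2" unfolding N[symmetric] by (simp add: power2_eq_square)
    have "((real v)\<^sup>2 - (real u)\<^sup>2) / (real u + real v)\<^sup>2 = (real v - real u) / (real u + real v)"
      using 4 by (simp add: power2_eq_square square_diff_square_factored add.commute[of "real v"])
    moreover have "2 * real u / (real u + real v) + (real v - real u) / (real u + real v) = 1"
      using 4 by (simp add: add_divide_distrib[symmetric])
    ultimately show ?case unfolding \<psi>_def sq by simp
  qed (use uv in \<open>auto simp: \<psi>_def\<close>)
  then show ?thesis by (simp add: \<psi>_def)
qed

text \<open>
  Unfolding the reflection at \<open>D\<close>: in the square \<open>D\<close> the function \<open>v \<mapsto> f u v\<close> extends symmetrically about \<open>D\<close>,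
  and so does \<open>v \<mapsto> H u v + H u (2 D - v)\<close>, which makes the two comparable on the triangle \<open>u < v \<le> D\<close>.
\<close>

lemma duel_reflection_le:
  assumes H: "duel N N H" and D: "D < N"
    and harm: "\<And>u v. 1 \<le> u \<Longrightarrow> u < v \<Longrightarrow> v \<le> D \<Longrightarrow>
      4 * f u v = f (u - 1) v + f (u + 1) v + f u (v - 1) + f u (refl_up D v)"
    and zero: "\<And>v. 1 \<le> v \<Longrightarrow> v \<le> D \<Longrightarrow> 0 \<le> f 0 v"
    and diag: "\<And>u. 1 \<le> u \<Longrightarrow> u \<le> D \<Longrightarrow> 1 / 2 + refl_ext N H u (2 * D - u) \<le> f u u"
    and u: "1 \<le> u" "u \<le> D"
  shows "2 * H u D \<le> f u D"
proof -
  define R where "R = {(u, v). 1 \<le> u \<and> u < v \<and> v \<le> D}"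
  define h where "h = (\<lambda>(u, v). f u v - (refl_ext N H u v + refl_ext N H u (2 * D - v)))"
  have edge: "0 \<le> h (u, u)" if "1 \<le> u" "u \<le> D" for u
    using that diag[of u] duel_diag[OF H, of u] D by (simp add: h_def refl_ext_def)
  have "0 \<le> h (u, D)"
  proof (cases "u = D")
    case True
    then show ?thesis using edge u by simp
  next
    case False
    show ?thesis
    proof (rule min_principle[where S = R and rank = fst and na = "\<lambda>(u, v). (u - 1, v)"
          and nb = "\<lambda>(u, v). (u + 1, v)" and nc = "\<lambda>(u, v). (u, v - 1)"
          and nd = "\<lambda>(u, v). (u, refl_up D v)"], goal_cases)
      case 1
      have "R \<subseteq> {..D} \<times> {..D}" by (auto simp: R_def)
      then show ?case by (rule finite_subset) auto
    next
      case (2 p)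
      obtain u v where p: "p = (u, v)" by force
      then have uv: "1 \<le> u" "u < v" "v \<le> D" using 2 by (auto simp: R_def)
      have e: "2 * D - v - 1 = 2 * D - (v + 1)" "2 * D - v + 1 = 2 * D - (v - 1)" using uv by auto
      have "4 * refl_ext N H u v = refl_ext N H (u - 1) v + refl_ext N H (u + 1) v + refl_ext N H u (v - 1) + refl_ext N H u (v + 1)"
        by (rule refl_ext_harmonic[OF H]) (use uv D in auto)
      moreover have "4 * refl_ext N H u (2 * D - v) = refl_ext N H (u - 1) (2 * D - v) + refl_ext N H (u + 1) (2 * D - v) +
          refl_ext N H u (2 * D - (v + 1)) + refl_ext N H u (2 * D - (v - 1))"
        unfolding e[symmetric] by (rule refl_ext_harmonic[OF H]) (use uv D in auto)
      moreover have "refl_ext N H u (refl_up D v) + refl_ext N H u (2 * D - refl_up D v) =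
          refl_ext N H u (v + 1) + refl_ext N H u (2 * D - (v + 1))"
      proof (cases "v = D")
        case True
        moreover have "2 * D - (D - 1) = D + 1" "2 * D - (D + 1) = D - 1" using uv by auto
        ultimately show ?thesis by (simp only: refl_up_def) simp
      qed (use uv in \<open>simp add: refl_up_def\<close>)
      ultimately have "h (u - 1, v) + h (u + 1, v) + h (u, v - 1) + h (u, refl_up D v) = 4 * h (u, v)"
        using harm[OF uv] unfolding h_def prod.case by algebra
      then show ?case by (simp add: p)
    next
      case (3 p)
      obtain u v where p: "p = (u, v)" by force
      then have "u - 1 = 0" "1 \<le> v" "v \<le> D" using 3 by (auto simp: R_def)
      then show ?case
        using zero[of v] refl_ext_zero[OF H, of v] refl_ext_zero[OF H, of "2 * D - v"] D by (simp add: p h_def)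
    next
      case (4 p)
      obtain u v where p: "p = (u, v)" by force
      then have "u + 1 = v" "1 \<le> v" "v \<le> D" using 4 by (auto simp: R_def)
      then show ?case using edge[of v] by (simp add: p)
    next
      case (5 p)
      obtain u v where p: "p = (u, v)" by force
      then have "v - 1 = u" "1 \<le> u" "u \<le> D" using 5 by (auto simp: R_def)
      then show ?case using edge[of u] by (simp add: p)
    next
      case (6 p)
      obtain u v where p: "p = (u, v)" by force
      then have "refl_up D v = u" "1 \<le> u" "u \<le> D" using 6 by (auto simp: R_def refl_up_def split: if_splits)
      then show ?case using edge[of u] by (simp add: p)
    next
      case (7 p)
      then show ?case by (auto simp: R_def)
    next
      case 8
      then show ?case using u False by (simp add: R_def)
    qed
  qed
  then show ?thesis using D by (simp add: h_def refl_ext_def)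
qed

section \<open>Bounds for two walkers on the same side of the target\<close>

lemma duel_first_le:
  assumes g: "duel D D g" and D: "1 \<le> D"
  shows "g 1 D \<le> 2 / (real D + 1) - 1 / (2 * real D)"
proof (cases "D = 1")
  case True
  then show ?thesis using duel_diag[OF g, of 1] by simp
next
  case False
  have "refl_ext D g 1 D \<le> real 1 * (1 / real (1 + D) + 1 / (real (2 * D) - real D + real 1) - 1 / real (2 * D))"
    by (rule refl_ext_le_corner[OF g order_refl]) (use D False in auto)
  then show ?thesis by (simp add: refl_ext_def add.commute)
qed

text \<open>The cubic \<open>E\<close> is harmonic, zero at \<open>u = 0\<close> and even about
  \<open>v = D\<close>. With \<open>t = u / D\<close> its diagonal value is
  \<open>A * u * (4 - 6 * t + 2 * t ^ 2)\<close>, so the last hypothesis says that \<open>E\<close>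
  covers what \<open>refl_ext_le_corner\<close> exceeds \<open>u / (2 * D)\<close> by at the mirror
  image \<open>(u, 2 * D - u)\<close> of a diagonal point.\<close>

lemma duel_first_le_cubic:
  assumes H: "duel N N H" and g: "duel D D g" and D: "1 \<le> D" "D < N"
    and S: "2 * D \<le> S" "S \<le> 2 * N" and A: "0 \<le> A"
    and le: "\<And>u. 1 \<le> u \<Longrightarrow> u < D \<Longrightarrow> 1 / (real S - 2 * real D + 2 * real u) - 1 / real S
      \<le> A * (4 - 6 * (real u / D) + 2 * (real u / D)\<^sup>2)"
  shows "2 * H 1 D \<le> g 1 D + 1 / (2 * real D) + A"
proof -
  define c where "c = 1 / (real D)\<^sup>2"
  define E where "E u v = A * (real u * (1 + (3 * (real D - real v)\<^sup>2 - (real u)\<^sup>2) * c))" for u v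
  define f where "f u v = g u v + real u / (2 * real D) + E u v" for u v
  have E: "4 * E u v = E (u - 1) v + E (u + 1) v + E u (v - 1) + E u (refl_up D v)"
    if "1 \<le> u" "u < v" "v \<le> D" for u v
  proof -
    have uv: "real (u - 1) = real u - 1" "real (v - 1) = real v - 1" using that by auto
    have "(real D - real (refl_up D v))\<^sup>2 = (real D - real v - 1)\<^sup>2"
      using that by (cases "v = D") (auto simp: refl_up_def algebra_simps)
    then have refl: "E u (refl_up D v) = A * (real u * (1 + (3 * (real D - real v - 1)\<^sup>2 - (real u)\<^sup>2) * c))"
      by (simp add: E_def)
    show ?thesis
      unfolding refl unfolding E_def uv of_nat_add of_nat_1 by algebra
  qed
  have "2 * H 1 D \<le> f 1 D"
  proof (rule duel_reflection_le[OF H D(2)], goal_cases)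
    case (1 u v)
    have "4 * g u v = g (u - 1) v + g (u + 1) v + g u (v - 1) + g u (refl_up D v)"
      using duelD(3)[OF g, of u v] 1 by (simp add: refl_up_def)
    moreover have "4 * (real u / (2 * real D)) = real (u - 1) / (2 * real D) + real (u + 1) / (2 * real D) +
        real u / (2 * real D) + real u / (2 * real D)"
      using 1 by (simp add: add_divide_distrib[symmetric] del: of_nat_Suc) (simp add: of_nat_diff)
    ultimately show ?case using E[OF 1] by (simp add: f_def)
  next
    case (2 v)
    then show ?case using duelD(1)[OF g, of v] by (simp add: f_def E_def)
  next
    case (3 u)
    show ?case
    proof (cases "u = D")
      case True
      have "refl_ext N H D D = 1 / 2" using duel_diag[OF H, of D] D by (simp add: refl_ext_def)
      then show ?thesis using True duel_diag[OF g, of D] D A by (simp add: f_def E_def c_def)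
    next
      case False
      then have u: "1 \<le> u" "u < D" using 3 by auto
      have "refl_ext N H u (2 * D - u) \<le> real u * (1 / real (u + (2 * D - u)) + 1 / (real S - real (2 * D - u) + real u) - 1 / real S)"
      proof (cases "2 * D = S")
        case True
        have "refl_ext N H u (2 * D - u) \<le> 1 / 2" by (rule refl_ext_le_half[OF H]) (use u D in auto)
        then show ?thesis using True u by (simp add: of_nat_diff)
      next
        case False
        then show ?thesis by (intro refl_ext_le_corner[OF H]) (use u D S in auto)
      qed
      also have "\<dots> = real u / (2 * real D) + real u * (1 / (real S - 2 * real D + 2 * real u) - 1 / real S)"
        using u by (simp add: of_nat_diff algebra_simps)
      also have "real u * (1 / (real S - 2 * real D + 2 * real u) - 1 / real S)
          \<le> real u * (A * (4 - 6 * (real u / D) + 2 * (real u / D)\<^sup>2))"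
        by (intro mult_left_mono le u) simp
      also have "\<dots> = E u u" using D by (simp add: E_def c_def field_simps power2_eq_square)
      finally show ?thesis using duel_diag[OF g, of u] u by (simp add: f_def)
    qed
  qed (use D in auto)
  moreover have "E 1 D \<le> A" using A D by (simp add: E_def c_def mult_left_le)
  ultimately show ?thesis by (simp add: f_def)
qed

text \<open>Here \<open>S = 4 * D\<close> and \<open>A = 1 / (16 * D)\<close>, whence
  \<open>1 / 2 + 1 / 16 = 9 / 16\<close>. The cubic covers the excess because
  \<open>2 \<le> (2 - t) * (1 + t)\<close> on the unit interval.\<close>

lemma duel_first_le_half:
  assumes H: "duel N N H" and g: "duel D D g" and D: "1 \<le> D" "2 * D \<le> N"
  shows "2 * H 1 D \<le> g 1 D + 9 / (16 * real D)"
proof -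
  have "2 * H 1 D \<le> g 1 D + 1 / (2 * real D) + 1 / (16 * real D)"
  proof (rule duel_first_le_cubic[OF H g, where S = "4 * D"], goal_cases)
    case (6 u)
    define t where "t = real u / real D"
    have t: "0 < t" "t < 1" "real u = t * real D" using 6 by (auto simp: t_def)
    have "1 / (real (4 * D) - 2 * real D + 2 * real u) - 1 / real (4 * D) = (1 / (4 * real D)) * ((1 - t) / (1 + t))"
    proof -
      have "real (4 * D) - 2 * real D + 2 * real u = 2 * real D * (1 + t)" unfolding t(3) by (simp add: algebra_simps)
      moreover have "1 / (2 * d * (1 + t)) - 1 / (4 * d) = (1 / (4 * d)) * ((1 - t) / (1 + t))" if "0 < d" for d :: real
        using that t(1) by (simp add: divide_simps) (simp add: algebra_simps)
      ultimately show ?thesis using D by (simp only: of_nat_mult of_nat_numeral)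
    qed
    also have "\<dots> \<le> (1 / (4 * real D)) * ((1 - t) * (2 - t) / 2)"
    proof (intro mult_left_mono)
      have "2 * (1 - t) \<le> (1 - t) * ((2 - t) * (1 + t))"
        using t mult_left_mono[of 2 "(2 - t) * (1 + t)" "1 - t"] mult_nonneg_nonneg[of t "1 - t"]
        by (simp add: algebra_simps)
      then show "(1 - t) / (1 + t) \<le> (1 - t) * (2 - t) / 2"
        using t by (simp add: divide_simps)
    qed simp
    also have "\<dots> = 1 / (16 * real D) * (4 - 6 * t + 2 * t\<^sup>2)"
      using D by (simp add: power2_eq_square field_simps)
    finally show ?case by (simp add: t_def)
  qed (use D in auto)
  then show ?thesis using D by (simp add: field_simps)
qed

text \<open>Now \<open>S = 2 * N\<close> is the largest admissible choice, and
  \<open>N - D \<le> D\<close> gives the required inequality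
  \<open>2 * M \<le> (2 - t) * (M + t * D)\<close>.\<close>

lemma duel_first_le_large:
  assumes H: "duel N N H" and g: "duel D D g" and D: "1 \<le> D" "D < N" "N \<le> 2 * D"
  shows "2 * H 1 D \<le> g 1 D + 1 / (2 * real D) + real D / (8 * real N * (real N - real D))"
proof (rule duel_first_le_cubic[OF H g D(1,2), where S = "2 * N"], goal_cases)
  case (4 u)
  define t where "t = real u / real D"
  have t: "0 < t" "t < 1" "real u = t * real D" using 4 by (auto simp: t_def)
  define M where "M = real N - real D"
  have M: "0 < M" "real N = M + real D" "M \<le> real D" using D by (auto simp: M_def)
  have pos: "0 < real D" "0 < t * real D" using D t by auto
  have "1 / (real (2 * N) - 2 * real D + 2 * real u) - 1 / real (2 * N) =
      (real D / (2 * real N)) * ((1 - t) / (M + t * real D))"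
    using M pos unfolding t(3) by (simp add: divide_simps) (simp add: algebra_simps)
  also have "\<dots> \<le> (real D / (2 * real N)) * ((1 - t) * (2 - t) / (2 * M))"
  proof (intro mult_left_mono)
    have "t * M \<le> t * real D" "t * (t * real D) \<le> t * real D" using t M by (auto intro!: mult_left_mono mult_left_le_one_le)
    then have "2 * M \<le> (2 - t) * (M + t * real D)" by (simp add: algebra_simps)
    then have "(1 - t) * (2 * M) \<le> (1 - t) * ((2 - t) * (M + t * real D))" using t by (intro mult_left_mono) auto
    then show "(1 - t) / (M + t * real D) \<le> (1 - t) * (2 - t) / (2 * M)"
      using M pos by (simp add: divide_simps mult_ac)
  qed simp
  also have "\<dots> = real D / (8 * real N * (real N - real D)) * (4 - 6 * t + 2 * t\<^sup>2)"
  proof -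
    have "4 - 6 * t + 2 * t\<^sup>2 = 2 * ((1 - t) * (2 - t))" by (simp add: power2_eq_square algebra_simps)
    then show ?thesis unfolding M_def[symmetric] by simp
  qed
  finally show ?case by (simp add: t_def)
qed (use D in auto)

text \<open>Serves \<open>D\<close> close to \<open>N\<close>, where the error term with
  \<open>N - D\<close> in the denominator is too large. On the reflected diagonal the bound of
  \<open>refl_ext_le_corner_square\<close> is affine in \<open>u\<close>, so a combination of
  \<open>g\<close> and the linear function \<open>u / (2 * D)\<close> suffices for the
  comparison.\<close>

lemma duel_first_le_square:
  assumes H: "duel N N H" and g: "duel D D g" and D: "1 \<le> D" "D < N"
  shows "2 * H 1 D \<le> g 1 D + 1 / (2 * real D) + (real D / real N)\<^sup>2 * (g 1 D - 1 / (2 * real D))"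
proof -
  define c where "c = (real D / real N)\<^sup>2"
  define f where "f u v = (1 + c) * g u v + (1 - c) * (real u / (2 * real D))" for u v
  have "2 * H 1 D \<le> f 1 D"
  proof (rule duel_reflection_le[OF H D(2)], goal_cases)
    case (1 u v)
    have "4 * g u v = g (u - 1) v + g (u + 1) v + g u (v - 1) + g u (refl_up D v)"
      using duelD(3)[OF g, of u v] 1 by (simp add: refl_up_def)
    then have "(1 + c) * (4 * g u v) = (1 + c) * (g (u - 1) v + g (u + 1) v + g u (v - 1) + g u (refl_up D v))"
      by simp
    moreover have "(1 - c) * (4 * (real u / (2 * real D))) = (1 - c) * (real (u - 1) / (2 * real D) + real (u + 1) / (2 * real D) +
        real u / (2 * real D) + real u / (2 * real D))"
      using 1 by (simp add: add_divide_distrib[symmetric] del: of_nat_Suc) (simp add: of_nat_diff)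
    ultimately show ?case by (simp only: f_def distrib_left)
  next
    case (2 v)
    then show ?case using duelD(1)[OF g, of v] by (simp add: f_def)
  next
    case (3 u)
    have "refl_ext N H u (2 * D - u) \<le> real u / (2 * real D) + c * (1 / 2 - real u / (2 * real D))"
    proof (cases "u = D")
      case True
      then show ?thesis using duel_diag[OF H, of D] D by (simp add: refl_ext_def)
    next
      case False
      have "refl_ext N H u (2 * D - u) \<le> real u / real (u + (2 * D - u)) +
          ((real (2 * D - u))\<^sup>2 - (real u)\<^sup>2) / (8 * (real N)\<^sup>2)"
        by (rule refl_ext_le_corner_square[OF H]) (use 3 False D in auto)
      moreover have "((real (2 * D - u))\<^sup>2 - (real u)\<^sup>2) / (8 * (real N)\<^sup>2) = c * (1 / 2 - real u / (2 * real D))"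
        using 3 D by (simp add: of_nat_diff c_def power2_eq_square field_simps)
      moreover have "real (u + (2 * D - u)) = 2 * real D" using 3 by simp
      ultimately show ?thesis by simp
    qed
    moreover have "(1 + c) * (1 / 2) + (1 - c) * t = 1 / 2 + (t + c * (1 / 2 - t))" for t :: real
      by (simp add: algebra_simps)
    ultimately have "1 / 2 + refl_ext N H u (2 * D - u) \<le> (1 + c) * (1 / 2) + (1 - c) * (real u / (2 * real D))"
      by (simp only:)
    then show ?case unfolding f_def duel_diag[OF g 3] .
  qed (use D in auto)
  then show ?thesis by (simp add: f_def c_def algebra_simps)
qed

section \<open>The spectral expansion\<close>

text \<open>
  The first component is the Chebyshev polynomial \<open>T\<^sub>k (1 + e)\<close> and the second its forward difference; in this
  form the monotonicity in \<open>e \<ge> 0\<close> is evident.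
\<close>

primrec cheb :: "real \<Rightarrow> nat \<Rightarrow> real \<times> real" where
  "cheb e 0 = (1, e)"
| "cheb e (Suc k) = (fst (cheb e k) + snd (cheb e k),
     snd (cheb e k) + 2 * e * (fst (cheb e k) + snd (cheb e k)))"

lemma cheb_ge:
  assumes "0 \<le> e"
  shows "1 \<le> fst (cheb e k) \<and> 0 \<le> snd (cheb e k)"
  using assms by (induction k) auto

lemma cheb_mono:
  assumes "0 \<le> e" "e \<le> e'"
  shows "fst (cheb e k) \<le> fst (cheb e' k) \<and> snd (cheb e k) \<le> snd (cheb e' k)"
proof (induction k)
  case (Suc k)
  have "2 * e * (fst (cheb e k) + snd (cheb e k)) \<le> 2 * e' * (fst (cheb e' k) + snd (cheb e' k))"
    using Suc assms cheb_ge[OF assms(1), of k] by (intro mult_mono add_mono) auto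
  then show ?case using Suc by auto
qed (use assms in simp)

lemma cheb_step: "fst (cheb e (Suc (Suc k))) + fst (cheb e k) = 2 * (1 + e) * fst (cheb e (Suc k))"
  by (simp add: algebra_simps)

lemma cheb_cosh: "cheb (cosh x - 1) k = (cosh (real k * x), cosh (real (Suc k) * x) - cosh (real k * x))"
proof (induction k)
  case (Suc k)
  have "cosh (real (Suc (Suc k)) * x) = cosh (real (Suc k) * x + x)" "cosh (real k * x) = cosh (real (Suc k) * x - x)"
    by (simp_all add: algebra_simps)
  then have "cosh (real (Suc (Suc k)) * x) + cosh (real k * x) = 2 * cosh x * cosh (real (Suc k) * x)"
    by (simp add: cosh_add cosh_diff)
  then show ?case unfolding cheb.simps Suc fst_conv snd_conv by (simp add: left_diff_distrib right_diff_distrib)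
qed simp

text \<open>The frequencies \<open>p\<close> with \<open>cos (W * p) = 0\<close>, for which
  \<open>sin (u * p)\<close> is even about \<open>u = W\<close> and hence compatible with the
  reflection there.\<close>

definition mode_freq :: "nat \<Rightarrow> nat \<Rightarrow> real" where
  "mode_freq W j = (2 * real j + 1) * (pi / (2 * real W))"

lemma mode_freq_bounds:
  assumes "j < W"
  shows "0 < mode_freq W j" "mode_freq W j < pi"
proof -
  have "mode_freq W j = pi * ((2 * real j + 1) / (2 * real W))" by (simp add: mode_freq_def)
  moreover have "(2 * real j + 1) / (2 * real W) < 1" using assms by simp
  ultimately show "mode_freq W j < pi" by (metis mult.right_neutral mult_strict_left_mono pi_gt_zero)
  show "0 < mode_freq W j" using assms by (simp add: mode_freq_def)
qed

text \<open>Multiplication by \<open>2 * sin \<alpha>\<close> makes the sum telescope to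
  \<open>sin (i * pi) = 0\<close>.\<close>

lemma sum_cos_mode_freq:
  assumes "0 < i" "i < 2 * W"
  shows "(\<Sum>j<W. cos (real i * mode_freq W j)) = 0"
proof -
  define \<alpha> where "\<alpha> = real i * (pi / (2 * real W))"
  have "\<alpha> = pi * (real i / (2 * real W))" by (simp add: \<alpha>_def)
  moreover have "real i / (2 * real W) < 1" using assms by simp
  ultimately have "\<alpha> < pi" by (metis mult.right_neutral mult_strict_left_mono pi_gt_zero)
  then have "0 < sin \<alpha>" using assms by (intro sin_gt_zero) (auto simp: \<alpha>_def)
  have "2 * sin \<alpha> * cos (real i * mode_freq W j) = sin (2 * real (Suc j) * \<alpha>) - sin (2 * real j * \<alpha>)" for j
  proof -
    have "real i * mode_freq W j = (2 * real j + 1) * \<alpha>" by (simp add: mode_freq_def \<alpha>_def)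
    moreover have "2 * real (Suc j) * \<alpha> = (2 * real j + 1) * \<alpha> + \<alpha>" "2 * real j * \<alpha> = (2 * real j + 1) * \<alpha> - \<alpha>"
      by (simp_all add: algebra_simps)
    ultimately show ?thesis by (simp add: sin_add sin_diff)
  qed
  then have "2 * sin \<alpha> * (\<Sum>j<W. cos (real i * mode_freq W j)) = (\<Sum>j<W. sin (2 * real (Suc j) * \<alpha>) - sin (2 * real j * \<alpha>))"
    by (simp only: sum_distrib_left)
  also have "\<dots> = sin (2 * real W * \<alpha>) - sin (2 * real 0 * \<alpha>)" by (rule sum_lessThan_telescope)
  also have "2 * real W * \<alpha> = real i * pi" using assms by (simp add: \<alpha>_def)
  finally show ?thesis using \<open>0 < sin \<alpha>\<close> by (simp add: mult.commute[of _ pi])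
qed

text \<open>The sine expansion of the constant 1 on \<open>{1..W}\<close>, which supplies the
  boundary value at \<open>v = 0\<close>. The increments in \<open>u\<close> are sums of cosines
  that vanish by \<open>sum_cos_mode_freq\<close>.\<close>

lemma sum_mode_weights:
  assumes "1 \<le> u" "u \<le> W"
  shows "(\<Sum>j<W. cot (mode_freq W j / 2) * sin (real u * mode_freq W j)) = real W"
  using assms
proof (induction u rule: dec_induct)
  case base
  have "cot (mode_freq W j / 2) * sin (real 1 * mode_freq W j) = 1 + cos (real 1 * mode_freq W j)" if "j < W" for j
  proof -
    have "0 < sin (mode_freq W j / 2)" using mode_freq_bounds[OF that] by (intro sin_gt_zero) auto
    moreover have "mode_freq W j = 2 * (mode_freq W j / 2)" by simp
    then have "sin (mode_freq W j) = 2 * sin (mode_freq W j / 2) * cos (mode_freq W j / 2)"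
      "cos (mode_freq W j) = 2 * (cos (mode_freq W j / 2))\<^sup>2 - 1"
      by (metis sin_double, metis cos_double_cos)
    ultimately show ?thesis by (simp add: cot_def power2_eq_square)
  qed
  then have "(\<Sum>j<W. cot (mode_freq W j / 2) * sin (real 1 * mode_freq W j)) = (\<Sum>j<W. 1 + cos (real 1 * mode_freq W j))"
    by (intro sum.cong) auto
  also have "\<dots> = real W" using sum_cos_mode_freq[of 1 W] assms by (simp add: sum.distrib)
  finally show ?case .
next
  case (step u)
  have "cot (mode_freq W j / 2) * sin (real (Suc u) * mode_freq W j) =
      cot (mode_freq W j / 2) * sin (real u * mode_freq W j) +
      (cos (real (Suc u) * mode_freq W j) + cos (real u * mode_freq W j))" if "j < W" for j
  proof -
    define b where "b = mode_freq W j / 2"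
    have "0 < sin b" using mode_freq_bounds[OF that] unfolding b_def by (intro sin_gt_zero) auto
    have e: "real (Suc u) * mode_freq W j = (2 * real u + 1) * b + b" "real u * mode_freq W j = (2 * real u + 1) * b - b"
      by (simp_all add: b_def algebra_simps)
    have "cot b * sin (a + b) = cot b * sin (a - b) + (cos (a + b) + cos (a - b))" for a
      using \<open>0 < sin b\<close> by (simp add: sin_add sin_diff cos_add cos_diff cot_def field_simps)
    then show ?thesis unfolding e b_def[symmetric] .
  qed
  then have "(\<Sum>j<W. cot (mode_freq W j / 2) * sin (real (Suc u) * mode_freq W j)) =
      (\<Sum>j<W. cot (mode_freq W j / 2) * sin (real u * mode_freq W j) +
      (cos (real (Suc u) * mode_freq W j) + cos (real u * mode_freq W j)))"
    by (intro sum.cong) auto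
  then show ?case
    using step sum_cos_mode_freq[of u W] sum_cos_mode_freq[of "Suc u" W] by (simp add: sum.distrib)
qed

text \<open>Separation of variables: \<open>sin (u * p)\<close> contributes \<open>2 * cos p\<close>
  to the four-term sum, so the factor in \<open>v\<close> must contribute
  \<open>2 * (2 - cos p)\<close>. This is the Chebyshev recursion at \<open>1 + e\<close> with
  \<open>e = 1 - cos p\<close>; counting from \<open>K\<close> makes it even about
  \<open>v = K\<close>.\<close>

definition duel_modes :: "nat \<Rightarrow> nat \<Rightarrow> nat \<Rightarrow> nat \<Rightarrow> real" where
  "duel_modes W K u v = (\<Sum>j<W. cot (mode_freq W j / 2) * sin (real u * mode_freq W j) *
     (fst (cheb (1 - cos (mode_freq W j)) (K - v)) / fst (cheb (1 - cos (mode_freq W j)) K))) / real W"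

lemma duel_duel_modes:
  assumes W: "1 \<le> W"
  shows "duel W K (duel_modes W K)"
  unfolding duel_def
proof (intro conjI ballI, goal_cases)
  case (1 v)
  then show ?case by (simp add: duel_modes_def)
next
  case (2 u)
  have "fst (cheb (1 - cos (mode_freq W j)) K) \<noteq> 0" for j
    using cheb_ge[of "1 - cos (mode_freq W j)" K] by simp
  then show ?case using 2 sum_mode_weights[of u W] W by (simp add: duel_modes_def)
next
  case (3 u v)
  define F where "F j u v = cot (mode_freq W j / 2) * sin (real u * mode_freq W j) *
     (fst (cheb (1 - cos (mode_freq W j)) (K - v)) / fst (cheb (1 - cos (mode_freq W j)) K))" for j u v
  have "4 * F j u v = F j (u - 1) v + F j (refl_up W u) v + F j u (v - 1) + F j u (refl_up K v)" if j: "j < W" for j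
  proof -
    define p where "p = mode_freq W j"
    define s where "s u = sin (real u * p)" for u
    define C where "C v = fst (cheb (1 - cos p) (K - v))" for v
    have s: "s (u - 1) + s (refl_up W u) = 2 * cos p * s u"
    proof -
      have "real (u - 1) * p = real u * p - p" "real (u + 1) * p = real u * p + p"
        using 3 by (simp_all add: of_nat_diff algebra_simps)
      then have e: "s (u - 1) + s (u + 1) = 2 * cos p * s u" by (simp add: s_def sin_add sin_diff)
      have "s (W + 1) = s (W - 1)"
      proof -
        have "real W * p = real j * pi + pi / 2" using W by (simp add: p_def mode_freq_def field_simps)
        then have "cos (real W * p) = 0" by (simp add: cos_add)
        moreover have "real (W - 1) * p = real W * p - p" "real (W + 1) * p = real W * p + p"
          using W by (simp_all add: of_nat_diff algebra_simps)
        ultimately show ?thesis by (simp add: s_def sin_add sin_diff)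
      qed
      then show ?thesis using e 3 by (cases "u = W") (auto simp: refl_up_def)
    qed
    have C: "C (v - 1) + C (refl_up K v) = 2 * (2 - cos p) * C v"
    proof (cases "v = K")
      case True
      then show ?thesis using 3 by (simp add: C_def refl_up_def algebra_simps)
    next
      case False
      then obtain k where k: "K - v = Suc k" using 3 by (metis Suc_diff_Suc atLeastAtMost_iff le_neq_implies_less)
      then have "K - (v - 1) = Suc (Suc k)" "K - (v + 1) = k" using 3 by auto
      then show ?thesis using k cheb_step[of "1 - cos p" k] 3 False by (simp add: C_def refl_up_def algebra_simps)
    qed
    define c where "c = cot (p / 2) / fst (cheb (1 - cos p) K)"
    have F: "F j u v = c * (s u * C v)" for u v by (simp add: F_def c_def s_def C_def p_def)
    have "c * (s (u - 1) * C v) + c * (s (refl_up W u) * C v) + c * (s u * C (v - 1)) + c * (s u * C (refl_up K v)) =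
      c * ((s (u - 1) + s (refl_up W u)) * C v + s u * (C (v - 1) + C (refl_up K v)))" by (simp add: algebra_simps)
    also have "\<dots> = 4 * (c * (s u * C v))" unfolding s C by (simp add: algebra_simps)
    finally show ?thesis unfolding F by simp
  qed
  then have "(\<Sum>j<W. 4 * F j u v) = (\<Sum>j<W. F j (u - 1) v + F j (refl_up W u) v + F j u (v - 1) + F j u (refl_up K v))"
    by (intro sum.cong) auto
  then have "4 * (\<Sum>j<W. F j u v) = (\<Sum>j<W. F j (u - 1) v) + (\<Sum>j<W. F j (refl_up W u) v) +
      (\<Sum>j<W. F j u (v - 1)) + (\<Sum>j<W. F j u (refl_up K v))"
    by (simp only: sum.distrib sum_distrib_left)
  moreover have "duel_modes W K u v = (\<Sum>j<W. F j u v) / real W" for u v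
    by (simp add: duel_modes_def F_def)
  ultimately show ?case by (simp add: add_divide_distrib[symmetric])
qed

text \<open>At \<open>(1, K)\<close> the weight is \<open>cot (p / 2) * sin p = 1 + cos p\<close>,
  so all modes are nonnegative and any number of them may be dropped. The parameters
  \<open>\<epsilon>\<close> and \<open>T\<close> leave room for rounding.\<close>

lemma duel_first_ge_modes:
  assumes f: "duel W K f" and W: "1 \<le> W" "1 \<le> K" and m: "m \<le> W"
    and e: "\<And>j. j < m \<Longrightarrow> 1 - cos (mode_freq W j) \<le> \<epsilon> j" "\<And>j. j < m \<Longrightarrow> \<epsilon> j \<le> 2"
    and T: "\<And>j. j < m \<Longrightarrow> fst (cheb (1 - cos (mode_freq W j)) K) \<le> T j"
  shows "(\<Sum>j<m. (2 - \<epsilon> j) / T j) / real W \<le> f 1 K"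
proof -
  have ge: "1 \<le> fst (cheb (1 - cos (mode_freq W j)) k)" for j k using cheb_ge[of "1 - cos (mode_freq W j)" k] by simp
  have "(\<Sum>j<m. (2 - \<epsilon> j) / T j) \<le> (\<Sum>j<m. (1 + cos (mode_freq W j)) / fst (cheb (1 - cos (mode_freq W j)) K))"
  proof (rule sum_mono)
    fix j assume "j \<in> {..<m}"
    then have "2 - \<epsilon> j \<le> 1 + cos (mode_freq W j)" "0 \<le> 2 - \<epsilon> j" "fst (cheb (1 - cos (mode_freq W j)) K) \<le> T j"
      using e T by force+
    then show "(2 - \<epsilon> j) / T j \<le> (1 + cos (mode_freq W j)) / fst (cheb (1 - cos (mode_freq W j)) K)"
      using ge[of j K] by (intro frac_le) auto
  qed
  also have "\<dots> \<le> (\<Sum>j<W. (1 + cos (mode_freq W j)) / fst (cheb (1 - cos (mode_freq W j)) K))"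
  proof (rule sum_mono2)
    fix j
    have "0 \<le> 1 + cos (mode_freq W j)" using cos_ge_minus_one[of "mode_freq W j"] by linarith
    then show "0 \<le> (1 + cos (mode_freq W j)) / fst (cheb (1 - cos (mode_freq W j)) K)"
      using ge[of j K] by (intro divide_nonneg_nonneg) auto
  qed (use m in auto)
  also have "\<dots> = (\<Sum>j<W. cot (mode_freq W j / 2) * sin (real 1 * mode_freq W j) *
     (fst (cheb (1 - cos (mode_freq W j)) (K - K)) / fst (cheb (1 - cos (mode_freq W j)) K)))"
  proof (rule sum.cong)
    fix j assume "j \<in> {..<W}"
    then have "0 < sin (mode_freq W j / 2)" using mode_freq_bounds[of j W] by (intro sin_gt_zero) auto
    moreover have "mode_freq W j = 2 * (mode_freq W j / 2)" by simp
    then have "sin (mode_freq W j) = 2 * sin (mode_freq W j / 2) * cos (mode_freq W j / 2)"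
      "cos (mode_freq W j) = 2 * (cos (mode_freq W j / 2))\<^sup>2 - 1"
      by (metis sin_double, metis cos_double_cos)
    ultimately have "cot (mode_freq W j / 2) * sin (mode_freq W j) = 1 + cos (mode_freq W j)"
      by (simp add: cot_def power2_eq_square)
    then show "(1 + cos (mode_freq W j)) / fst (cheb (1 - cos (mode_freq W j)) K) =
      cot (mode_freq W j / 2) * sin (real 1 * mode_freq W j) *
      (fst (cheb (1 - cos (mode_freq W j)) (K - K)) / fst (cheb (1 - cos (mode_freq W j)) K))" by simp
  qed simp
  finally have "(\<Sum>j<m. (2 - \<epsilon> j) / T j) / real W \<le> duel_modes W K 1 K"
    unfolding duel_modes_def by (rule divide_right_mono) simp
  also have "\<dots> \<le> f 1 K" by (rule duel_le[OF duel_duel_modes[OF W(1)] f]) (use W in auto)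
  finally show ?thesis .
qed

section \<open>Elementary bounds for the cosine and for pi\<close>

lemma one_minus_cos_le: "1 - cos x \<le> x\<^sup>2 / 2" for x :: real
proof -
  have "cos x = 1 - 2 * (sin (x / 2))\<^sup>2" using cos_double_sin[of "x / 2"] by simp
  moreover have "(sin (x / 2))\<^sup>2 \<le> (x / 2)\<^sup>2" using abs_sin_x_le_abs_x[of "x / 2"] by (simp only: abs_le_square_iff)
  ultimately show ?thesis by (simp add: power2_eq_square)
qed

text \<open>Half of \<open>x ^ 2\<close> separates the two sides. Together with
  \<open>cheb_mono\<close> this bounds the Chebyshev denominators by
  \<open>cosh (k * p)\<close>.\<close>

lemma cos_cosh_ge: "1 - cos x \<le> cosh x - 1" for x :: real
proof -
  have "0 \<le> cosh x - 1 - x\<^sup>2 / 2"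
  proof -
    have c: "cosh x - 1 = 2 * (sinh (x / 2))\<^sup>2" for x :: real
      using cosh_add[of "x / 2" "x / 2"] cosh_square_eq[of "x / 2"] by (simp add: power2_eq_square)
    have "\<bar>x / 2\<bar> \<le> \<bar>sinh (x / 2)\<bar>" for x :: real
    proof -
      have "y \<le> sinh y" if "0 \<le> y" for y :: real
      proof -
        have "(\<lambda>y. sinh y - y) 0 \<le> (\<lambda>y. sinh y - y) y"
          by (rule DERIV_nonneg_imp_nondecreasing[OF that])
            (auto intro!: exI derivative_eq_intros simp: cosh_real_ge_1)
        then show ?thesis by simp
      qed
      from this[of "x / 2"] this[of "- x / 2"] show ?thesis by (cases "0 \<le> x") auto
    qed
    then have "(x / 2)\<^sup>2 \<le> (sinh (x / 2))\<^sup>2" by (simp only: abs_le_square_iff)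
    then show ?thesis unfolding c by (simp add: power2_eq_square)
  qed
  then show ?thesis using one_minus_cos_le[of x] by linarith
qed

text \<open>The number 0.5236 is a sixth of 3.1416, and the Taylor polynomial of degree 7 shows that
  its sine exceeds \<open>1 / 2 = sin (pi / 6)\<close>.\<close>

lemma pi_less: "pi < 31416 / 10000"
proof (rule ccontr)
  assume "\<not> ?thesis"
  then have "sin (5236 / 10000) \<le> sin (pi / 6)" by (intro sin_monotone_2pi_le) auto
  then have "sin (5236 / 10000 :: real) \<le> 1 / 2" by (simp add: sin_30)
  moreover have "{..<8} = {0, 1, 2, 3, 4, 5, 6, 7 :: nat}" by auto
  then have taylor: "(\<Sum>m<8. sin_coeff m * y ^ m) = y - y ^ 3 / 6 + y ^ 5 / 120 - y ^ 7 / 5040" for y :: real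
    by (simp add: sin_coeff_def fact_numeral)
  have "\<bar>sin (5236 / 10000 :: real) - (\<Sum>m<8. sin_coeff m * (5236 / 10000) ^ m)\<bar>
      \<le> inverse (fact 8) * \<bar>5236 / 10000\<bar> ^ 8" by (rule Maclaurin_sin_bound)
  from this[unfolded taylor] have "1 / 2 < sin (5236 / 10000 :: real)"
    by (simp add: fact_numeral power_divide abs_if split: if_splits)
  ultimately show False by simp
qed

section \<open>Numerical verification\<close>

lemma duel_square_values:
  "duel 2 2 f \<Longrightarrow> f 1 2 = 3 / 8" "duel 3 3 g \<Longrightarrow> g 1 3 = 7 / 26"
proof -
  show "f 1 2 = 3 / 8" if f: "duel 2 2 f"
    using duelD(3)[OF f, of 1 2] duelD(1)[OF f, of 2] duel_diag[OF f, of 1] duel_diag[OF f, of 2]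
    by (simp add: refl_up_def numeral_2_eq_2)
  show "g 1 3 = 7 / 26" if g: "duel 3 3 g"
    using duelD(3)[OF g, of 1 3] duelD(3)[OF g, of 1 2] duelD(3)[OF g, of 2 3] duelD(1)[OF g, of 2] duelD(1)[OF g, of 3]
      duel_diag[OF g, of 1] duel_diag[OF g, of 2] duel_diag[OF g, of 3]
    by (simp add: refl_up_def eval_nat_numeral)
qed

text \<open>With the target at \<open>x = N - D\<close>, \<open>f\<close> has the walkers on
  opposite sides of it and \<open>g\<close> both between it and the end \<open>N\<close>;
  \<open>H\<close> belongs to the target \<open>N\<close> itself.\<close>

lemma end_source_duel:
  assumes q: "path_game N q" and D: "1 \<le> D" "D < N"
  obtains f g H where "duel (N - D) D f" "duel D D g" "duel N N H"
    "end_source N q (N - D) = f 1 D + (if D = 1 then 0 else g 1 D - 2 * H 1 D)"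
proof
  define x where "x = N - D"
  have x: "x \<le> N" "N - x = D" "x + D = N" "N - D = x" "N - (N - x) = x" using D by (auto simp: x_def)
  show "duel (N - D) D (\<lambda>u v. q x (x + v) (x - u))" using path_game_duel(3)[OF q x(1)] x by simp
  show "duel D D (\<lambda>u v. q x (x + v) (x + u))" using path_game_duel(1)[OF q x(1)] x by simp
  show "duel N N (\<lambda>u v. q N (N - v) (N - u))" using path_game_duel(2)[OF q order_refl] by simp
  have "x + 1 < N \<longleftrightarrow> D \<noteq> 1" using x D by auto
  then show "end_source N q (N - D) = q x (x + D) (x - 1) + (if D = 1 then 0 else q x (x + D) (x + 1) - 2 * q N (N - D) (N - 1))"
    by (simp add: end_source_def x)
qed

text \<open>The bounds for \<open>2 * H 1 D\<close> contain \<open>g 1 D\<close>, which cancels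
  against the same term of the source. Only in the last bound a multiple \<open>(D / N) ^ 2\<close>
  of it survives, and this is estimated by \<open>duel_first_le\<close>.\<close>

lemma end_source_lower:
  assumes q: "path_game N q" and D: "1 \<le> D" "D < N"
    and a: "\<forall>f. duel (N - D) D f \<longrightarrow> a \<le> f 1 D"
  shows "D = 1 \<Longrightarrow> a \<le> end_source N q (N - D)"
    and "D = 2 \<Longrightarrow> 6 \<le> N \<Longrightarrow> a - 2392 / 10000 \<le> end_source N q (N - D)"
    and "2 * D \<le> N \<Longrightarrow> a - 9 / (16 * real D) \<le> end_source N q (N - D)"
    and "N \<le> 2 * D \<Longrightarrow> a - 1 / (2 * real D) - real D / (8 * real N * (real N - real D)) \<le> end_source N q (N - D)"
    and "a - (1 - (real D / real N)\<^sup>2) / (2 * real D) - (real D / real N)\<^sup>2 * (2 / (real D + 1) - 1 / (2 * real D))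
      \<le> end_source N q (N - D)"
proof -
  obtain f g H where fgH: "duel (N - D) D f" "duel D D g" "duel N N H"
    and S: "end_source N q (N - D) = f 1 D + (if D = 1 then 0 else g 1 D - 2 * H 1 D)"
    using end_source_duel[OF q D] .
  note a = a[rule_format, OF fgH(1)]
  show "D = 1 \<Longrightarrow> a \<le> end_source N q (N - D)" using a S by simp
  have lower: "a - c \<le> end_source N q (N - D)" if "0 \<le> c" "2 * H 1 D \<le> g 1 D + c" for c
    using that a S by (cases "D = 1") auto
  \<comment> \<open>The general bound is applied one vertex further, at distance 3 (hence
    \<open>6 \<le> N\<close>), and one harmonic equation brings it back to distance 2. The resulting
    loss 0.23918 is rounded up.\<close>
  show "a - 2392 / 10000 \<le> end_source N q (N - D)" if "D = 2" "6 \<le> N"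
  proof -
    have g3: "duel 3 3 (duel_modes 3 3)" by (rule duel_duel_modes) simp
    have "2 * H 1 3 \<le> duel_modes 3 3 1 3 + 9 / (16 * real 3)"
      by (rule duel_first_le_half[OF fgH(3) g3]) (use that in auto)
    moreover have "4 * H 1 2 = H 0 2 + H 2 2 + H 1 1 + H 1 3"
      using duelD(3)[OF fgH(3), of 1 2] that by (simp add: refl_up_def eval_nat_numeral)
    moreover have "H 0 2 = 0" "H 2 2 = 1 / 2" "H 1 1 = 1 / 2"
      using duelD(1)[OF fgH(3), of 2] duel_diag[OF fgH(3)] that by auto
    moreover have "g 1 2 = 3 / 8" using duel_square_values(1)[of g] fgH(2) that by simp
    ultimately show ?thesis using lower[of "2392 / 10000"] duel_square_values(2)[OF g3] that by simp
  qed
  show "a - 9 / (16 * real D) \<le> end_source N q (N - D)" if "2 * D \<le> N"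
    using duel_first_le_half[OF fgH(3,2) D(1) that] by (intro lower) auto
  show "a - 1 / (2 * real D) - real D / (8 * real N * (real N - real D)) \<le> end_source N q (N - D)" if "N \<le> 2 * D"
    using duel_first_le_large[OF fgH(3,2) D that] D lower[of "1 / (2 * real D) + real D / (8 * real N * (real N - real D))"]
    by (simp add: diff_diff_eq)
  define l where "l = (real D / real N)\<^sup>2"
  have l: "0 \<le> l" "l \<le> 1" using D by (auto simp: l_def power_le_one)
  have "l * g 1 D \<le> l * (2 / (real D + 1) - 1 / (2 * real D))"
    using duel_first_le[OF fgH(2) D(1)] l by (intro mult_left_mono) auto
  moreover have "0 \<le> (1 - l) / (2 * real D) + l * (2 / (real D + 1) - 1 / (2 * real D))"
    using l D by (intro add_nonneg_nonneg mult_nonneg_nonneg) (auto simp: field_simps)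
  moreover have "2 * H 1 D \<le> g 1 D + 1 / (2 * real D) + l * (g 1 D - 1 / (2 * real D))"
    using duel_first_le_square[OF fgH(3,2) D] by (simp add: l_def)
  ultimately have "a - ((1 - l) / (2 * real D) + l * (2 / (real D + 1) - 1 / (2 * real D))) \<le> end_source N q (N - D)"
    by (intro lower) (auto simp: right_diff_distrib diff_divide_distrib)
  then show "a - (1 - l) / (2 * real D) - l * (2 / (real D + 1) - 1 / (2 * real D)) \<le> end_source N q (N - D)"
    by (simp only: diff_diff_eq)
qed

section \<open>Integer arithmetic for short paths\<close>

definition charge_poly :: "'a :: comm_ring_1 \<Rightarrow> 'a \<Rightarrow> 'a" where
  "charge_poly N D = N ^ 3 - 6 * N * D\<^sup>2 + 4 * D ^ 3 + N\<^sup>2 + 2 * N - 4 * D"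

text \<open>\<open>charge_poly\<close> is polymorphic so that one polynomial serves both evaluation
  over \<open>int\<close> and estimates over \<open>real\<close>.\<close>

lemma barrier_charge_eq:
  assumes "D \<le> N"
  shows "barrier_charge N (N - D) = 8 * charge_poly (real N) (real D)"
  using assms unfolding barrier_charge_def charge_poly_def Let_def of_nat_diff[OF assms] by algebra

text \<open>In units of \<open>10\<^sup>-\<^sup>9\<close>; the added 1 rounds the quotient up.\<close>

primrec icheb :: "int \<Rightarrow> nat \<Rightarrow> int \<times> int" where
  "icheb E 0 = (1000000000, E)"
| "icheb E (Suc k) = (let t = fst (icheb E k) + snd (icheb E k) in (t, snd (icheb E k) + (2 * E * t) div 1000000000 + 1))"

lemma div_int_less: "real_of_int a / real_of_int b < real_of_int (a div b) + 1"
  unfolding floor_divide_of_int_eq[where ?'a = real, symmetric] by linarith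

lemma div_int_le: "real_of_int (a div b) \<le> real_of_int a / real_of_int b"
  unfolding floor_divide_of_int_eq[where ?'a = real, symmetric] by linarith

text \<open>All quantities are nonnegative and the recursion is monotone in them, so rounding up in
  every step preserves the upper bound.\<close>

lemma cheb_le_icheb:
  assumes e: "0 \<le> e" "e * 10 ^ 9 \<le> real_of_int E"
  shows "fst (cheb e k) * 10 ^ 9 \<le> real_of_int (fst (icheb E k)) \<and> snd (cheb e k) * 10 ^ 9 \<le> real_of_int (snd (icheb E k))"
proof (induction k)
  case (Suc k)
  define t where "t = fst (icheb E k) + snd (icheb E k)"
  have t: "(fst (cheb e k) + snd (cheb e k)) * 10 ^ 9 \<le> real_of_int t" using Suc by (simp add: t_def algebra_simps)
  define R where "R = (2 * E * t) div 1000000000"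
  define X where "X = fst (cheb e k) + snd (cheb e k)"
  have "(e * 10 ^ 9) * (X * 10 ^ 9) \<le> real_of_int E * real_of_int t"
    using e t[folded X_def] cheb_ge[OF e(1), of k] order_trans[OF mult_nonneg_nonneg e(2), OF e(1)] by (intro mult_mono) (auto simp: X_def)
  then have "2 * e * X * 10 ^ 9 \<le> real_of_int (2 * E * t) / real_of_int 1000000000" by simp
  also have "\<dots> < real_of_int ((2 * E * t) div 1000000000) + 1" by (rule div_int_less)
  finally have R: "2 * e * X * 10 ^ 9 < real_of_int R + 1" unfolding R_def .
  have "icheb E (Suc k) = (t, snd (icheb E k) + R + 1)" "cheb e (Suc k) = (X, snd (cheb e k) + 2 * e * X)"
    by (simp_all only: icheb.simps cheb.simps Let_def t_def X_def R_def)
  moreover have "(snd (cheb e k) + 2 * e * X) * 10 ^ 9 \<le> real_of_int (snd (icheb E k) + R + 1)"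
    using R conjunct2[OF Suc] unfolding distrib_right of_int_add of_int_1 by linarith
  ultimately show ?case using t[folded X_def] by simp
qed (use assms in simp)

text \<open>Evaluated by rewriting, \<open>icheb\<close> takes exponential time, because its recursive call is duplicated.\<close>

primrec ichebt :: "int \<Rightarrow> nat \<Rightarrow> int \<Rightarrow> int \<Rightarrow> int" where
  "ichebt E 0 t u = t"
| "ichebt E (Suc k) t u = ichebt E k (t + u) (u + (2 * E * (t + u)) div 1000000000 + 1)"

lemma ichebt_eq: "ichebt E k 1000000000 E = fst (icheb E k)"
proof -
  have "ichebt E k (fst (icheb E n)) (snd (icheb E n)) = fst (icheb E (n + k))" for n
  proof (induction k arbitrary: n)
    case (Suc k)
    show ?case
      using Suc[of "Suc n"] by (simp only: icheb.simps ichebt.simps Let_def fst_conv snd_conv add_Suc_shift)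
  qed simp
  from this[of 0] show ?thesis by simp
qed

text \<open>A lower bound, in units of \<open>10\<^sup>-\<^sup>6\<close>, for one mode \<open>(2 - e) / T\<^sub>k (1 + e)\<close>, where \<open>e \<le> 10\<^sup>-\<^sup>6 E\<close>.\<close>

definition imode :: "int \<Rightarrow> nat \<Rightarrow> int" where
  "imode E k = (1000000000 * (2000000 - E)) div ichebt (1000 * E) k 1000000000 (1000 * E)"

lemma icheb_pos: "0 \<le> E \<Longrightarrow> 0 < fst (icheb E k) \<and> 0 \<le> snd (icheb E k)"
  by (induction k) (auto simp: Let_def pos_imp_zdiv_nonneg_iff intro!: add_nonneg_nonneg mult_nonneg_nonneg)

lemma imode_le:
  assumes "0 \<le> E"
  shows "real_of_int (imode E k) / 10 ^ 6 \<le> (2 - real_of_int E / 10 ^ 6) / (real_of_int (fst (icheb (1000 * E) k)) / 10 ^ 9)"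
proof -
  have "real_of_int (imode E k) \<le> real_of_int (1000000000 * (2000000 - E)) / real_of_int (fst (icheb (1000 * E) k))"
    unfolding imode_def ichebt_eq by (rule div_int_le)
  moreover have "0 < real_of_int (fst (icheb (1000 * E) k))" using icheb_pos[of "1000 * E" k] assms by simp
  ultimately show ?thesis by (simp add: field_simps)
qed

text \<open>In units of \<open>10\<^sup>-\<^sup>6\<close>; the factor is an upper bound of \<open>10\<^sup>6 \<pi>\<^sup>2 / 8\<close>.\<close>

definition freq_up :: "nat \<Rightarrow> nat \<Rightarrow> int" where
  "freq_up W j = (1233800 * (2 * int j + 1)\<^sup>2) div (int W)\<^sup>2 + 1"

lemma mode_freq_cos_le: "1 - cos (mode_freq W j) \<le> 12338 / 10 ^ 4 * (2 * real j + 1)\<^sup>2 / (real W)\<^sup>2"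
proof -
  have "1 - cos (mode_freq W j) \<le> (mode_freq W j)\<^sup>2 / 2" by (rule one_minus_cos_le)
  also have "\<dots> = (pi\<^sup>2 / 8) * ((2 * real j + 1)\<^sup>2 / (real W)\<^sup>2)"
    by (simp add: mode_freq_def power_mult_distrib power_divide)
  also have "\<dots> \<le> 12338 / 10 ^ 4 * ((2 * real j + 1)\<^sup>2 / (real W)\<^sup>2)"
  proof (intro mult_right_mono)
    have "pi\<^sup>2 \<le> (31416 / 10000)\<^sup>2" using pi_less by (intro power_mono) auto
    then show "pi\<^sup>2 / 8 \<le> 12338 / 10 ^ 4" by (simp add: power2_eq_square)
  qed simp
  finally show ?thesis by simp
qed

lemma mode_freq_cos_le_freq_up: "1 - cos (mode_freq W j) \<le> real_of_int (freq_up W j) / 10 ^ 6"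
proof -
  have "real_of_int (1233800 * (2 * int j + 1)\<^sup>2) / real_of_int ((int W)\<^sup>2) < real_of_int (freq_up W j)"
    unfolding freq_up_def using div_int_less[of "1233800 * (2 * int j + 1)\<^sup>2" "(int W)\<^sup>2"] by simp
  then show ?thesis using mode_freq_cos_le[of W j] by simp
qed

lemma freq_up_nonneg: "0 \<le> freq_up W j"
  by (auto simp: freq_up_def intro!: add_nonneg_nonneg) (simp add: zdiv_int[symmetric] pos_imp_zdiv_nonneg_iff div_int_pos_iff)

text \<open>For \<open>W < 3\<close> the bound \<open>freq_up W 1\<close> exceeds 2, so that the second mode would be of no use.\<close>

definition first_low :: "nat \<Rightarrow> nat \<Rightarrow> int" where
  "first_low W D = (imode (freq_up W 0) D + (if W < 3 then 0 else imode (freq_up W 1) D)) div int W"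

lemma freq_up_le: "freq_up W 0 \<le> 2000000" "3 \<le> W \<Longrightarrow> freq_up W 1 \<le> 2000000"
proof -
  have sq: "c\<^sup>2 \<le> (int W)\<^sup>2" if "0 \<le> c" "c \<le> int W" for c using that by (intro power_mono)
  show "freq_up W 0 \<le> 2000000"
  proof (cases "W = 0")
    case False
    then have "1233800 div (int W)\<^sup>2 \<le> 1233800 div 1" using sq[of 1] by (intro zdiv_mono2) auto
    then show ?thesis by (simp add: freq_up_def)
  qed (simp add: freq_up_def)
  assume "3 \<le> W"
  then have "11104200 div (int W)\<^sup>2 \<le> 11104200 div 9" using sq[of 3] by (intro zdiv_mono2) auto
  then show "freq_up W 1 \<le> 2000000" by (simp add: freq_up_def)
qed

lemma first_low_le:
  assumes f: "duel x D f" and W: "1 \<le> W" "W \<le> x" and D: "1 \<le> D"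
  shows "real_of_int (first_low W D) / 10 ^ 6 \<le> f 1 D"
proof -
  define m where "m = (if W < 3 then 1 else 2 :: nat)"
  define T where "T j = real_of_int (fst (icheb (1000 * freq_up W j) D)) / 10 ^ 9" for j
  have j: "j < m \<Longrightarrow> j = 0 \<or> (j = 1 \<and> 3 \<le> W)" for j by (auto simp: m_def split: if_splits)
  have "(\<Sum>j<m. real_of_int (imode (freq_up W j) D) / 10 ^ 6) \<le> (\<Sum>j<m. (2 - real_of_int (freq_up W j) / 10 ^ 6) / T j)"
    unfolding T_def by (intro sum_mono imode_le freq_up_nonneg)
  then have "(\<Sum>j<m. real_of_int (imode (freq_up W j) D) / 10 ^ 6) / real W \<le> (\<Sum>j<m. (2 - real_of_int (freq_up W j) / 10 ^ 6) / T j) / real W"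
    by (rule divide_right_mono) simp
  also have "\<dots> \<le> duel_modes W D 1 D"
  proof (rule duel_first_ge_modes[OF duel_duel_modes[OF W(1)] W(1) D])
    show "m \<le> W" using W by (auto simp: m_def)
    show "1 - cos (mode_freq W j) \<le> real_of_int (freq_up W j) / 10 ^ 6" for j by (rule mode_freq_cos_le_freq_up)
    show "real_of_int (freq_up W j) / 10 ^ 6 \<le> 2" if "j < m" for j using j[OF that] freq_up_le[of W] by force
    show "fst (cheb (1 - cos (mode_freq W j)) D) \<le> T j" for j
      using cheb_le_icheb[of "1 - cos (mode_freq W j)" "1000 * freq_up W j" D] mode_freq_cos_le_freq_up[of W j]
      by (simp add: T_def)
  qed
  also have "\<dots> \<le> f 1 D" by (rule duel_le[OF duel_duel_modes[OF W(1)] f]) (use W D in auto)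
  finally have le: "(\<Sum>j<m. real_of_int (imode (freq_up W j) D) / 10 ^ 6) / real W \<le> f 1 D" .
  have "real_of_int (first_low W D) \<le> real_of_int (imode (freq_up W 0) D + (if W < 3 then 0 else imode (freq_up W 1) D)) / real_of_int (int W)"
    unfolding first_low_def by (rule div_int_le)
  then have "real_of_int (first_low W D) / 10 ^ 6 \<le> real_of_int (imode (freq_up W 0) D + (if W < 3 then 0 else imode (freq_up W 1) D)) / real W / 10 ^ 6"
    by (intro divide_right_mono) auto
  also have "\<dots> = (\<Sum>j<m. real_of_int (imode (freq_up W j) D) / 10 ^ 6) / real W"
    by (cases "W < 3") (auto simp: m_def numeral_2_eq_2 add_divide_distrib)
  finally show ?thesis using le by linarith
qed

text \<open>The width is capped at \<open>2 * D\<close>, as \<open>duel_le\<close> permits: two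
  modes give at most \<open>4 / W\<close>, which would be too little for a wide strip. The constants
  562500, 500000 and 125000 are \<open>9 / 16\<close>, \<open>1 / 2\<close> and \<open>1 / 8\<close>
  in units of \<open>10 ^ (-6)\<close>; the final 1 or 2 makes up for rounding down the subtracted
  quotients.\<close>

definition end_low :: "nat \<Rightarrow> nat \<Rightarrow> int" where
  "end_low N D = (let n = int N; d = int D; a = first_low (min (N - D) (2 * D)) D in
     if D = 1 then a
     else if D = 2 \<and> 6 \<le> N then a - 239200
     else max (if 2 * D \<le> N then a - 562500 div d - 1
         else a - 500000 div d - (125000 * d) div (n * (n - d)) - 2)
       (a - ((n\<^sup>2 - d\<^sup>2) * 500000) div (n\<^sup>2 * d) - (500000 * d * (3 * d - 1)) div ((d + 1) * n\<^sup>2) - 2))"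

lemma end_low_le:
  assumes q: "path_game N q" and D: "1 \<le> D" "D < N"
  shows "real_of_int (end_low N D) / 10 ^ 6 \<le> end_source N q (N - D)"
proof -
  define a where "a = first_low (min (N - D) (2 * D)) D"
  have a: "\<forall>f. duel (N - D) D f \<longrightarrow> real_of_int a / 10 ^ 6 \<le> f 1 D"
    unfolding a_def using first_low_le[of "N - D" D _ "min (N - D) (2 * D)"] D by auto
  define b1 where "b1 = ((int N)\<^sup>2 - (int D)\<^sup>2) * 500000"
  define b2 where "b2 = 500000 * int D * (3 * int D - 1)"
  have el: "end_low N D = (if D = 1 then a
     else if D = 2 \<and> 6 \<le> N then a - 239200
     else max (if 2 * D \<le> N then a - 562500 div int D - 1
         else a - 500000 div int D - (125000 * int D) div (int N * (int N - int D)) - 2)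
       (a - b1 div ((int N)\<^sup>2 * int D) - b2 div ((int D + 1) * (int N)\<^sup>2) - 2))"
    unfolding end_low_def a_def b1_def b2_def Let_def ..
  note L = end_source_lower[OF q D a]
  have "real_of_int b1 / real_of_int ((int N)\<^sup>2 * int D) < real_of_int (b1 div ((int N)\<^sup>2 * int D)) + 1"
    "real_of_int b2 / real_of_int ((int D + 1) * (int N)\<^sup>2) < real_of_int (b2 div ((int D + 1) * (int N)\<^sup>2)) + 1"
    by (rule div_int_less)+
  moreover have "real_of_int a / 10 ^ 6 - (1 - (real D / real N)\<^sup>2) / (2 * real D) - (real D / real N)\<^sup>2 * (2 / (real D + 1) - 1 / (2 * real D)) =
      (real_of_int a - real_of_int b1 / real_of_int ((int N)\<^sup>2 * int D) - real_of_int b2 / real_of_int ((int D + 1) * (int N)\<^sup>2)) / 10 ^ 6"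
  proof -
    have "(1 - (real D / real N)\<^sup>2) / (2 * real D) = real_of_int b1 / real_of_int ((int N)\<^sup>2 * int D) / 10 ^ 6"
      using D by (simp add: b1_def power_divide field_simps)
    moreover have "(real D / real N)\<^sup>2 * (2 / (real D + 1) - 1 / (2 * real D)) = real_of_int b2 / real_of_int ((int D + 1) * (int N)\<^sup>2) / 10 ^ 6"
      using D by (simp add: b2_def power_divide divide_simps) (simp add: algebra_simps power2_eq_square)
    ultimately show ?thesis by (simp only: diff_divide_distrib)
  qed
  ultimately have t: "real_of_int (a - b1 div ((int N)\<^sup>2 * int D) - b2 div ((int D + 1) * (int N)\<^sup>2) - 2) / 10 ^ 6
      \<le> real_of_int a / 10 ^ 6 - (1 - (real D / real N)\<^sup>2) / (2 * real D) - (real D / real N)\<^sup>2 * (2 / (real D + 1) - 1 / (2 * real D))"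
    by simp
  consider "D = 1" | "D = 2" "6 \<le> N" | "D \<noteq> 1" "\<not> (D = 2 \<and> 6 \<le> N)" "2 * D \<le> N"
    | "D \<noteq> 1" "\<not> (D = 2 \<and> 6 \<le> N)" "\<not> 2 * D \<le> N" by blast
  then show ?thesis
  proof cases
    case 1
    then show ?thesis using L(1) el by simp
  next
    case 2
    then show ?thesis using L(2) el by (simp add: field_simps)
  next
    case 3
    have "real_of_int 562500 / real_of_int (int D) < real_of_int (562500 div int D) + 1" by (rule div_int_less)
    moreover have "real_of_int a / 10 ^ 6 - 9 / (16 * real D) = (real_of_int a - real_of_int 562500 / real_of_int (int D)) / 10 ^ 6"
      using D by (simp add: field_simps)
    ultimately have s: "real_of_int (a - 562500 div int D - 1) / 10 ^ 6 \<le> real_of_int a / 10 ^ 6 - 9 / (16 * real D)"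
      by simp
    have "end_low N D = max (a - 562500 div int D - 1) (a - b1 div ((int N)\<^sup>2 * int D) - b2 div ((int D + 1) * (int N)\<^sup>2) - 2)"
      using 3 el by (simp only: if_False if_True)
    then show ?thesis using order_trans[OF s L(3)] order_trans[OF t L(5)] 3 by (simp add: max_def)
  next
    case 4
    have "real_of_int 500000 / real_of_int (int D) < real_of_int (500000 div int D) + 1" by (rule div_int_less)
    moreover have "real_of_int (125000 * int D) / real_of_int (int N * (int N - int D)) <
        real_of_int ((125000 * int D) div (int N * (int N - int D))) + 1" by (rule div_int_less)
    moreover have "real_of_int a / 10 ^ 6 - 1 / (2 * real D) - real D / (8 * real N * (real N - real D)) =
        (real_of_int a - real_of_int 500000 / real_of_int (int D) - real_of_int (125000 * int D) / real_of_int (int N * (int N - int D))) / 10 ^ 6"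
      using D by (simp add: diff_divide_distrib)
    ultimately have s: "real_of_int (a - 500000 div int D - (125000 * int D) div (int N * (int N - int D)) - 2) / 10 ^ 6
        \<le> real_of_int a / 10 ^ 6 - 1 / (2 * real D) - real D / (8 * real N * (real N - real D))"
      by simp
    have "end_low N D = max (a - 500000 div int D - (125000 * int D) div (int N * (int N - int D)) - 2)
        (a - b1 div ((int N)\<^sup>2 * int D) - b2 div ((int D + 1) * (int N)\<^sup>2) - 2)"
      using 4 el by (simp only: if_False)
    then show ?thesis using order_trans[OF s L(4)] order_trans[OF t L(5)] 4 by (simp add: max_def)
  qed
qed

definition small_ok :: "nat \<Rightarrow> nat \<Rightarrow> bool" where
  "small_ok N D \<longleftrightarrow> 1720000 * charge_poly (int N) (int D) < end_low N D * int N ^ 4"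

lemma small_okD:
  assumes q: "path_game N q" and D: "1 \<le> D" "D < N" and ok: "small_ok N D"
  shows "172 / 100 * charge_poly (real N) (real D) < end_source N q (N - D) * real N ^ 4"
proof -
  have "real_of_int (1720000 * charge_poly (int N) (int D)) < real_of_int (end_low N D * int N ^ 4)"
    using ok unfolding small_ok_def of_int_less_iff .
  then have "172 / 100 * charge_poly (real N) (real D) < (real_of_int (end_low N D) / 10 ^ 6) * real N ^ 4"
    by (simp add: charge_poly_def)
  also have "\<dots> \<le> end_source N q (N - D) * real N ^ 4"
    by (intro mult_right_mono end_low_le[OF q D]) simp
  finally show ?thesis .
qed

section \<open>The shortest paths, by solving the harmonic equations\<close>

lemma end_source_gt_three:
  assumes q: "path_game 3 q" and D: "D = 1 \<or> D = 2"
  shows "172 / 100 * charge_poly (real 3) (real D) < end_source 3 q (3 - D) * real 3 ^ 4"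
proof -
  have "1 \<le> D" "D < 3" using D by auto
  then obtain f g H where fgH: "duel (3 - D) D f" "duel D D g" "duel 3 3 H"
    and S: "end_source 3 q (3 - D) = f 1 D + (if D = 1 then 0 else g 1 D - 2 * H 1 D)"
    by (rule end_source_duel[OF q])
  from D show ?thesis
  proof
    assume D: "D = 1"
    have "f 1 1 = 5 / 7"
      using duelD(3)[OF fgH(1), of 1 1] duelD(3)[OF fgH(1), of 2 1] duelD(1,2)[OF fgH(1)] D
      by (simp add: refl_up_def eval_nat_numeral)
    then show ?thesis using S D by (simp add: charge_poly_def)
  next
    assume D: "D = 2"
    have "f 1 2 = 1 / 7"
      using duelD(3)[OF fgH(1), of 1 1] duelD(3)[OF fgH(1), of 1 2] duelD(1,2)[OF fgH(1)] D
      by (simp add: refl_up_def eval_nat_numeral)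
    moreover have "g 1 2 = 3 / 8" using duel_square_values(1) fgH(2) D by simp
    moreover have "4 * H 1 2 = 1 + H 1 3"
      using duelD(3)[OF fgH(3), of 1 2] duelD(1)[OF fgH(3), of 2] duel_diag[OF fgH(3), of 1] duel_diag[OF fgH(3), of 2]
      by (simp add: refl_up_def eval_nat_numeral)
    ultimately show ?thesis using S D duel_square_values(2)[OF fgH(3)] by (simp add: charge_poly_def)
  qed
qed

lemma end_source_gt_two:
  assumes q: "path_game 2 q"
  shows "172 / 100 * charge_poly (real 2) (real 1) < end_source 2 q (2 - 1) * real 2 ^ 4"
proof -
  obtain f where f: "duel (2 - 1) 1 f" "end_source 2 q (2 - 1) = f 1 1"
    using end_source_duel[OF q, of 1] by auto
  then have "f 1 1 = 1 / 2" using duel_diag[of 1 f 1] by simp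
  then show ?thesis using f(2) by (simp add: charge_poly_def)
qed

lemma end_source_gt_four:
  assumes q: "path_game 4 q" and D: "D = 2 \<or> D = 3"
  shows "172 / 100 * charge_poly (real 4) (real D) < end_source 4 q (4 - D) * real 4 ^ 4"
proof -
  have "1 \<le> D" "D < 4" using D by auto
  then obtain f g H where fgH: "duel (4 - D) D f" "duel D D g" "duel 4 4 H"
    and S: "end_source 4 q (4 - D) = f 1 D + (if D = 1 then 0 else g 1 D - 2 * H 1 D)"
    by (rule end_source_duel[OF q])
  have H: "4 * H 1 2 = 1 + H 1 3" "4 * H 1 3 = H 2 3 + H 1 2 + H 1 4" "4 * H 1 4 = H 2 4 + 2 * H 1 3"
    "4 * H 2 3 = H 1 3 + 1 + H 2 4" "4 * H 2 4 = H 1 4 + H 3 4 + 2 * H 2 3" "4 * H 3 4 = H 2 4 + 1 / 2 + 1"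
    using duelD(3)[OF fgH(3), of 1 2] duelD(3)[OF fgH(3), of 1 3] duelD(3)[OF fgH(3), of 1 4]
      duelD(3)[OF fgH(3), of 2 3] duelD(3)[OF fgH(3), of 2 4] duelD(3)[OF fgH(3), of 3 4]
      duelD(1)[OF fgH(3)] duel_diag[OF fgH(3), of 1] duel_diag[OF fgH(3), of 2] duel_diag[OF fgH(3), of 3] duel_diag[OF fgH(3), of 4]
    by (simp_all add: refl_up_def eval_nat_numeral)
  from D show ?thesis
  proof
    assume D: "D = 2"
    have "f 1 2 = 3 / 8" "g 1 2 = 3 / 8" using duel_square_values(1) fgH D by auto
    then show ?thesis using S D H by (simp add: charge_poly_def)
  next
    assume D: "D = 3"
    have "4 * f 1 1 = 1 + f 1 2" "4 * f 1 2 = f 1 1 + f 1 3" "4 * f 1 3 = 2 * f 1 2"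
      using duelD(3)[OF fgH(1), of 1 1] duelD(3)[OF fgH(1), of 1 2] duelD(3)[OF fgH(1), of 1 3] duelD(1,2)[OF fgH(1)] D
      by (simp_all add: refl_up_def eval_nat_numeral)
    moreover have "g 1 3 = 7 / 26" using duel_square_values(2) fgH(2) D by simp
    ultimately show ?thesis using S D H by (simp add: charge_poly_def)
  qed
qed

lemma end_source_gt_five:
  assumes q: "path_game 5 q"
  shows "172 / 100 * charge_poly (real 5) (real 2) < end_source 5 q (5 - 2) * real 5 ^ 4"
proof -
  obtain f g H where fgH: "duel (5 - 2) 2 f" "duel 2 2 g" "duel 5 5 H"
    and S: "end_source 5 q (5 - 2) = f 1 2 + (if 2 = (1::nat) then 0 else g 1 2 - 2 * H 1 2)"
    by (rule end_source_duel[OF q, of 2]) auto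
  \<comment> \<open>Instead of solving the square of side 5, the corner bound with
    \<open>S = 2 * N = 10\<close> is used: \<open>1 / 4 + 1 / 8 - 1 / 10 = 11 / 40\<close>.\<close>
  have "refl_ext 5 H 1 3 \<le> real 1 * (1 / real (1 + 3) + 1 / (real 10 - real 3 + real 1) - 1 / real 10)"
    by (rule refl_ext_le_corner[OF fgH(3), of 10 1 3]) auto
  then have "H 1 3 \<le> 11 / 40" by (simp add: refl_ext_def)
  moreover have "4 * H 1 2 = 1 + H 1 3"
    using duelD(3)[OF fgH(3), of 1 2] duelD(1)[OF fgH(3), of 2] duel_diag[OF fgH(3), of 1] duel_diag[OF fgH(3), of 2]
    by (simp add: refl_up_def eval_nat_numeral)
  moreover have "g 1 2 = 3 / 8" by (rule duel_square_values(1)[OF fgH(2)])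
  moreover have "4 * f 1 1 = 1 + f 2 1 + f 1 2" "4 * f 1 2 = f 2 2 + 2 * f 1 1" "4 * f 2 1 = f 1 1 + f 3 1 + 1 + f 2 2"
    "4 * f 2 2 = f 1 2 + f 3 2 + 2 * f 2 1" "4 * f 3 1 = 2 * f 2 1 + 1 + f 3 2" "4 * f 3 2 = 2 * f 2 2 + 2 * f 3 1"
    using duelD(3)[OF fgH(1), of 1 1] duelD(3)[OF fgH(1), of 1 2] duelD(3)[OF fgH(1), of 2 1] duelD(3)[OF fgH(1), of 2 2]
      duelD(3)[OF fgH(1), of 3 1] duelD(3)[OF fgH(1), of 3 2] duelD(1,2)[OF fgH(1)]
    by (simp_all add: refl_up_def eval_nat_numeral)
  ultimately show ?thesis using S by (simp add: charge_poly_def)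
qed

section \<open>Long paths, in terms of the ratio of the distances to the ends\<close>

lemma cosh_le:
  fixes y :: real
  assumes "0 \<le> y" "y < 2"
  shows "cosh y - 1 \<le> (y\<^sup>2 / 2) / (1 - y\<^sup>2 / 4)"
proof -
  have sinh_le: "sinh z \<le> z * cosh z" if "0 \<le> z" for z :: real
  proof -
    have "(\<lambda>z. z * cosh z - sinh z) 0 \<le> (\<lambda>z. z * cosh z - sinh z) z"
    proof (rule DERIV_nonneg_imp_nondecreasing[OF that])
      fix t :: real assume "0 \<le> t"
      then show "\<exists>d. ((\<lambda>z. z * cosh z - sinh z) has_real_derivative d) (at t) \<and> 0 \<le> d"
        by (intro exI[of _ "t * sinh t"]) (auto intro!: derivative_eq_intros)
    qed
    then show ?thesis by simp
  qed
  have c: "cosh y = 1 + 2 * (sinh (y / 2))\<^sup>2" "(cosh (y / 2))\<^sup>2 = 1 + (sinh (y / 2))\<^sup>2"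
    using cosh_add[of "y / 2" "y / 2"] cosh_square_eq[of "y / 2"] by (simp_all add: power2_eq_square)
  \<comment> \<open>Replacing \<open>cosh ^ 2\<close> by \<open>1 + sinh ^ 2\<close> makes this
    linear in the square of \<open>sinh (y / 2)\<close>; solving for it gives a rational
    bound.\<close>
  have "(sinh (y / 2))\<^sup>2 \<le> (y / 2 * cosh (y / 2))\<^sup>2"
    using sinh_le[of "y / 2"] assms by (intro power_mono) auto
  then have "(sinh (y / 2))\<^sup>2 \<le> y\<^sup>2 / 4 * (1 + (sinh (y / 2))\<^sup>2)"
    by (simp add: power_mult_distrib c(2) power_divide)
  then have "(cosh y - 1) * (1 - y\<^sup>2 / 4) \<le> y\<^sup>2 / 2" unfolding c(1) by (simp add: algebra_simps)
  moreover have "0 < 1 - y\<^sup>2 / 4"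
  proof -
    have "y\<^sup>2 < 2\<^sup>2" using assms by (intro power_strict_mono) auto
    then show ?thesis by simp
  qed
  ultimately show ?thesis by (simp only: pos_le_divide_eq)
qed

text \<open>\<open>10\<^sup>-\<^sup>9 icosh_j\<close> bounds \<open>cosh ((2 j + 1) \<pi> / 64) - 1\<close>.\<close>

definition icosh :: "nat \<Rightarrow> int" where
  "icosh j = (if j = 0 then 1205518 else 10902230)"

lemma icosh_ge:
  assumes "j < 2"
  shows "(cosh ((2 * real j + 1) * (pi / 64)) - 1) * 10 ^ 9 \<le> real_of_int (icosh j)"
proof -
  define y where "y = (2 * real j + 1) * (31416 / 640000 :: real)"
  have j: "j = 0 \<or> j = 1" using assms by auto
  have "(2 * real j + 1) * (pi / 64) \<le> y" unfolding y_def using pi_less by (intro mult_left_mono) auto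
  then have "cosh ((2 * real j + 1) * (pi / 64)) \<le> cosh y" by (intro cosh_real_nonneg_le_iff[THEN iffD2]) (auto simp: y_def)
  moreover define Z where "Z = (y\<^sup>2 / 2) / (1 - y\<^sup>2 / 4)"
  have "cosh y - 1 \<le> Z" unfolding Z_def using j by (intro cosh_le) (auto simp: y_def)
  moreover have "Z * 10 ^ 9 \<le> real_of_int (icosh j)"
    using j by (auto simp: Z_def y_def icosh_def power2_eq_square)
  ultimately show ?thesis by simp
qed

definition icosh_table :: "nat \<Rightarrow> nat \<Rightarrow> int" where
  "icosh_table j l = ichebt (icosh j) l 1000000000 (icosh j)"

lemma icosh_table_ge:
  assumes "j < 2"
  shows "cosh ((2 * real j + 1) * (pi / 64) * real l) \<le> real_of_int (icosh_table j l) / 10 ^ 9" "0 < icosh_table j l"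
proof -
  have "fst (cheb (cosh ((2 * real j + 1) * (pi / 64)) - 1) l) * 10 ^ 9 \<le> real_of_int (fst (icheb (icosh j) l))"
    using cheb_le_icheb[OF _ icosh_ge[OF assms], of l] by (simp add: cosh_real_ge_1)
  then show "cosh ((2 * real j + 1) * (pi / 64) * real l) \<le> real_of_int (icosh_table j l) / 10 ^ 9"
    by (simp add: cheb_cosh icosh_table_def ichebt_eq mult.commute)
  show "0 < icosh_table j l"
    using icheb_pos[of "icosh j" l] by (simp add: icosh_table_def ichebt_eq icosh_def)
qed

text \<open>After the passage to hyperbolic cosines only
  \<open>D * mode_freq W j = (2 * j + 1) * (pi / 2) * (D / W)\<close> enters, so rounding
  \<open>D / W\<close> up to a multiple of \<open>1 / 32\<close> lets one finite table serve all
  path lengths.\<close>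

lemma duel_first_ge_ratio:
  assumes f: "duel x D f" and D: "1 \<le> D" and W: "3 \<le> W" "W \<le> x" and l: "32 * D \<le> l * W"
    and e: "12338 / 10 ^ 4 / (real W)\<^sup>2 \<le> e" "9 * e \<le> 2"
  shows "((2 - e) / (real_of_int (icosh_table 0 l) / 10 ^ 9) + (2 - 9 * e) / (real_of_int (icosh_table 1 l) / 10 ^ 9)) / real W \<le> f 1 D"
proof -
  have "(\<Sum>j<2. (2 - (2 * real j + 1)\<^sup>2 * e) / (real_of_int (icosh_table j l) / 10 ^ 9)) / real W \<le> duel_modes W D 1 D"
  proof (rule duel_first_ge_modes[OF duel_duel_modes])
    fix j :: nat assume j: "j < 2"
    show "1 - cos (mode_freq W j) \<le> (2 * real j + 1)\<^sup>2 * e"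
      using mode_freq_cos_le[of W j] mult_left_mono[OF e(1), of "(2 * real j + 1)\<^sup>2"] by simp
    have "j = 0 \<or> j = 1" using j by auto
    then show "(2 * real j + 1)\<^sup>2 * e \<le> 2"
    proof
      assume "j = 0"
      have "0 \<le> 12338 / 10 ^ 4 / (real W)\<^sup>2" by simp
      then have "0 \<le> e" using e(1) by linarith
      then show ?thesis using e \<open>j = 0\<close> by simp
    qed (use e in simp)
    have "fst (cheb (1 - cos (mode_freq W j)) D) \<le> fst (cheb (cosh (mode_freq W j) - 1) D)"
      using cheb_mono[of "1 - cos (mode_freq W j)" "cosh (mode_freq W j) - 1" D] cos_cosh_ge[of "mode_freq W j"] by simp
    also have "\<dots> = cosh (real D * mode_freq W j)" by (simp add: cheb_cosh)
    also have "\<dots> \<le> cosh ((2 * real j + 1) * (pi / 64) * real l)"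
    proof -
      have "real (32 * D) \<le> real (l * W)" using l by (simp only: of_nat_le_iff)
      then have "real D / real W \<le> real l / 32" using W by (simp add: divide_simps mult_ac)
      then have "(2 * real j + 1) * (pi / 2) * (real D / real W) \<le> (2 * real j + 1) * (pi / 2) * (real l / 32)"
        by (intro mult_left_mono) auto
      moreover have "real D * mode_freq W j = (2 * real j + 1) * (pi / 2) * (real D / real W)" by (simp add: mode_freq_def)
      moreover have "(2 * real j + 1) * (pi / 64) * real l = (2 * real j + 1) * (pi / 2) * (real l / 32)" by simp
      ultimately show ?thesis using W D by (intro cosh_real_nonneg_le_iff[THEN iffD2]) auto
    qed
    also have "\<dots> \<le> real_of_int (icosh_table j l) / 10 ^ 9" by (rule icosh_table_ge(1)[OF j])
    finally show "fst (cheb (1 - cos (mode_freq W j)) D) \<le> real_of_int (icosh_table j l) / 10 ^ 9" .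
  qed (use D W in auto)
  also have "\<dots> \<le> f 1 D" by (rule duel_le[OF duel_duel_modes f]) (use W D in auto)
  finally show ?thesis by (simp add: numeral_2_eq_2)
qed

text \<open>
  For \<open>D / (N - D) \<in> [k / 32, l / 32]\<close> and \<open>N \<ge> 20\<close>, \<open>ratio_low\<close> bounds \<open>10\<^sup>6 (N - D) f 1 D\<close>.
\<close>

definition ratio_low :: "nat \<Rightarrow> int" where
  "ratio_low l = (let e = (12338 * (32 + int l)\<^sup>2) div 4096 + 1 in
     (1000000000 * (2000000 - e)) div icosh_table 0 l +
     (if l \<le> 32 then (1000000000 * (2000000 - 9 * e)) div icosh_table 1 l else 0))"

lemma ratio_low_le:
  assumes f: "duel x D f" and D: "1 \<le> D" and l: "32 * D \<le> l * x" "l \<le> 224" and N: "20 \<le> x + D"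
  shows "real_of_int (ratio_low l) / 10 ^ 6 / real x \<le> f 1 D"
proof -
  define e where "e = (12338 * (32 + int l)\<^sup>2) div 4096 + 1"
  have "l * x \<le> 224 * x" using l by (intro mult_right_mono) auto
  then have x: "3 \<le> x" using l(1) N by linarith
  have "32 * 20 \<le> 32 * (x + D)" using N by simp
  \<comment> \<open>Thus \<open>x \<ge> 640 / (32 + l)\<close>, which makes the bound
    \<open>e\<close> independent of \<open>N\<close>; the 4096 in \<open>e\<close> is
    \<open>640 ^ 2 / 100\<close>.\<close>
  also have "\<dots> \<le> (32 + l) * x" using l by (simp add: algebra_simps)
  finally have "real 640 \<le> real ((32 + l) * x)" by (simp only: of_nat_le_iff)
  then have "640\<^sup>2 \<le> ((32 + real l) * real x)\<^sup>2" by (intro power_mono) auto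
  then have "640\<^sup>2 / (real x)\<^sup>2 \<le> (32 + real l)\<^sup>2" using x by (simp add: power_mult_distrib divide_simps)
  then have "12338 / 10 ^ 4 / (real x)\<^sup>2 * 10 ^ 6 \<le> 12338 * (32 + real l)\<^sup>2 / 4096" by simp
  also have "\<dots> = real_of_int (12338 * (32 + int l)\<^sup>2) / real_of_int 4096" by simp
  also have "\<dots> < real_of_int e" unfolding e_def using div_int_less[of "12338 * (32 + int l)\<^sup>2" 4096] by simp
  finally have e: "12338 / 10 ^ 4 / (real x)\<^sup>2 \<le> real_of_int e / 10 ^ 6" by simp
  have "(32 + int l)\<^sup>2 \<le> 256\<^sup>2" using l by (intro power_mono) auto
  then have "(12338 * (32 + int l)\<^sup>2) div 4096 \<le> (12338 * 256\<^sup>2) div 4096" by (intro zdiv_mono1 mult_left_mono) auto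
  then have e2: "9 * (real_of_int e / 10 ^ 6) \<le> 2" by (simp add: e_def)
  have conv: "real_of_int ((1000000000 * a) div icosh_table j l) / 10 ^ 6 \<le> (real_of_int a / 10 ^ 6) / (real_of_int (icosh_table j l) / 10 ^ 9)"
    for a j
    using div_int_le[of "1000000000 * a" "icosh_table j l"] by (simp add: field_simps)
  have "real_of_int (ratio_low l) / 10 ^ 6 \<le> (2 - real_of_int e / 10 ^ 6) / (real_of_int (icosh_table 0 l) / 10 ^ 9) +
      (2 - 9 * (real_of_int e / 10 ^ 6)) / (real_of_int (icosh_table 1 l) / 10 ^ 9)"
  proof -
    have "0 \<le> (2 - 9 * (real_of_int e / 10 ^ 6)) / (real_of_int (icosh_table 1 l) / 10 ^ 9)"
      using e2 icosh_table_ge(2)[of 1 l] by (intro divide_nonneg_nonneg) auto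
    note n = this
    have "real_of_int (2000000 - e) / 10 ^ 6 = 2 - real_of_int e / 10 ^ 6"
      "real_of_int (2000000 - 9 * e) / 10 ^ 6 = 2 - 9 * (real_of_int e / 10 ^ 6)" by simp_all
    note c = conv[of "2000000 - e" 0, unfolded this(1)] conv[of "2000000 - 9 * e" 1, unfolded this(2)]
    show ?thesis
    proof (cases "l \<le> 32")
      case True
      then have "real_of_int (ratio_low l) / 10 ^ 6 = real_of_int ((1000000000 * (2000000 - e)) div icosh_table 0 l) / 10 ^ 6 +
          real_of_int ((1000000000 * (2000000 - 9 * e)) div icosh_table 1 l) / 10 ^ 6"
        unfolding ratio_low_def Let_def e_def[symmetric] by (simp only: if_True of_int_add add_divide_distrib)
      then show ?thesis using add_mono[OF c] by (simp only:)
    next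
      case False
      then have "real_of_int (ratio_low l) / 10 ^ 6 = real_of_int ((1000000000 * (2000000 - e)) div icosh_table 0 l) / 10 ^ 6"
        unfolding ratio_low_def Let_def e_def[symmetric] by (simp only: if_False add_0_right)
      then show ?thesis using add_increasing2[OF n c(1)] by (simp only:)
    qed
  qed
  then have "real_of_int (ratio_low l) / 10 ^ 6 / real x \<le> ((2 - real_of_int e / 10 ^ 6) / (real_of_int (icosh_table 0 l) / 10 ^ 9) +
      (2 - 9 * (real_of_int e / 10 ^ 6)) / (real_of_int (icosh_table 1 l) / 10 ^ 9)) / real x"
    by (rule divide_right_mono) simp
  also have "\<dots> \<le> f 1 D" by (rule duel_first_ge_ratio[OF f D x order_refl l(1) e e2])
  finally show ?thesis .
qed

text \<open>This is the required inequality with cleared denominators, worst-cased over \<open>D / (N - D) \<in> [k / 32, l / 32]\<close>.\<close>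

definition ratio_ok :: "nat \<Rightarrow> nat \<Rightarrow> bool" where
  "ratio_ok k l \<longleftrightarrow> (let k' = int k; l' = int l; s = 32 + k'; m = ratio_low l;
       c = 1720000 * (s ^ 3 - 6 * k'\<^sup>2 * s + 4 * k' ^ 3) + 94600 * s ^ 3 in
     0 \<le> m \<and>
     (if l \<le> 32 then 32 * (32 + l') * s ^ 3 * 562500 + 32 * l' * c < k' * m * (32 + l') * s ^ 3
      else 500000 * s * 32 * s ^ 3 + l' * 125000 * k' * s ^ 3 + 32 * k' * c < s * m * k' * s ^ 3))"

text \<open>These cover the ratios from \<open>16 / 32 = 1 / 2\<close> to
  \<open>224 / 32 = 7\<close>, the range between \<open>end_source_gt_far\<close> and
  \<open>end_source_gt_near\<close>. The value 32 must be a node because the bound for the source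
  changes at \<open>2 * D = N\<close>.\<close>

definition ratio_nodes :: "nat list" where
  "ratio_nodes = [16, 17, 18, 19, 20, 22, 24, 27, 31, 32, 37, 43, 50, 58, 67, 77, 90, 109, 139, 178, 210, 224]"

lemma ratio_ok_nodes: "list_all (\<lambda>(k, l). ratio_ok k l) (zip ratio_nodes (tl ratio_nodes))"
  by code_simp

definition cubic :: "real \<Rightarrow> real" where
  "cubic t = 1 - 6 * t\<^sup>2 + 4 * t ^ 3"

lemma cubic_antimono:
  assumes "0 \<le> p" "p \<le> t" "t \<le> 1"
  shows "cubic t \<le> cubic p"
proof -
  have "t\<^sup>2 \<le> t" "p\<^sup>2 \<le> p" using assms by (auto simp: power2_eq_square mult_left_le)
  moreover have "2 * (t * p) \<le> t\<^sup>2 + p\<^sup>2" using zero_le_power2[of "t - p"] by (simp add: power2_diff)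
  ultimately have "4 * t\<^sup>2 + 4 * (t * p) + 4 * p\<^sup>2 \<le> 6 * t + 6 * p" using assms by linarith
  then have "0 \<le> 6 * (t + p) - 4 * (t\<^sup>2 + t * p + p\<^sup>2)" by (simp only: distrib_left diff_ge_0_iff_ge)
  then have "0 \<le> (t - p) * (6 * (t + p) - 4 * (t\<^sup>2 + t * p + p\<^sup>2))" using assms by simp
  also have "\<dots> = cubic p - cubic t" by (simp add: cubic_def) algebra
  finally show ?thesis by simp
qed

text \<open>The cubic is the leading part of \<open>charge_poly\<close>. The lower order terms are
  at most \<open>1 / N + 2 / N ^ 2\<close> relative to \<open>N ^ 3\<close>, which is
  \<open>55 / 1000\<close> at \<open>N = 20\<close>.\<close>

lemma charge_poly_le:
  assumes N: "20 \<le> N" and D: "D \<le> N"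
  shows "charge_poly (real N) (real D) \<le> real N ^ 3 * (cubic (real D / real N) + 55 / 1000)"
proof -
  have "real N ^ 3 * cubic (real D / real N) = real N ^ 3 - 6 * real N * (real D)\<^sup>2 + 4 * real D ^ 3"
    using N by (simp add: cubic_def power_divide algebra_simps power2_eq_square power3_eq_cube)
  moreover have "(real N)\<^sup>2 + 2 * real N \<le> real N ^ 3 * (55 / 1000)"
  proof -
    have "20 * real N + 400 \<le> 22 * real N * 2" using N by simp
    have "0 \<le> (real N - 20) * (55 * real N + 100)" using N by simp
    then have "1000 * real N + 2000 \<le> 55 * real N * real N" by (simp add: algebra_simps)
    then have "(1000 * real N + 2000) * real N \<le> 55 * real N * real N * real N" by (intro mult_right_mono) auto
    then show ?thesis by (simp add: power2_eq_square power3_eq_cube algebra_simps)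
  qed
  ultimately show ?thesis by (simp add: charge_poly_def algebra_simps)
qed

text \<open>Rescaled form of the claim: \<open>172 / 100\<close> times the cubic in \<open>D / N\<close> bounds \<open>N\<close> times the source from below.\<close>

lemma end_source_gtI:
  assumes N: "20 \<le> N" and D: "D \<le> N"
    and gt: "172 / 100 * (cubic (real D / real N) + 55 / 1000) < real N * S"
  shows "172 / 100 * charge_poly (real N) (real D) < S * real N ^ 4"
proof -
  have "172 / 100 * charge_poly (real N) (real D) \<le> 172 / 100 * (real N ^ 3 * (cubic (real D / real N) + 55 / 1000))"
    by (intro mult_left_mono charge_poly_le[OF N D]) simp
  also have "\<dots> = real N ^ 3 * (172 / 100 * (cubic (real D / real N) + 55 / 1000))" by (rule mult.left_commute)
  also have "\<dots> < real N ^ 3 * (real N * S)" using gt N by (intro mult_strict_left_mono) auto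
  finally show ?thesis by (simp add: power_eq_if mult_ac)
qed

text \<open>For \<open>l \<le> 32\<close> one has \<open>t \<le> 1 / 2\<close>, where the cubic is
  nonnegative; the inequality is multiplied by \<open>D\<close> and \<open>t\<close> is bounded by
  its right end. Beyond, the cubic may be negative, so the multiplier is \<open>N\<close>, which
  leaves no factor \<open>t\<close> next to it. In both cases the cubic is evaluated at the left
  node.\<close>

lemma end_source_gt_ratio:
  assumes q: "path_game N q" and N: "20 \<le> N" and D: "1 \<le> D" "D < N"
    and kl: "16 \<le> k" "k \<le> l" "l \<le> 32 \<or> 32 \<le> k" "l \<le> 224" "ratio_ok k l"
    and r: "k * (N - D) \<le> 32 * D" "32 * D \<le> l * (N - D)"
  shows "172 / 100 * charge_poly (real N) (real D) < end_source N q (N - D) * real N ^ 4"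
proof (rule end_source_gtI[OF N])
  show "D \<le> N" using D by simp
  define x where "x = N - D"
  have x: "0 < real x" "real N = real x + real D" "0 < real D" using D by (auto simp: x_def)
  define m where "m = real_of_int (ratio_low l) / 10 ^ 6"
  define a where "a = m / real x"
  define S where "S = end_source N q (N - D)"
  define t where "t = real D / real N"
  have "32 * D \<le> l * x" "20 \<le> x + D" using r D N by (simp_all add: x_def)
  then have a: "\<forall>f. duel (N - D) D f \<longrightarrow> a \<le> f 1 D"
    using ratio_low_le[of x D _ l] D kl by (simp add: x_def a_def m_def)
  note L = end_source_lower[OF q D a, folded S_def]
  define s where "s = 32 + real k"
  have s: "0 < s" by (simp add: s_def)
  have "real (k * x) \<le> real (32 * D)" using r(1) unfolding x_def[symmetric] by (simp only: of_nat_le_iff)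
  then have kr: "real k * real x \<le> 32 * real D" by simp
  have "real (32 * D) \<le> real (l * x)" using r(2) unfolding x_def[symmetric] by (simp only: of_nat_le_iff)
  then have lr: "32 * real D \<le> real l * real x" by simp
  have t: "real k / s \<le> t" "t \<le> real l / (32 + real l)" "0 < t" "t \<le> 1"
    using kr lr x kl(1) by (simp_all add: t_def s_def x(2) divide_simps) (simp_all add: algebra_simps)
  define c where "c = cubic (real k / s) + 55 / 1000"
  have c: "cubic t + 55 / 1000 \<le> c" unfolding c_def using cubic_antimono[OF _ t(1,4)] s by simp
  have cs: "1720000 * (s ^ 3 - 6 * (real k)\<^sup>2 * s + 4 * real k ^ 3) + 94600 * s ^ 3 = 1720000 * c * s ^ 3"
    using s by (simp add: c_def cubic_def power_divide field_simps power2_eq_square power3_eq_cube)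
  have m: "real_of_int (ratio_low l) = 1000000 * m" by (simp add: m_def)
  have m0: "0 \<le> m" using kl(5) by (simp add: ratio_ok_def Let_def m_def)
  show "172 / 100 * (cubic (real D / real N) + 55 / 1000) < real N * end_source N q (N - D)"
    unfolding t_def[symmetric] S_def[symmetric]
  proof (cases "l \<le> 32")
    case True
    have "real_of_int (32 * (32 + int l) * (32 + int k) ^ 3 * 562500 + 32 * int l * (1720000 * ((32 + int k) ^ 3 - 6 * (int k)\<^sup>2 * (32 + int k) + 4 * int k ^ 3) + 94600 * (32 + int k) ^ 3))
        < real_of_int (int k * ratio_low l * (32 + int l) * (32 + int k) ^ 3)"
      using kl(5) True unfolding ratio_ok_def Let_def of_int_less_iff by simp
    then have "32 * (32 + real l) * s ^ 3 * 562500 + 32 * real l * (1720000 * c * s ^ 3) < real k * (1000000 * m) * (32 + real l) * s ^ 3"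
      by (simp only: of_int_add of_int_mult of_int_diff of_int_power of_int_numeral of_int_of_nat_eq m s_def[symmetric] cs)
    then have "(32 * (32 + real l) * 562500 + 32 * real l * (1720000 * c)) * s ^ 3 < (real k * (1000000 * m) * (32 + real l)) * s ^ 3"
      by (simp add: algebra_simps)
    then have "32 * (32 + real l) * 562500 + 32 * real l * (1720000 * c) < real k * (1000000 * m) * (32 + real l)"
      using s by (simp add: mult_less_cancel_right)
    then have key: "9 / 16 + (real l / (32 + real l)) * (172 / 100 * c) < real k / 32 * m"
      by (simp add: divide_simps) (simp add: algebra_simps)
    have "l * x \<le> 32 * x" using True by simp
    then have "D \<le> x" using \<open>32 * D \<le> l * x\<close> by linarith
    then have "2 * D \<le> N" by (simp add: x_def)
    from L(3)[OF this] have "real D * (a - 9 / (16 * real D)) \<le> real D * S" by (intro mult_left_mono) auto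
    then have "real D * a - 9 / 16 \<le> real D * S" using x by (simp add: right_diff_distrib)
    moreover have "real k / 32 * m \<le> real D * a"
    proof -
      have "real k / 32 \<le> real D / real x" using kr x by (simp add: divide_simps mult_ac)
      then have "real k / 32 * m \<le> real D / real x * m" using m0 by (rule mult_right_mono)
      then show ?thesis by (simp add: a_def)
    qed
    moreover have "t * (172 / 100 * (cubic t + 55 / 1000)) \<le> (real l / (32 + real l)) * (172 / 100 * c)"
    proof -
      have "real k / s \<le> 1 / 2" using kl(2) True by (simp add: s_def divide_simps)
      then have "cubic (1 / 2) \<le> cubic (real k / s)" using s by (intro cubic_antimono) auto
      then have "0 \<le> c" by (simp add: c_def cubic_def power2_eq_square power3_eq_cube)
      have "t * (172 / 100 * (cubic t + 55 / 1000)) \<le> t * (172 / 100 * c)" using c t by (intro mult_left_mono) auto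
      also have "\<dots> \<le> (real l / (32 + real l)) * (172 / 100 * c)" using t \<open>0 \<le> c\<close> by (intro mult_right_mono) auto
      finally show ?thesis .
    qed
    ultimately have "t * (172 / 100 * (cubic t + 55 / 1000)) < real D * S" using key by linarith
    also have "real D * S = t * (real N * S)" using x by (simp add: t_def)
    finally show "172 / 100 * (cubic t + 55 / 1000) < real N * S" using t by simp
  next
    case False
    then have k: "32 \<le> k" using kl(3) by simp
    have "real_of_int (500000 * (32 + int k) * 32 * (32 + int k) ^ 3 + int l * 125000 * int k * (32 + int k) ^ 3 + 32 * int k * (1720000 * ((32 + int k) ^ 3 - 6 * (int k)\<^sup>2 * (32 + int k) + 4 * int k ^ 3) + 94600 * (32 + int k) ^ 3))
        < real_of_int ((32 + int k) * ratio_low l * int k * (32 + int k) ^ 3)"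
      using kl(5) False unfolding ratio_ok_def Let_def of_int_less_iff by simp
    then have "500000 * s * 32 * s ^ 3 + real l * 125000 * real k * s ^ 3 + 32 * real k * (1720000 * c * s ^ 3) < s * (1000000 * m) * real k * s ^ 3"
      by (simp only: of_int_add of_int_mult of_int_diff of_int_power of_int_numeral of_int_of_nat_eq m s_def[symmetric] cs)
    then have "(500000 * s * 32 + real l * 125000 * real k + 32 * real k * (1720000 * c)) * s ^ 3 < (s * (1000000 * m) * real k) * s ^ 3"
      by (simp add: algebra_simps)
    then have "500000 * s * 32 + real l * 125000 * real k + 32 * real k * (1720000 * c) < s * (1000000 * m) * real k"
      using s by (simp add: mult_less_cancel_right)
    then have key: "s / (2 * real k) + real l / 256 + 172 / 100 * c < s / 32 * m"
      using k by (simp add: divide_simps) (simp add: algebra_simps)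
    have "32 * x \<le> k * x" using k by simp
    then have "x \<le> D" using r(1) unfolding x_def[symmetric] by linarith
    then have "N \<le> 2 * D" using D by (simp add: x_def)
    have NS: "real N * (a - 1 / (2 * real D) - real D / (8 * real N * (real N - real D))) \<le> real N * S"
      using L(4)[OF \<open>N \<le> 2 * D\<close>] by (intro mult_left_mono) auto
    have NSeq: "real N * (a - 1 / (2 * real D) - real D / (8 * real N * (real N - real D))) =
        real N * a - real N / (2 * real D) - real D / (8 * real x)"
    proof -
      have "real N - real D = real x" using x by simp
      moreover have "0 < real N" using x by simp
      ultimately show ?thesis using x(1,3) by (simp only: right_diff_distrib) simp
    qed
    have "s / 32 * m \<le> real N * a"
    proof -
      have "s / 32 \<le> real N / real x" using kr x by (simp add: s_def divide_simps) (simp add: algebra_simps)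
      then have "s / 32 * m \<le> real N / real x * m" using m0 by (rule mult_right_mono)
      then show ?thesis by (simp add: a_def)
    qed
    moreover have "real N / (2 * real D) \<le> s / (2 * real k)"
      using kr x k by (simp add: s_def divide_simps) (simp add: algebra_simps)
    moreover have "real D / (8 * real x) \<le> real l / 256"
      using lr x by (simp add: divide_simps mult_ac)
    ultimately show "172 / 100 * (cubic t + 55 / 1000) < real N * S" using key NS[unfolded NSeq] mult_left_mono[OF c, of "172 / 100"] by linarith
  qed
qed

text \<open>Reducing the width to \<open>2 * D\<close> gives the ratio \<open>16 / 32\<close> for
  every \<open>N\<close>. Two modes then yield \<open>f 1 D \<ge> 0.907 / D\<close>, and subtracting
  \<open>9 / (16 * D)\<close> leaves \<open>0.3445 / D\<close>.\<close>

lemma end_source_gt_far: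
  assumes q: "path_game N q" and N: "20 \<le> N" and D: "4 \<le> D" "2 * D \<le> N - D"
  shows "172 / 100 * charge_poly (real N) (real D) < end_source N q (N - D) * real N ^ 4"
proof (rule end_source_gtI[OF N])
  show "D \<le> N" using D by simp
  define e :: real where "e = 12338 / 10 ^ 4 / 64"
  define a where "a = ((2 - e) / (real_of_int (icosh_table 0 16) / 10 ^ 9) + (2 - 9 * e) / (real_of_int (icosh_table 1 16) / 10 ^ 9)) / real (2 * D)"
  define S where "S = end_source N q (N - D)"
  define t where "t = real D / real N"
  have D': "1 \<le> D" "D < N" using D by auto
  have "64 \<le> (real (2 * D))\<^sup>2" using D power_mono[of 8 "real (2 * D)" 2] by simp
  then have e: "12338 / 10 ^ 4 / (real (2 * D))\<^sup>2 \<le> e" unfolding e_def using D by (intro divide_left_mono) auto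
  have a: "\<forall>f. duel (N - D) D f \<longrightarrow> a \<le> f 1 D"
    unfolding a_def using D e by (intro allI impI duel_first_ge_ratio) (auto simp: e_def)
  have "icosh_table 0 16 = 1324747949" "icosh_table 1 16 = 5345164252" by code_simp+
  then have "1814 / 1000 / real (2 * D) \<le> a"
    unfolding a_def by (intro divide_right_mono) (auto simp: e_def)
  moreover have "a - 9 / (16 * real D) \<le> S"
    using end_source_lower(3)[OF q D' a] D by (simp add: S_def)
  ultimately have "real D * (1814 / 1000 / real (2 * D) - 9 / (16 * real D)) \<le> real D * S"
    by (intro mult_left_mono) auto
  then have S: "3445 / 10000 \<le> real D * S" using D by (simp add: right_diff_distrib)
  have "real (3 * D) \<le> real N" using D by (simp only: of_nat_le_iff)
  then have t: "0 < t" "t \<le> 1 / 3" using D by (simp_all add: t_def divide_simps)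
  have "t * (cubic t + 55 / 1000) \<le> 2 / 10"
  proof -
    \<comment> \<open>This is the tangent to \<open>t ^ 3\<close> at \<open>11 / 40\<close>, close
      to the point where \<open>1055 / 1000 * t - (6 - 4 / 3) * t ^ 3\<close> is largest.\<close>
    have "0 \<le> (t - 11 / 40)\<^sup>2 * (t + 22 / 40)" using t by simp
    also have "\<dots> = t ^ 3 - 363 / 1600 * t + 1331 / 32000" by (simp add: power2_eq_square power3_eq_cube field_simps)
    finally have "0 \<le> t ^ 3 - 363 / 1600 * t + 1331 / 32000" .
    moreover have "t * t ^ 3 \<le> 1 / 3 * t ^ 3" using t by (intro mult_right_mono) auto
    moreover have "t * (cubic t + 55 / 1000) = 1055 / 1000 * t - 6 * t ^ 3 + 4 * (t * t ^ 3)"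
      by (simp add: cubic_def power2_eq_square power3_eq_cube algebra_simps)
    ultimately show ?thesis using t by linarith
  qed
  then have "172 / 100 * (t * (cubic t + 55 / 1000)) \<le> 172 / 100 * (2 / 10)" by (intro mult_left_mono) auto
  also have "\<dots> < real D * S" using S by simp
  finally have "t * (172 / 100 * (cubic t + 55 / 1000)) < real D * S" by (simp only: mult.left_commute[of t])
  also have "real D * S = t * (real N * S)" using D' by (simp add: t_def)
  finally show "172 / 100 * (cubic (real D / real N) + 55 / 1000) < real N * end_source N q (N - D)"
    using t by (simp add: t_def[symmetric] S_def[symmetric])
qed

text \<open>For these \<open>D\<close> the cubic is so negative that \<open>f 1 D \<ge> 0\<close> is
  enough; the loss from \<open>H\<close> comes from the bound with
  \<open>(D / N) ^ 2\<close>.\<close>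

lemma end_source_gt_near:
  assumes q: "path_game N q" and N: "20 \<le> N" and D: "1 \<le> D" "D < N" "7 * (N - D) \<le> D"
  shows "172 / 100 * charge_poly (real N) (real D) < end_source N q (N - D) * real N ^ 4"
proof (rule end_source_gtI[OF N])
  show "D \<le> N" using D by simp
  define S where "S = end_source N q (N - D)"
  define t where "t = real D / real N"
  have a: "\<forall>f. duel (N - D) D f \<longrightarrow> 0 \<le> f 1 D" using D by (auto intro: duel_nonneg)
  note L = end_source_lower(5)[OF q D(1,2) a, folded S_def t_def]
  have pos: "0 < real D" "0 < real N" using D by auto
  have "7 * N \<le> 8 * D" using D by linarith
  then have "real (7 * N) \<le> real (8 * D)" by (simp only: of_nat_le_iff)
  then have t: "7 / 8 \<le> t" "t \<le> 1" using D by (simp_all add: t_def divide_simps)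
  have "2 / (real D + 1) - 1 / (2 * real D) \<le> 3 / (2 * real D)" using pos by (simp add: divide_simps)
  then have "t\<^sup>2 * (2 / (real D + 1) - 1 / (2 * real D)) \<le> t\<^sup>2 * (3 / (2 * real D))" by (intro mult_left_mono) auto
  then have "- ((1 - t\<^sup>2) / (2 * real D)) - t\<^sup>2 * (3 / (2 * real D)) \<le> S" using L by simp
  moreover have "(1 - t\<^sup>2) / (2 * real D) + t\<^sup>2 * (3 / (2 * real D)) = (1 + 2 * t\<^sup>2) / (2 * real D)"
    by (simp add: add_divide_distrib diff_divide_distrib)
  ultimately have "real D * (- ((1 + 2 * t\<^sup>2) / (2 * real D))) \<le> real D * S" by (intro mult_left_mono) auto
  moreover have "real D * (- ((1 + 2 * t\<^sup>2) / (2 * real D))) = - (1 / 2 + t\<^sup>2)" using pos by (simp add: field_simps)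
  ultimately have S: "- (1 / 2 + t\<^sup>2) \<le> real D * S" by simp
  have "t * (172 / 100 * (cubic t + 55 / 1000)) < - (1 / 2 + t\<^sup>2)"
  proof -
    \<comment> \<open>Expanded about \<open>7 / 8\<close>, the polynomial has a negative constant
      and linear part; \<open>u \<le> 1 / 8\<close> absorbs the positive higher powers into the
      linear term.\<close>
    define u where "u = t - 7 / 8"
    have u: "0 \<le> u" "u \<le> 1 / 8" "t = u + 7 / 8" using t by (auto simp: u_def)
    have "u * u \<le> 1 / 8 * u" using u by (intro mult_right_mono) auto
    moreover have "u * (u * u) \<le> 1 / 8 * (1 / 8 * u)" using u calculation by (intro mult_mono) auto
    moreover have "u * (u * (u * u)) \<le> 1 / 8 * (1 / 8 * (1 / 8 * u))" using u calculation by (intro mult_mono) auto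
    moreover have "t * (172 / 100 * (cubic t + 55 / 1000)) + (1 / 2 + t\<^sup>2) =
        172 / 25 * (u * (u * (u * u))) + 344 / 25 * (u * (u * u)) + 1103 / 200 * (u * u) - 17029 / 10000 * u - 17449 / 640000"
      unfolding u(3) cubic_def by (simp add: power2_eq_square power3_eq_cube field_simps)
    ultimately show ?thesis using u by linarith
  qed
  with S have "t * (172 / 100 * (cubic t + 55 / 1000)) < real D * S" by linarith
  also have "real D * S = t * (real N * S)" using pos by (simp add: t_def)
  finally show "172 / 100 * (cubic (real D / real N) + 55 / 1000) < real N * end_source N q (N - D)"
    using t by (simp add: t_def[symmetric] S_def[symmetric])
qed

text \<open>The thresholds give \<open>end_low N D \<ge> 100000\<close> for
  \<open>D = 1, 2, 3\<close>: 339200 is 100000 + 239200, and 287501 is 100000 + 562500 / 3 +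
  1.\<close>

lemma end_low_values: "first_low 2 1 \<ge> 100000" "first_low 4 2 \<ge> 339200" "first_low 6 3 \<ge> 287501"
  by code_simp+

text \<open>For small \<open>D\<close> the capped width \<open>2 * D\<close> makes the lower bound
  \<open>1 / 10\<close> independent of \<open>N\<close>, and \<open>20 / 10\<close> exceeds
  \<open>172 / 100 * (1 + 55 / 1000)\<close>.\<close>

lemma end_source_gt_boundary:
  assumes q: "path_game N q" and N: "20 \<le> N" and D: "1 \<le> D" "D \<le> 3"
  shows "172 / 100 * charge_poly (real N) (real D) < end_source N q (N - D) * real N ^ 4"
proof (rule end_source_gtI[OF N])
  show "D \<le> N" using D N by simp
  have "cubic (real D / real N) \<le> cubic 0" using D N by (intro cubic_antimono) auto
  then have "cubic (real D / real N) \<le> 1" by (simp add: cubic_def)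
  moreover have "1 / 10 \<le> end_source N q (N - D)"
  proof -
    have "D = 1 \<or> D = 2 \<or> D = 3" using D by auto
    moreover have "min (N - D) (2 * D) = 2 * D" using D N by auto
    ultimately have "100000 \<le> end_low N D" using end_low_values N by (auto simp: end_low_def Let_def le_max_iff_disj)
    then have "1 / 10 \<le> real_of_int (end_low N D) / 10 ^ 6" by simp
    then show ?thesis using end_low_le[OF q D(1)] D N by simp
  qed
  then have "20 * (1 / 10) \<le> real N * end_source N q (N - D)" using N by (intro mult_mono) auto
  ultimately show "172 / 100 * (cubic (real D / real N) + 55 / 1000) < real N * end_source N q (N - D)" by simp
qed

lemma consecutive_interval:
  fixes x y :: nat
  assumes "k * x \<le> y" "y \<le> last (l # ns) * x"
  shows "\<exists>(a, b) \<in> set (zip (k # l # ns) (l # ns)). a * x \<le> y \<and> y \<le> b * x"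
  using assms
proof (induction ns arbitrary: k l)
  case (Cons m ns)
  show ?case
  proof (cases "y \<le> l * x")
    case True
    then show ?thesis using Cons.prems by auto
  next
    case False
    then have "\<exists>(a, b) \<in> set (zip (l # m # ns) (m # ns)). a * x \<le> y \<and> y \<le> b * x"
      using Cons.prems by (intro Cons.IH) auto
    then show ?thesis by auto
  qed
qed simp

lemma end_source_gt_large:
  assumes q: "path_game N q" and N: "20 \<le> N" and D: "1 \<le> D" "D < N"
  shows "172 / 100 * charge_poly (real N) (real D) < end_source N q (N - D) * real N ^ 4"
proof -
  define x where "x = N - D"
  consider "D \<le> 3" | "4 \<le> D" "2 * D \<le> x" | "7 * x \<le> D" | "x \<le> 2 * D" "D \<le> 7 * x" by linarith
  then show ?thesis
  proof cases
    case 4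
    have piece: ?thesis if "k * x \<le> 32 * D" "32 * D \<le> l * x" "(k, l) \<in> set (zip ratio_nodes (tl ratio_nodes))" for k l
    proof (rule end_source_gt_ratio[OF q N D])
      show "ratio_ok k l" using ratio_ok_nodes that(3) by (auto simp: list_all_iff)
      show "16 \<le> k" "k \<le> l" "l \<le> 32 \<or> 32 \<le> k" "l \<le> 224" using that(3) by (auto simp: ratio_nodes_def)
      show "k * (N - D) \<le> 32 * D" "32 * D \<le> l * (N - D)" using that by (simp_all add: x_def)
    qed
    have "\<exists>(k, l) \<in> set (zip (16 # 17 # tl (tl ratio_nodes)) (17 # tl (tl ratio_nodes))). k * x \<le> 32 * D \<and> 32 * D \<le> l * x"
      using 4 by (intro consecutive_interval) (auto simp: ratio_nodes_def)
    then obtain k l where "(k, l) \<in> set (zip (16 # 17 # tl (tl ratio_nodes)) (17 # tl (tl ratio_nodes)))"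
      "k * x \<le> 32 * D" "32 * D \<le> l * x" by blast
    moreover have "ratio_nodes = 16 # 17 # tl (tl ratio_nodes)" "tl ratio_nodes = 17 # tl (tl ratio_nodes)"
      by (simp_all add: ratio_nodes_def)
    ultimately show ?thesis using piece[of k l] by metis
  next
    case 1
    then show ?thesis by (intro end_source_gt_boundary[OF q N D(1)])
  next
    case 2
    then show ?thesis by (intro end_source_gt_far[OF q N]) (auto simp: x_def)
  next
    case 3
    then show ?thesis by (intro end_source_gt_near[OF q N D]) (auto simp: x_def)
  qed
qed

lemma small_ok_four_five: "small_ok 4 1" "small_ok 5 1" "small_ok 5 3" "small_ok 5 4"
  by code_simp+

lemma small_ok_range_6: "list_all (\<lambda>N. list_all (small_ok N) [1..<N]) [6..<10]"
  by code_simp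

lemma small_ok_range_10: "list_all (\<lambda>N. list_all (small_ok N) [1..<N]) [10..<12]"
  by code_simp

lemma small_ok_range_12: "list_all (\<lambda>N. list_all (small_ok N) [1..<N]) [12..<14]"
  by code_simp

lemma small_ok_range_14: "list_all (\<lambda>N. list_all (small_ok N) [1..<N]) [14..<15]"
  by code_simp

lemma small_ok_range_15: "list_all (\<lambda>N. list_all (small_ok N) [1..<N]) [15..<16]"
  by code_simp

lemma small_ok_range_16: "list_all (\<lambda>N. list_all (small_ok N) [1..<N]) [16..<17]"
  by code_simp

lemma small_ok_range_17: "list_all (\<lambda>N. list_all (small_ok N) [1..<N]) [17..<18]"
  by code_simp

lemma small_ok_range_18: "list_all (\<lambda>N. list_all (small_ok N) [1..<N]) [18..<19]"
  by code_simp

lemma small_ok_range_19: "list_all (\<lambda>N. list_all (small_ok N) [1..<N]) [19..<20]"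
  by code_simp

lemma small_ok_range:
  assumes "6 \<le> N" "N < 20" "1 \<le> D" "D < N"
  shows "small_ok N D"
proof -
  have range: "small_ok N D" if "list_all (\<lambda>N. list_all (small_ok N) [1..<N]) [a..<b]" "a \<le> N" "N < b" for a b
    using that assms(3,4) by (auto simp: list_all_iff)
  consider "6 \<le> N" "N < 10" | "10 \<le> N" "N < 12" | "12 \<le> N" "N < 14" | "14 \<le> N" "N < 15" | "15 \<le> N" "N < 16" | "16 \<le> N" "N < 17" | "17 \<le> N" "N < 18" | "18 \<le> N" "N < 19" | "19 \<le> N" "N < 20"
    using assms(1,2) by linarith
  then show ?thesis
  proof cases
    case 1 then show ?thesis by (rule range[OF small_ok_range_6])
 next
    case 2 then show ?thesis by (rule range[OF small_ok_range_10])
 next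
    case 3 then show ?thesis by (rule range[OF small_ok_range_12])
 next
    case 4 then show ?thesis by (rule range[OF small_ok_range_14])
 next
    case 5 then show ?thesis by (rule range[OF small_ok_range_15])
 next
    case 6 then show ?thesis by (rule range[OF small_ok_range_16])
 next
    case 7 then show ?thesis by (rule range[OF small_ok_range_17])
 next
    case 8 then show ?thesis by (rule range[OF small_ok_range_18])
 next
    case 9 then show ?thesis by (rule range[OF small_ok_range_19])

  qed
qed


lemma end_source_gt:
  assumes q: "path_game N q" and N: "2 \<le> N" and D: "1 \<le> D" "D < N"
  shows "172 / 100 * charge_poly (real N) (real D) < end_source N q (N - D) * real N ^ 4"
proof -
  consider "N = 2" | "N = 3" | "N = 4" | "N = 5" | "6 \<le> N" "N < 20" | "20 \<le> N" using N by linarith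
  then show ?thesis
  proof cases
    case 1
    then show ?thesis using end_source_gt_two q D by (metis One_nat_def Suc_1 le_antisym less_Suc_eq_le)
  next
    case 2
    then have "D = 1 \<or> D = 2" using D by auto
    then show ?thesis using end_source_gt_three q 2 by blast
  next
    case 3
    then consider "D = 1" | "D = 2 \<or> D = 3" using D by linarith
    then show ?thesis
    proof cases
      case 1
      then show ?thesis using small_okD[OF q D] small_ok_four_five(1) 3 by simp
    next
      case 2
      then show ?thesis using end_source_gt_four q 3 by blast
    qed
  next
    case 4
    then consider "D = 1" | "D = 2" | "D = 3" | "D = 4" using D by linarith
    then show ?thesis
    proof cases
      case 2
      then show ?thesis using end_source_gt_five q 4 by blast
    qed (use small_okD[OF q D] small_ok_four_five 4 in auto)
  next
    case 5
    have "small_ok N D" using 5 D by (intro small_ok_range)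
    then show ?thesis by (rule small_okD[OF q D])
  next
    case 6
    then show ?thesis by (intro end_source_gt_large[OF q _ D])
  qed
qed

lemma path_adv_central_pos:
  assumes q: "path_game N q" and xy: "x < y" "y \<le> N" "N < x + y" "N \<le> 2 * x + 1"
  shows "0 < path_adv N q x y"
proof (cases "2 \<le> N")
  case True
  show ?thesis
  proof (rule path_adv_pos[OF q _ _ xy])
    \<comment> \<open>The factor is \<open>172 / 100\<close> divided by 8, since the barrier charge
      is \<open>8 * charge_poly\<close>.\<close>
    show "0 < 215 / 1000 / real N ^ 4" using True by simp
    fix z assume z: "1 \<le> z" "z < N"
    have "172 / 100 * charge_poly (real N) (real (N - z)) < end_source N q (N - (N - z)) * real N ^ 4"
      by (rule end_source_gt[OF q True]) (use z in auto)
    moreover have "barrier_charge N z = 8 * charge_poly (real N) (real (N - z))"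
      using barrier_charge_eq[of "N - z" N] z by simp
    ultimately have "215 / 1000 * barrier_charge N z < end_source N q z * real N ^ 4" using z by simp
    then show "215 / 1000 / real N ^ 4 * barrier_charge N z < end_source N q z"
      using True by (simp add: divide_simps mult_ac)
  qed
next
  case False
  then show ?thesis using xy by linarith
qed

section \<open>Equilibria\<close>

locale dominated_game =
  fixes V :: "'a set" and E :: "'a \<Rightarrow> 'a \<Rightarrow> bool" and C :: "'a set"
  assumes fin: "finite V" and C: "C \<subseteq> V" "C \<noteq> {}"
    and antisym: "\<And>a b. a \<in> V \<Longrightarrow> b \<in> V \<Longrightarrow> advantage V E b a = - advantage V E a b"
    and even_match: "\<And>a b. a \<in> C \<Longrightarrow> b \<in> C \<Longrightarrow> advantage V E a b = 0"
    and beats: "\<And>a b. a \<in> C \<Longrightarrow> b \<in> V - C \<Longrightarrow> 0 < advantage V E a b"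
begin

abbreviation "A \<equiv> advantage V E"

lemma A_nonneg: "a \<in> C \<Longrightarrow> b \<in> V \<Longrightarrow> 0 \<le> A a b"
  using even_match[of a b] beats[of a b] by (cases "b \<in> C") auto

lemma A_nonpos: "a \<in> V \<Longrightarrow> b \<in> C \<Longrightarrow> A a b \<le> 0"
proof -
  assume ab: "a \<in> V" "b \<in> C"
  then have "b \<in> V" using C by auto
  then show ?thesis using A_nonneg[OF ab(2,1)] antisym[OF \<open>b \<in> V\<close> ab(1)] by linarith
qed

lemma A_pos_iff: "a \<in> C \<Longrightarrow> b \<in> V \<Longrightarrow> A a b = 0 \<longleftrightarrow> b \<in> C"
  using even_match[of a b] beats[of a b] by (cases "b \<in> C") auto

lemma safe_vertices_eq: "safe_vertices V E = C"
proof -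
  have "a \<in> C" if "a \<in> V" "\<forall>b\<in>V. 0 \<le> A a b" for a
  proof -
    obtain c where c: "c \<in> C" "c \<in> V" using C by auto
    have "0 \<le> A a c" using that c by blast
    then have "A c a \<le> 0" using antisym[OF that(1) c(2)] by linarith
    then show ?thesis using beats[OF c(1), of a] that(1) by (meson DiffI not_le)
  qed
  moreover have "a \<in> V \<and> (\<forall>b\<in>V. 0 \<le> A a b)" if "a \<in> C" for a using A_nonneg[OF that] C that by auto
  ultimately show ?thesis unfolding safe_vertices_def by blast
qed

lemma sum_pmf_prob_on:
  assumes "\<mu> \<in> prob_on V"
  shows "(\<Sum>a\<in>V. pmf \<mu> a) = 1"
  using assms fin by (intro sum_pmf_eq_1) (auto simp: prob_on_def)

lemma pmf_outside:
  assumes "\<mu> \<in> prob_on C" "a \<notin> C"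
  shows "pmf \<mu> a = 0"
proof -
  have "a \<notin> set_pmf \<mu>" using assms by (auto simp: prob_on_def)
  then show ?thesis by (simp only: set_pmf_iff not_not)
qed

text \<open>All terms are nonnegative, so a sum that is not positive forces each to vanish, and
  \<open>A c\<close> vanishes only on \<open>C\<close>.\<close>

lemma supported_iff:
  assumes \<mu>: "\<mu> \<in> prob_on V" and c: "c \<in> C"
  shows "0 \<le> (\<Sum>a\<in>V. pmf \<mu> a * A c a)" "(\<Sum>a\<in>V. pmf \<mu> a * A c a) \<le> 0 \<Longrightarrow> \<mu> \<in> prob_on C"
proof -
  have nn: "0 \<le> pmf \<mu> a * A c a" if "a \<in> V" for a using A_nonneg[OF c that] by simp
  show "0 \<le> (\<Sum>a\<in>V. pmf \<mu> a * A c a)" using nn by (rule sum_nonneg)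
  assume "(\<Sum>a\<in>V. pmf \<mu> a * A c a) \<le> 0"
  moreover have "0 \<le> (\<Sum>a\<in>V. pmf \<mu> a * A c a)" using nn by (rule sum_nonneg)
  ultimately have "(\<Sum>a\<in>V. pmf \<mu> a * A c a) = 0" by linarith
  moreover have "(\<Sum>a\<in>V. pmf \<mu> a * A c a) = 0 \<longleftrightarrow> (\<forall>a\<in>V. pmf \<mu> a * A c a = 0)"
    by (rule sum_nonneg_eq_0_iff[OF fin nn])
  ultimately have z: "\<forall>a\<in>V. pmf \<mu> a * A c a = 0" by (rule iffD1[rotated])
  have "a \<in> C" if a: "a \<in> set_pmf \<mu>" for a
  proof -
    have "a \<in> V" using a \<mu> by (auto simp: prob_on_def)
    then have "pmf \<mu> a * A c a = 0" using z by blast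
    moreover have "pmf \<mu> a \<noteq> 0" using a unfolding set_pmf_iff .
    ultimately show ?thesis using A_pos_iff[OF c \<open>a \<in> V\<close>] by simp
  qed
  then show "\<mu> \<in> prob_on C" by (auto simp: prob_on_def)
qed

lemma optimal_strategies_eq: "optimal_strategies V E = prob_on C"
proof (intro equalityI subsetI)
  fix \<mu> assume "\<mu> \<in> optimal_strategies V E"
  then have \<mu>: "\<mu> \<in> prob_on V" "\<forall>b\<in>V. 0 \<le> (\<Sum>a\<in>V. pmf \<mu> a * A a b)" by (auto simp: optimal_strategies_def)
  obtain c where c: "c \<in> C" "c \<in> V" using C by auto
  have "(\<Sum>a\<in>V. pmf \<mu> a * A c a) = (\<Sum>a\<in>V. - (pmf \<mu> a * A a c))"
  proof (rule sum.cong)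
    fix a assume "a \<in> V"
    then show "pmf \<mu> a * A c a = - (pmf \<mu> a * A a c)" using antisym[of a c] c by simp
  qed simp
  also have "\<dots> \<le> 0" using \<mu>(2) c by (simp add: sum_negf)
  finally show "\<mu> \<in> prob_on C" by (rule supported_iff(2)[OF \<mu>(1) c(1)])
next
  fix \<mu> assume \<mu>: "\<mu> \<in> prob_on C"
  have "0 \<le> (\<Sum>a\<in>V. pmf \<mu> a * A a b)" if "b \<in> V" for b
  proof (rule sum_nonneg)
    fix a assume "a \<in> V"
    show "0 \<le> pmf \<mu> a * A a b"
      using A_nonneg[of a b] that pmf_outside[OF \<mu>, of a] by (cases "a \<in> C") auto
  qed
  moreover have "\<mu> \<in> prob_on V" using \<mu> C unfolding prob_on_def by blast
  ultimately show "\<mu> \<in> optimal_strategies V E" unfolding optimal_strategies_def by blast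
qed

text \<open>Each player can secure at least 0 by moving to some \<open>c\<close> in
  \<open>C\<close>, and the two advantages sum to 0; hence both are 0 and \<open>c\<close> ties with
  \<open>a\<close> and with \<open>b\<close>.\<close>

lemma PNE_eq: "PNE V E = C \<times> C"
proof (intro equalityI subsetI)
  fix p assume "p \<in> PNE V E"
  then obtain a b where p: "p = (a, b)" "a \<in> V" "b \<in> V"
    and n: "\<forall>a'\<in>V. A a' b \<le> A a b" "\<forall>b'\<in>V. A b' a \<le> A b a"
    by (auto simp: PNE_def advantage_def)
  obtain c where c: "c \<in> C" "c \<in> V" using C by auto
  have "0 \<le> A c b" "0 \<le> A c a" using A_nonneg c p by auto
  moreover have "A c b \<le> A a b" "A c a \<le> A b a" using n c by blast+
  ultimately have "A c b = 0" "A c a = 0" using antisym[OF p(2,3)] by linarith+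
  then show "p \<in> C \<times> C" using A_pos_iff c p by auto
next
  fix p assume "p \<in> C \<times> C"
  then obtain a b where p: "p = (a, b)" "a \<in> C" "b \<in> C" by auto
  then have "\<forall>a'\<in>V. A a' b \<le> A a b" "\<forall>b'\<in>V. A b' a \<le> A b a"
    using A_nonpos[of _ b] A_nonpos[of _ a] even_match[of a b] even_match[of b a] by simp_all
  then show "p \<in> PNE V E" using p C by (auto simp: PNE_def advantage_def)
qed

definition mixed_adv :: "'a pmf \<Rightarrow> 'a pmf \<Rightarrow> real" where
  "mixed_adv \<mu> \<nu> = (\<Sum>a\<in>V. \<Sum>b\<in>V. pmf \<mu> a * pmf \<nu> b * A a b)"

lemma mixed_payoff_eq:
  assumes "\<mu> \<in> prob_on V" "\<nu> \<in> prob_on V"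
  shows "mixed_payoff V E \<mu> \<nu> = mixed_adv \<mu> \<nu> + real (card V) / 2"
proof -
  have "mixed_payoff V E \<mu> \<nu> = (\<Sum>p\<in>V \<times> V. (case p of (a, b) \<Rightarrow> payoff V E a b) * pmf (pair_pmf \<mu> \<nu>) p)"
    unfolding mixed_payoff_def
    by (rule integral_measure_pmf_real) (use assms fin in \<open>auto simp: prob_on_def\<close>)
  also have "\<dots> = (\<Sum>a\<in>V. \<Sum>b\<in>V. pmf \<mu> a * pmf \<nu> b * A a b + (real (card V) / 2) * (pmf \<mu> a * pmf \<nu> b))"
    unfolding sum.cartesian_product by (intro sum.cong) (auto simp: pmf_pair advantage_def algebra_simps)
  also have "\<dots> = mixed_adv \<mu> \<nu> + (real (card V) / 2) * ((\<Sum>a\<in>V. pmf \<mu> a) * (\<Sum>b\<in>V. pmf \<nu> b))"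
    by (simp only: mixed_adv_def sum.distrib sum_distrib_left[symmetric] sum_product)
  finally show ?thesis using sum_pmf_prob_on[OF assms(1)] sum_pmf_prob_on[OF assms(2)] by simp
qed

lemma mixed_adv_antisym: "mixed_adv \<nu> \<mu> = - mixed_adv \<mu> \<nu>"
proof -
  have "mixed_adv \<nu> \<mu> = (\<Sum>a\<in>V. \<Sum>b\<in>V. pmf \<nu> b * pmf \<mu> a * A b a)"
    unfolding mixed_adv_def by (rule sum.swap)
  also have "\<dots> = (\<Sum>a\<in>V. \<Sum>b\<in>V. - (pmf \<mu> a * pmf \<nu> b * A a b))"
  proof (intro sum.cong refl)
    fix a b assume "a \<in> V" "b \<in> V"
    then show "pmf \<nu> b * pmf \<mu> a * A b a = - (pmf \<mu> a * pmf \<nu> b * A a b)" using antisym[of a b] by simp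
  qed
  finally show ?thesis by (simp add: mixed_adv_def sum_negf)
qed

lemma mixed_adv_return:
  assumes "c \<in> V"
  shows "mixed_adv (return_pmf c) \<nu> = (\<Sum>b\<in>V. pmf \<nu> b * A c b)"
proof -
  have "mixed_adv (return_pmf c) \<nu> = (\<Sum>a\<in>V. if a = c then \<Sum>b\<in>V. pmf \<nu> b * A c b else 0)"
    unfolding mixed_adv_def by (intro sum.cong) (auto simp: pmf_return)
  then show ?thesis using assms fin by simp
qed

lemma mixed_adv_nonneg:
  assumes "\<mu> \<in> prob_on C"
  shows "0 \<le> mixed_adv \<mu> \<nu>"
  unfolding mixed_adv_def
proof (intro sum_nonneg)
  fix a b assume "a \<in> V" "b \<in> V"
  then show "0 \<le> pmf \<mu> a * pmf \<nu> b * A a b"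
    using A_nonneg[of a b] pmf_outside[OF assms, of a] by (cases "a \<in> C") auto
qed

text \<open>The argument for pure equilibria, with the point mass at a vertex of \<open>C\<close> as
  the deviation and \<open>supported_iff\<close> in place of the tie criterion.\<close>

lemma MNE_eq: "MNE V E = prob_on C \<times> prob_on C"
proof (intro equalityI subsetI)
  fix p assume "p \<in> MNE V E"
  then obtain \<mu> \<nu> where p: "p = (\<mu>, \<nu>)" "\<mu> \<in> prob_on V" "\<nu> \<in> prob_on V"
    and n: "\<forall>\<mu>'\<in>prob_on V. mixed_payoff V E \<mu>' \<nu> \<le> mixed_payoff V E \<mu> \<nu>"
      "\<forall>\<nu>'\<in>prob_on V. mixed_payoff V E \<nu>' \<mu> \<le> mixed_payoff V E \<nu> \<mu>" by (auto simp: MNE_def)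
  obtain c where c: "c \<in> C" "c \<in> V" using C by auto
  then have d: "return_pmf c \<in> prob_on V" by (simp add: prob_on_def)
  have "mixed_adv (return_pmf c) \<nu> \<le> mixed_adv \<mu> \<nu>" "mixed_adv (return_pmf c) \<mu> \<le> mixed_adv \<nu> \<mu>"
    using bspec[OF n(1) d] bspec[OF n(2) d] by (simp_all add: mixed_payoff_eq p d)
  moreover have "0 \<le> mixed_adv (return_pmf c) \<nu>" "0 \<le> mixed_adv (return_pmf c) \<mu>"
    using supported_iff(1)[OF p(3) c(1)] supported_iff(1)[OF p(2) c(1)] by (simp_all only: mixed_adv_return[OF c(2)])
  ultimately have "mixed_adv (return_pmf c) \<nu> \<le> 0" "mixed_adv (return_pmf c) \<mu> \<le> 0"
    using mixed_adv_antisym[of \<mu> \<nu>] by linarith+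
  then have "\<mu> \<in> prob_on C" "\<nu> \<in> prob_on C"
    using supported_iff(2)[OF p(2) c(1)] supported_iff(2)[OF p(3) c(1)] by (simp_all only: mixed_adv_return[OF c(2)])
  then show "p \<in> prob_on C \<times> prob_on C" using p by simp
next
  fix p assume "p \<in> prob_on C \<times> prob_on C"
  then obtain \<mu> \<nu> where p: "p = (\<mu>, \<nu>)" "\<mu> \<in> prob_on C" "\<nu> \<in> prob_on C" by auto
  then have V: "\<mu> \<in> prob_on V" "\<nu> \<in> prob_on V" using C by (auto simp: prob_on_def)
  have "mixed_adv \<mu> \<nu> = 0" "mixed_adv \<nu> \<mu> = 0"
    using mixed_adv_nonneg[OF p(2), of \<nu>] mixed_adv_nonneg[OF p(3), of \<mu>] mixed_adv_antisym[of \<mu> \<nu>] by linarith+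
  moreover have le: "mixed_adv \<rho> \<nu> \<le> 0" "mixed_adv \<rho> \<mu> \<le> 0" for \<rho>
    using mixed_adv_nonneg[OF p(3), of \<rho>] mixed_adv_nonneg[OF p(2), of \<rho>] mixed_adv_antisym[of \<rho> \<nu>] mixed_adv_antisym[of \<rho> \<mu>] by linarith+
  ultimately have "\<forall>\<mu>'\<in>prob_on V. mixed_payoff V E \<mu>' \<nu> \<le> mixed_payoff V E \<mu> \<nu>"
    "\<forall>\<nu>'\<in>prob_on V. mixed_payoff V E \<nu>' \<mu> \<le> mixed_payoff V E \<nu> \<mu>"
    using V by (simp_all add: mixed_payoff_eq le)
  then show "p \<in> MNE V E" using V by (simp add: MNE_def p(1))
qed

end

section \<open>Paths as dominated games\<close>

lemma central_vertices_iff: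
  assumes "1 \<le> n"
  shows "c \<in> central_vertices n \<longleftrightarrow> n \<le> 2 * c + 2 \<and> 2 * c \<le> n"
proof
  assume "c \<in> central_vertices n"
  then show "n \<le> 2 * c + 2 \<and> 2 * c \<le> n" by (auto simp: central_vertices_def)
next
  assume "n \<le> 2 * c + 2 \<and> 2 * c \<le> n"
  then have "n = 2 * c + 1 \<or> n = 2 * c \<or> n = 2 * (c + 1)" by presburger
  then consider "n = 2 * c + 1" | "n = 2 * c" | "n = 2 * (c + 1)" by blast
  then show "c \<in> central_vertices n"
  proof cases
    case 2
    then have "n = 2 * c \<and> 1 \<le> c" using assms by linarith
    then show ?thesis unfolding central_vertices_def by blast
  next
    case 3
    then have "n = 2 * (c + 1) \<and> 1 \<le> c + 1 \<and> c = c + 1 - 1" by simp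
    then show ?thesis unfolding central_vertices_def by blast
  qed (auto simp: central_vertices_def)
qed

lemma card_central_vertices:
  assumes "1 \<le> n"
  shows "card (central_vertices n) = (if odd n then 1 else 2)"
proof (cases "odd n")
  case True
  then obtain m where m: "n = 2 * m + 1" by (rule oddE)
  have "central_vertices n = {m}"
    by (rule set_eqI, unfold central_vertices_iff[OF assms] singleton_iff) (use m in presburger)
  then show ?thesis using True by simp
next
  case False
  then obtain m where m: "n = 2 * m" by auto
  then have "1 \<le> m" using assms by linarith
  then have "central_vertices n = {m - 1, m}"
    by (intro set_eqI, unfold central_vertices_iff[OF assms] insert_iff empty_iff) (use m in presburger)
  then show ?thesis using False \<open>1 \<le> m\<close> by simp
qed

lemma advantage_path:
  "advantage (path_verts (Suc N)) path_adj a b = path_adv N (first_hit_prob (path_verts (Suc N)) path_adj) a b"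
proof -
  define q where "q = first_hit_prob (path_verts (Suc N)) path_adj"
  have V: "path_verts (Suc N) = {..N}" by (auto simp: path_verts_def)
  have "advantage (path_verts (Suc N)) path_adj a b = (\<Sum>z\<in>path_verts (Suc N). q z a b) - real (card (path_verts (Suc N))) / 2"
    unfolding advantage_def payoff_def q_def ..
  then show ?thesis unfolding q_def[symmetric] by (simp add: path_adv_def V add.commute)
qed

lemma dominated_game_singleton: "dominated_game (path_verts 1) path_adj (central_vertices 1)"
proof -
  have "ennreal (first_hit_prob (path_verts 1) path_adj 0 0 0) = ennreal (1 / 2)"
    unfolding first_hit_prob_eq by (rule duel_value_boundary(1))
  then have "first_hit_prob (path_verts 1) path_adj 0 0 0 = 1 / 2"
    using first_hit_prob_nonneg[of "path_verts 1" path_adj 0 0 0] by (subst (asm) ennreal_inj) auto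
  moreover have V: "path_verts 1 = {0}" by (auto simp: path_verts_def)
  ultimately have "advantage (path_verts 1) path_adj 0 0 = 0"
    by (simp add: advantage_def payoff_def)
  moreover have "central_vertices 1 = {0}"
    by (rule set_eqI, unfold central_vertices_iff[OF order_refl] singleton_iff) presburger
  ultimately show ?thesis using V by unfold_locales auto
qed

lemma dominated_game_path:
  assumes n: "1 \<le> n"
  shows "dominated_game (path_verts n) path_adj (central_vertices n)"
proof (cases "n = 1")
  case True
  then show ?thesis using dominated_game_singleton by simp
next
  case False
  define N where "N = n - 1"
  have N: "1 \<le> N" "n = Suc N" using n False by (auto simp: N_def)
  define q where "q = first_hit_prob (path_verts (Suc N)) path_adj"
  have q: "path_game N q" unfolding q_def by (rule path_game_first_hit_prob[OF N(1)])
  have adv: "advantage (path_verts n) path_adj a b = path_adv N q a b" for a b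
    unfolding N(2) q_def by (rule advantage_path)
  have V: "x \<in> path_verts n \<longleftrightarrow> x \<le> N" for x using N(2) by (auto simp: path_verts_def)
  have C: "c \<in> central_vertices n \<longleftrightarrow> N \<le> 2 * c + 1 \<and> 2 * c \<le> N + 1" for c
    using central_vertices_iff[OF n, of c] N(2) by auto
  show ?thesis
  proof unfold_locales
    show "finite (path_verts n)" by (simp add: path_verts_def)
    show "central_vertices n \<subseteq> path_verts n" using N(1) by (auto simp: V C)
    have "n div 2 \<in> central_vertices n" unfolding central_vertices_iff[OF n] by linarith
    then show "central_vertices n \<noteq> {}" by blast
    show "advantage (path_verts n) path_adj b a = - advantage (path_verts n) path_adj a b"
      if "a \<in> path_verts n" "b \<in> path_verts n" for a b
      unfolding adv using that V by (intro path_adv_swap[OF q]) auto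
    show "advantage (path_verts n) path_adj a b = 0" if "a \<in> central_vertices n" "b \<in> central_vertices n" for a b
    proof -
      \<comment> \<open>Two central vertices are equal or mirror images, so the pair lies where the
        advantage vanishes by symmetry.\<close>
      have "b = a \<or> b = N - a" "a \<le> N" using that N(1) unfolding C by linarith+
      then show ?thesis unfolding adv using path_adv_diag[OF q] path_adv_antidiag[OF q] by blast
    qed
    show "0 < advantage (path_verts n) path_adj a b"
      if a: "a \<in> central_vertices n" and b: "b \<in> path_verts n - central_vertices n" for a b
    proof (cases "a < b")
      case True
      have "b \<le> N" "N < a + b" "N \<le> 2 * a + 1" using a b True unfolding C V Diff_iff by linarith+
      then show ?thesis unfolding adv by (intro path_adv_central_pos[OF q True])
    next
      case False
      \<comment> \<open>A noncentral vertex to the left of \<open>a\<close> is mirrored into the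
        triangle treated before.\<close>
      have ab: "a \<le> N" "b \<le> N" "b < a" "a + b < N" "2 * a \<le> N + 1"
        using a b False N(1) unfolding C V Diff_iff by linarith+
      then have "0 < path_adv N q (N - a) (N - b)" by (intro path_adv_central_pos[OF q]) auto
      then show ?thesis unfolding adv path_adv_reflect[OF q ab(1,2)] .
    qed
  qed
qed

theorem theorem6p1:
  fixes n :: nat and V C :: "nat set"
  assumes "n \<ge> 1"
  defines "V \<equiv> path_verts n"
  defines "C \<equiv> safe_vertices V path_adj"
  shows "(C = central_vertices n \<and> (odd n \<longrightarrow> card C = 1) \<and> (even n \<longrightarrow> card C = 2))
    \<and> (\<forall>c \<in> central_vertices n. \<forall>b \<in> V - central_vertices n. advantage V path_adj c b > 0)
    \<and> (optimal_strategies V path_adj = prob_on C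
       \<and> PNE V path_adj = C \<times> C
       \<and> MNE V path_adj = prob_on C \<times> prob_on C)"
proof -
  interpret dominated_game V path_adj "central_vertices n"
    unfolding V_def by (rule dominated_game_path) (rule assms(1))
  have C: "C = central_vertices n" unfolding C_def by (rule safe_vertices_eq)
  show ?thesis
    using card_central_vertices[OF assms(1)] beats optimal_strategies_eq PNE_eq MNE_eq unfolding C by auto
qed

end
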